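(* Let $N\ge n\ge2$ and let $X_1,\dots,X_n:\Omega\to M_{N\times N}(\mathbb{C})$ be random matrices. Suppose there is a subset $\emptyset\ne I\subsetneq[n]$ such that the family $(X_k)_{k\in I}$ is independent from and orthogonally in general position to the family $(X_k)_{k\notin I}$. Then for every $\pi\in\mathit{PM}(n)$ the vertex cumulant vanishes: $$K_\pi(X_1,\dots,X_n)=0.$$
   Context: Random matrices have entries with finite moments of all orders. The family $(X_k)_{k\in I}$ is independent from and orthogonally in general position to $(X_k)_{k\notin I}$ if the two families are independent and the joint distribution of $(X_k)_{k\in[n]}$ is the same as that of the matrices $O_1X_kO_1^T$ ($k\in I$) and $O_2X_kO_2^T$ ($k\notin I$), where $O_1,O_2$ are Haar-distributed random $N\times N$ orthogonal matrices independent from each other and from the $X_k$. $\mathrm{tr}=\frac1N\mathrm{Tr}$. Partitions. $[n]=\{1,\dots,n\}$; $\mathcal P(I)$ is the set of partitions of a finite set $I$, ordered by refinement ($\mathcal U\preceq\mathcal V$ if every block of $\mathcal U$ is contained in a block of $\mathcal V$), with join $\vee$, largest element $1$; $\#(\mathcal U)$ is the number of blocks; $\mathcal U|_J=\{U\cap J\neq\emptyset: U\in\mathcal U\}$. Its Möbius function is $\mu_{\mathcal P}(\mathcal U,\mathcal V)=\prod_{V\in\mathcal V}(-1)^{\#(\mathcal U|_V)-1}(\#(\mathcal U|_V)-1)!$ for $\mathcal U\preceq\mathcal V$. Premaps. Let $\delta:k\mapsto-k$. For a finite set $I$ of positive integers, $\mathit{PM}(I)$ is the set of permutations $\pi$ of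 $I\cup(-I)$ with $\pi(k)=-\pi^{-1}(-k)$ and with no $k$ in the same cycle as $-k$; $\mathit{PM}(n)=\mathit{PM}([n])$. The cycles of $\pi$ come in pairs, each obtained from the other by reversing order and all signs. $\#(\pi)$ is the number of cycles of $\pi$ (so twice the number of pairs), and $\Pi(\pi)\in\mathcal P(I)$ has one block for each pair of cycles, consisting of the absolute values of its elements. $\pi_+$ is the product of the cycles obtained by choosing from each pair the one in which the element of smallest absolute value is positive (extended by the identity to $I\cup(-I)$), and $\pi_-=\delta\pi_+^{-1}\delta$, so that $\pi=\pi_+\pi_-$. For $J\subseteq I$, $\pi|_J$ is the permutation of $J\cup(-J)$ obtained from the cycle notation of $\pi$ by deleting all other elements. For $\pi,\rho\in\mathit{PM}(I)$, $\mathrm{Kr}_\pi(\rho)=\pi_-^{-1}\rho^{-1}\pi_+\in\mathit{PM}(I)$ and $\chi_\pi(\rho)=\#(\pi)/2+\#(\rho)/2+\#(\mathrm{Kr}_\pi(\rho))/2-|I|$. Traces. Put $X_{-k}=X_k^T$. For $\pi\in\mathit{PM}(I)$, $\mathrm{tr}_\pi(X_1,\dots,X_n)=\prod_{(c_1,\dots,c_r)}\mathrm{tr}(X_{c_1}\cdots X_{c_r})$ over the cycles of $\pi_+$. Weingarten function. For $\mathcal U\in\mathcal P(I)$ with $|I|=n\le N$, choose pairings $\mathcal U_1,\mathcal U_2$ of $[2n]$ such that the blocks of $\mathcal U_1\vee\mathcal U_2$ correspond bijectively to blocks of $\mathcal U$ with half as many elements; $\mathrm{Wg}(\mathcal U)$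 is the $(\mathcal U_1,\mathcal U_2)$ entry of the inverse of the matrix $[N^{\#(\mathcal V_1\vee\mathcal V_2)}]_{\mathcal V_1,\mathcal V_2}$ indexed by pairings of $[2n]$ (this does not depend on the choice). $\mathrm{wg}(\mathcal U)=N^{2n-\#(\mathcal U)}\mathrm{Wg}(\mathcal U)$. Matrix and vertex cumulants. For $\rho\in\mathit{PM}(I)$, $I\subseteq[n]$, the matrix cumulant is $$c_\rho(X_1,\dots,X_n)=\sum_{\pi\in\mathit{PM}(I)}N^{\chi_\rho(\pi)-\#(\rho)}\,\mathrm{wg}(\Pi(\mathrm{Kr}_\rho(\pi)))\,\mathbb E(\mathrm{tr}_\pi(X_1,\dots,X_n)).$$ For $\mathcal V\succeq\Pi(\pi)$, $c_{(\mathcal V,\pi)}=\prod_{V\in\mathcal V}c_{\pi|_V}$. The vertex cumulant is $$K_\pi(X_1,\dots,X_n)=\sum_{\mathcal V\in\mathcal P([n]):\,\mathcal V\succeq\Pi(\pi)}\mu_{\mathcal P}(\mathcal V,1)\,c_{(\mathcal V,\pi)}(X_1,\dots,X_n).$$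
   Formalization: With π_- = δπ_+^{-1}δ, the stated Kr_π(ρ) = π_-^{-1}ρ^{-1}π_+ is in general not a premap (e.g. π_+ = (1 2 3), ρ = id), so the cumulants would be ill-defined; Kr_π(ρ) = π_-ρ^{-1}π_+ is used instead. *)

theory Defs
  imports "HOL-Probability.Probability" "HOL-Combinatorics.Orbits" "HOL-Combinatorics.Cycles"
begin

section \<open>Partitions\<close>

text \<open>
  The set of partitions of \<open>A\<close> is \<^term>\<open>{P. partition_on A P}\<close> and its refinement order is
  \<^term>\<open>refines A\<close>; the largest element is \<^term>\<open>{A}\<close> for nonempty \<open>A\<close>.
\<close>

definition part_join :: "'a set \<Rightarrow> 'a set set \<Rightarrow> 'a set set \<Rightarrow> 'a set set" where
  "part_join A P Q = A // {(x, y). \<exists>B\<in>P \<union> Q. x \<in> B \<and> y \<in> B}\<^sup>+"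

lemma part_join_least_upper_bound:
  assumes P: "partition_on A P" and Q: "partition_on A Q"
  shows "refines A P (part_join A P Q)" "refines A Q (part_join A P Q)"
    and "\<lbrakk>refines A P R; refines A Q R\<rbrakk> \<Longrightarrow> refines A (part_join A P Q) R"
proof -
  define r where "r = {(x, y). \<exists>B\<in>P \<union> Q. x \<in> B \<and> y \<in> B}"
  have sub: "r \<subseteq> A \<times> A"
    using P Q by (fastforce simp: r_def partition_on_def)
  have refl: "(x, x) \<in> r" if "x \<in> A" for x
    using P that by (fastforce simp: r_def partition_on_def)
  have "sym r" by (auto simp: r_def sym_def)
  then have "sym (r\<^sup>+)" by (rule sym_trancl)
  moreover have "r\<^sup>+ \<subseteq> A \<times> A" by (rule trancl_subset_Sigma[OF sub])
  moreover have "refl_on A (r\<^sup>+)" by (intro refl_onI r_into_trancl refl)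
  ultimately have eq: "equiv A (r\<^sup>+)"
    by (simp add: equiv_def trans_trancl)
  have J: "part_join A P Q = A // r\<^sup>+"
    by (simp add: part_join_def r_def)
  have pj: "partition_on A (part_join A P Q)"
    unfolding J by (rule partition_on_quotient[OF eq])
  have up: "\<exists>Y\<in>part_join A P Q. B \<subseteq> Y" if B: "B \<in> P \<union> Q" for B
  proof -
    obtain x where x: "x \<in> B" using P Q B by (metis UnE equals0I partition_onD3)
    have "x \<in> A" using P Q B x by (auto simp: partition_on_def)
    moreover have "B \<subseteq> r\<^sup>+ `` {x}" using B x by (auto simp: r_def)
    ultimately show ?thesis unfolding J by (auto intro: quotientI)
  qed
  show "refines A P (part_join A P Q)" "refines A Q (part_join A P Q)"
    using P Q pj up by (auto simp: refines_def)
  assume R: "refines A P R" "refines A Q R"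
  have pR: "partition_on A R" using R by (simp add: refines_def)
  have step: "y \<in> Y" if "(x, y) \<in> r" "x \<in> Y" "Y \<in> R" for x y Y
  proof -
    obtain B where B: "B \<in> P \<union> Q" "x \<in> B" "y \<in> B" using \<open>(x, y) \<in> r\<close> by (auto simp: r_def)
    then obtain Z where Z: "Z \<in> R" "B \<subseteq> Z" using R by (auto simp: refines_def)
    then have "Z = Y" using B that pR by (auto simp: partition_on_def disjoint_def)
    then show ?thesis using B Z by auto
  qed
  have steps: "y \<in> Y" if "(x, y) \<in> r\<^sup>+" "x \<in> Y" "Y \<in> R" for x y Y
    using that by (induction rule: trancl_induct) (auto intro: step)
  show "refines A (part_join A P Q) R"
    unfolding refines_def
  proof (intro conjI ballI pj pR)
    fix C assume "C \<in> part_join A P Q"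
    then obtain x where x: "x \<in> A" "C = r\<^sup>+ `` {x}" by (auto simp: J elim: quotientE)
    then obtain Y where "Y \<in> R" "x \<in> Y" using pR by (auto simp: partition_on_def)
    then show "\<exists>Y\<in>R. C \<subseteq> Y" using x steps by blast
  qed
qed

definition part_restrict :: "'a set set \<Rightarrow> 'a set \<Rightarrow> 'a set set" where
  "part_restrict P J = {U \<inter> J | U. U \<in> P \<and> U \<inter> J \<noteq> {}}"

definition part_moebius :: "'a set set \<Rightarrow> 'a set set \<Rightarrow> int" where
  "part_moebius P Q = (\<Prod>V\<in>Q. (-1) ^ (card (part_restrict P V) - 1) * fact (card (part_restrict P V) - 1))"

section \<open>Premaps\<close>

text \<open>
  Index sets of positive integers are sets of type \<^typ>\<open>int set\<close>, so that \<open>\<delta>\<close> is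
  \<^term>\<open>uminus :: int \<Rightarrow> int\<close>. A permutation of \<open>signed I\<close> is a function \<^typ>\<open>int \<Rightarrow> int\<close> which is
  the identity outside \<open>signed I\<close>.
\<close>

definition signed :: "int set \<Rightarrow> int set" where
  "signed I = I \<union> uminus ` I"

definition premaps :: "int set \<Rightarrow> (int \<Rightarrow> int) set" where
  "premaps I = {\<pi>. \<pi> permutes signed I \<and>
     (\<forall>k\<in>signed I. \<pi> k = - inv \<pi> (- k)) \<and> (\<forall>k\<in>signed I. - k \<notin> orbit \<pi> k)}"

definition pcycles :: "int set \<Rightarrow> (int \<Rightarrow> int) \<Rightarrow> int set set" where
  "pcycles I \<pi> = orbit \<pi> ` signed I"

definition premap_part :: "int set \<Rightarrow> (int \<Rightarrow> int) \<Rightarrow> int set set" where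
  "premap_part I \<pi> = (\<lambda>c. abs ` c) ` pcycles I \<pi>"

definition positive_cycle :: "int set \<Rightarrow> bool" where
  "positive_cycle c \<longleftrightarrow> (\<exists>m\<in>c. 0 < m \<and> (\<forall>k\<in>c. m \<le> \<bar>k\<bar>))"

definition premap_plus :: "(int \<Rightarrow> int) \<Rightarrow> int \<Rightarrow> int" where
  "premap_plus \<pi> k = (if positive_cycle (orbit \<pi> k) then \<pi> k else k)"

definition premap_minus :: "(int \<Rightarrow> int) \<Rightarrow> int \<Rightarrow> int" where
  "premap_minus \<pi> = uminus \<circ> inv (premap_plus \<pi>) \<circ> uminus"

definition premap_restrict :: "(int \<Rightarrow> int) \<Rightarrow> int set \<Rightarrow> int \<Rightarrow> int" where
  "premap_restrict \<pi> J k = (if k \<in> signed J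
     then (\<pi> ^^ (LEAST m. 0 < m \<and> (\<pi> ^^ m) k \<in> signed J)) k else k)"

text \<open>
  The Kreweras complement is also written \<open>\<pi>_-\<^sup>-\<^sup>1 \<rho>\<^sup>-\<^sup>1 \<pi>_+\<close>, in the convention where \<open>\<pi>_-\<close> denotes
  \<open>\<delta> \<pi>_+ \<delta>\<close> and \<open>\<pi> = \<pi>_+ \<pi>_-\<^sup>-\<^sup>1\<close>. Here \<open>\<pi>_-\<close> is \<open>\<delta> \<pi>_+\<^sup>-\<^sup>1 \<delta>\<close>, so that \<open>\<pi> = \<pi>_+ \<pi>_-\<close>, and the same
  permutation is \<open>\<pi>_- \<rho>\<^sup>-\<^sup>1 \<pi>_+\<close>. (With this \<open>\<pi>_-\<close>, the product \<open>\<pi>_-\<^sup>-\<^sup>1 \<rho>\<^sup>-\<^sup>1 \<pi>_+\<close> is in general not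
  a premap.)
\<close>

definition kreweras :: "(int \<Rightarrow> int) \<Rightarrow> (int \<Rightarrow> int) \<Rightarrow> int \<Rightarrow> int" where
  "kreweras \<pi> \<rho> = premap_minus \<pi> \<circ> inv \<rho> \<circ> premap_plus \<pi>"

lemma premap_plus_permutes:
  assumes "finite I" and \<pi>: "\<pi> permutes signed I"
  shows "premap_plus \<pi> permutes signed I"
proof -
  have "permutation \<pi>"
    using assms by (metis finite_Un finite_imageI permutation_permutes signed_def)
  then have orb: "orbit \<pi> (\<pi> k) = orbit \<pi> k" for k
    by (meson cyclic_on_orbit' orbit.base orbit_cyclic_eq3)
  have "inj (premap_plus \<pi>)"
  proof (rule injI)
    fix x y assume "premap_plus \<pi> x = premap_plus \<pi> y"
    then show "x = y"
      using orb[of x] orb[of y] permutes_inj[OF \<pi>]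
      by (auto simp: premap_plus_def inj_eq split: if_splits)
  qed
  moreover have "y \<in> range (premap_plus \<pi>)" for y
  proof (cases "positive_cycle (orbit \<pi> y)")
    case True
    then have "premap_plus \<pi> (inv \<pi> y) = y"
      using orb[of "inv \<pi> y"] by (simp add: premap_plus_def permutes_inverses[OF \<pi>])
    then show ?thesis by (metis rangeI)
  qed (metis premap_plus_def rangeI)
  ultimately have "bij (premap_plus \<pi>)" by (auto simp: bij_def)
  then show ?thesis
    using permutes_not_in[OF \<pi>] unfolding permutes_def bij_iff by (auto simp: premap_plus_def)
qed

lemma kreweras_premap:
  assumes "finite I" and \<pi>: "\<pi> \<in> premaps I" and \<rho>: "\<rho> \<in> premaps I"
  shows "kreweras \<pi> \<rho> \<in> premaps I"
proof -
  let ?S = "signed I" and ?K = "kreweras \<pi> \<rho>"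
  define p where "p = premap_plus \<pi>"
  have S: "- k \<in> ?S \<longleftrightarrow> k \<in> ?S" for k
    by (force simp: signed_def)
  have p: "p permutes ?S"
    using premap_plus_permutes \<open>finite I\<close> \<pi> by (simp add: premaps_def p_def)
  have r: "\<rho> permutes ?S"
    using \<rho> by (simp add: premaps_def)
  have r_neg: "\<rho> (- k) = - inv \<rho> k" for k
  proof (cases "k \<in> ?S")
    case True
    then show ?thesis using \<rho> S[of k] by (force simp: premaps_def)
  next
    case False
    then show ?thesis using S[of k] permutes_not_in[OF r, of "- k"] permutes_not_in[OF permutes_inv[OF r], of k]
      by simp
  qed
  have inv_r_neg: "inv \<rho> (- k) = - \<rho> k" for k
    using r_neg[of "- k"] by simp
  have K: "?K k = - inv p (- inv \<rho> (p k))" for k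
    by (simp add: kreweras_def premap_minus_def p_def)
  have pp: "p (inv p k) = k" "inv p (p k) = k" for k
    using p by (simp_all add: permutes_inverses)
  have rr: "\<rho> (inv \<rho> k) = k" "inv \<rho> (\<rho> k) = k" for k
    using r by (simp_all add: permutes_inverses)
  have K_cancel: "?K (- ?K (- k)) = k" for k
    by (simp add: K pp rr inv_r_neg)
  have K_cancel': "- ?K (- ?K k) = k" for k
    using K_cancel[of "- k"] by simp
  have K_bij: "bij ?K"
    by (rule o_bij[of "\<lambda>k. - ?K (- k)"]) (auto simp: fun_eq_iff K_cancel K_cancel')
  have inv_K: "inv ?K k = - ?K (- k)" for k
    using K_cancel[of k] bij_is_inj[OF K_bij] by (intro inv_f_eq)
  have "?K k = k" if "k \<notin> ?S" for k
    using that S[of k] permutes_not_in[OF p, of k] permutes_not_in[OF permutes_inv[OF p], of "- k"]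
      permutes_not_in[OF permutes_inv[OF r], of k]
    by (simp add: K)
  then have K_perm: "?K permutes ?S"
    using K_bij unfolding permutes_def bij_iff by blast
  have no_neg: "?K k \<noteq> - k" if "k \<in> ?S" for k
  proof
    assume "?K k = - k"
    then have "p (inv p (- inv \<rho> (p k))) = p k" by (simp add: K)
    then have "inv \<rho> (p k) = - p k" unfolding pp by simp
    then have "\<rho> (- p k) = p k" using rr(1)[of "p k"] by simp
    moreover have "- p k \<in> ?S" using that p S by (simp add: permutes_in_image)
    moreover have "\<rho> (- p k) \<in> orbit \<rho> (- p k)" by (rule orbit.base)
    moreover have "- (- p k) \<notin> orbit \<rho> (- p k)" using \<rho> calculation(2) unfolding premaps_def by blast
    ultimately show False by simp
  qed
  have "- k \<notin> orbit ?K k" if k: "k \<in> ?S" for k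
  proof
    assume "- k \<in> orbit ?K k"
    then obtain m where m: "0 < m" "(?K ^^ m) k = - k" by (auto simp: orbit_altdef)
    have pos: "(?K ^^ j) k \<in> ?S" for j
      using k K_perm by (induction j) (auto simp: permutes_in_image)
    have sym: "(?K ^^ (m - j)) k = - (?K ^^ j) k" if "j \<le> m" for j
      using that
    proof (induction j)
      case (Suc j)
      then have "m - j = Suc (m - Suc j)" by simp
      with Suc have "?K ((?K ^^ (m - Suc j)) k) = - (?K ^^ j) k" by simp
      then show ?case using K_cancel'[of "(?K ^^ (m - Suc j)) k"] by simp
    qed (simp add: m)
    show False
    proof (cases "even m")
      case True
      then obtain j where "m = 2 * j" by blast
      then have "(?K ^^ j) k = 0" using sym[of j] by simp
      moreover have "0 \<notin> ?S"
      proof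
        assume "0 \<in> ?S"
        have "permutation \<rho>"
          using r \<open>finite I\<close> by (metis finite_Un finite_imageI permutation_permutes signed_def)
        then have "0 \<in> orbit \<rho> 0" by (rule permutation_self_in_orbit)
        then show False using \<rho> \<open>0 \<in> ?S\<close> by (auto simp: premaps_def)
      qed
      ultimately show False using pos[of j] by simp
    next
      case False
      then obtain j where "m = 2 * j + 1" by (elim oddE)
      then have "?K ((?K ^^ j) k) = - (?K ^^ j) k" using sym[of j] by simp
      then show False using no_neg pos by blast
    qed
  qed
  then show ?thesis
    using K_perm inv_K by (simp add: premaps_def)
qed
definition euler_char :: "int set \<Rightarrow> (int \<Rightarrow> int) \<Rightarrow> (int \<Rightarrow> int) \<Rightarrow> real" where
  "euler_char I \<pi> \<rho> = real (card (pcycles I \<pi>)) / 2 + real (card (pcycles I \<rho>)) / 2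
     + real (card (pcycles I (kreweras \<pi> \<rho>))) / 2 - real (card I)"

section \<open>Traces along premaps\<close>

definition ntr :: "complex^'N^'N \<Rightarrow> complex" where
  "ntr A = trace A / of_nat CARD('N)"

definition signed_mat :: "(int \<Rightarrow> complex^'N^'N) \<Rightarrow> int \<Rightarrow> complex^'N^'N" where
  "signed_mat A k = (if 0 < k then A k else transpose (A (- k)))"

text \<open>
  The product runs over the chosen cycles only, not over the fixed points by which \<open>\<pi>_+\<close> is extended.
  Each cycle is written starting from its element of smallest absolute value; the
  starting point does not matter because the trace is cyclic.
\<close>

definition tr_premap :: "int set \<Rightarrow> (int \<Rightarrow> int) \<Rightarrow> (int \<Rightarrow> complex^'N^'N) \<Rightarrow> complex" where
  "tr_premap I \<pi> A = (\<Prod>c\<in>{c \<in> pcycles I \<pi>. positive_cycle c}.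
     ntr (foldr (\<lambda>k B. signed_mat A k ** B) (support \<pi> (Min (abs ` c))) (mat 1)))"

section \<open>Weingarten function\<close>

definition pairings :: "nat \<Rightarrow> nat set set set" where
  "pairings n = {P. partition_on {1..2 * n} P \<and> (\<forall>B\<in>P. card B = 2)}"

text \<open>
  Matrices indexed by a finite set \<open>S\<close> are functions \<open>S \<rightarrow> S \<rightarrow> \<real>\<close>; the inverse is extended by \<open>0\<close> to
  make it unique.
\<close>

definition inverse_matrix_on :: "'i set \<Rightarrow> ('i \<Rightarrow> 'i \<Rightarrow> real) \<Rightarrow> 'i \<Rightarrow> 'i \<Rightarrow> real" where
  "inverse_matrix_on S G = (THE W.
     (\<forall>a b. a \<notin> S \<or> b \<notin> S \<longrightarrow> W a b = 0) \<and>
     (\<forall>a\<in>S. \<forall>b\<in>S. (\<Sum>c\<in>S. G a c * W c b) = (if a = b then 1 else 0) \<and>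
                    (\<Sum>c\<in>S. W a c * G c b) = (if a = b then 1 else 0)))"

definition weingarten_matrix :: "nat \<Rightarrow> nat \<Rightarrow> nat set set \<Rightarrow> nat set set \<Rightarrow> real" where
  "weingarten_matrix N n = inverse_matrix_on (pairings n)
     (\<lambda>P Q. real N ^ card (part_join {1..2 * n} P Q))"

definition join_type :: "nat \<Rightarrow> 'a set set \<Rightarrow> nat set set \<Rightarrow> nat set set \<Rightarrow> bool" where
  "join_type n U P Q \<longleftrightarrow> (\<exists>f. bij_betw f (part_join {1..2 * n} P Q) U \<and>
     (\<forall>B\<in>part_join {1..2 * n} P Q. card B = 2 * card (f B)))"

text \<open>In the next two definitions \<open>U\<close> is a partition of the finite set \<^term>\<open>\<Union> U\<close>, of size \<open>n\<close>.\<close>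

definition Weingarten :: "nat \<Rightarrow> 'a set set \<Rightarrow> real" where
  "Weingarten N U = (let n = card (\<Union> U);
     (P, Q) = (SOME (P, Q). P \<in> pairings n \<and> Q \<in> pairings n \<and> join_type n U P Q)
     in weingarten_matrix N n P Q)"

definition normalized_Weingarten :: "nat \<Rightarrow> 'a set set \<Rightarrow> real" where
  "normalized_Weingarten N U = real N ^ (2 * card (\<Union> U) - card U) * Weingarten N U"

section \<open>Random matrices\<close>

definition random_matrix :: "'w measure \<Rightarrow> ('w \<Rightarrow> complex^'N^'N) \<Rightarrow> bool" where
  "random_matrix M A \<longleftrightarrow> A \<in> borel_measurable M \<and>
     (\<forall>i j p. integrable M (\<lambda>\<omega>. norm (A \<omega> $ i $ j) ^ p))"

definition haar_orthogonal :: "(real^'N^'N) measure \<Rightarrow> bool" where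
  "haar_orthogonal \<mu> \<longleftrightarrow> prob_space \<mu> \<and> sets \<mu> = sets borel \<and> (AE Q in \<mu>. orthogonal_matrix Q) \<and>
     (\<forall>R. orthogonal_matrix R \<longrightarrow> distr \<mu> borel (\<lambda>Q. R ** Q) = \<mu>)"

definition orth_conj :: "real^'N^'N \<Rightarrow> complex^'N^'N \<Rightarrow> complex^'N^'N" where
  "orth_conj Q A = (let C = (\<chi> i j. complex_of_real (Q $ i $ j)) in C ** A ** transpose C)"

text \<open>
  Since only distributions matter, the two Haar-distributed matrices live on a
  product extension \<open>\<mu> \<Otimes> \<mu> \<Otimes> M\<close> of the probability space, and \<open>M\<close> itself need not be rich enough
  to carry them. The Haar measure \<open>\<mu>\<close> exists and is unique.
\<close>

definition indep_orth_general_position ::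
    "'w measure \<Rightarrow> (int \<Rightarrow> 'w \<Rightarrow> complex^'N^'N) \<Rightarrow> int set \<Rightarrow> int set \<Rightarrow> bool" where
  "indep_orth_general_position M X T I \<longleftrightarrow>
     prob_space.indep_var M
       (PiM I (\<lambda>_. borel)) (\<lambda>\<omega>. \<lambda>k\<in>I. X k \<omega>)
       (PiM (T - I) (\<lambda>_. borel)) (\<lambda>\<omega>. \<lambda>k\<in>T - I. X k \<omega>) \<and>
     (\<exists>\<mu>. haar_orthogonal \<mu> \<and>
       distr M (PiM T (\<lambda>_. borel)) (\<lambda>\<omega>. \<lambda>k\<in>T. X k \<omega>) =
       distr (\<mu> \<Otimes>\<^sub>M (\<mu> \<Otimes>\<^sub>M M)) (PiM T (\<lambda>_. borel))
         (\<lambda>(Q\<^sub>1, Q\<^sub>2, \<omega>). \<lambda>k\<in>T. orth_conj (if k \<in> I then Q\<^sub>1 else Q\<^sub>2) (X k \<omega>)))"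

section \<open>Matrix and vertex cumulants\<close>

definition matrix_cumulant ::
    "'w measure \<Rightarrow> (int \<Rightarrow> 'w \<Rightarrow> complex^'N^'N) \<Rightarrow> int set \<Rightarrow> (int \<Rightarrow> int) \<Rightarrow> complex" where
  "matrix_cumulant M X I \<rho> = (\<Sum>\<pi>\<in>premaps I.
     of_real (real CARD('N) powr (euler_char I \<rho> \<pi> - real (card (pcycles I \<rho>)))
       * normalized_Weingarten CARD('N) (premap_part I (kreweras \<rho> \<pi>)))
     * (\<integral>\<omega>. tr_premap I \<pi> (\<lambda>k. X k \<omega>) \<partial>M))"

definition part_cumulant ::
    "'w measure \<Rightarrow> (int \<Rightarrow> 'w \<Rightarrow> complex^'N^'N) \<Rightarrow> int set set \<Rightarrow> (int \<Rightarrow> int) \<Rightarrow> complex" where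
  "part_cumulant M X \<V> \<pi> = (\<Prod>V\<in>\<V>. matrix_cumulant M X V (premap_restrict \<pi> V))"

definition vertex_cumulant ::
    "'w measure \<Rightarrow> (int \<Rightarrow> 'w \<Rightarrow> complex^'N^'N) \<Rightarrow> nat \<Rightarrow> (int \<Rightarrow> int) \<Rightarrow> complex" where
  "vertex_cumulant M X n \<pi> = (\<Sum>\<V>\<in>{\<V>. refines {1..int n} (premap_part {1..int n} \<pi>) \<V>}.
     of_int (part_moebius \<V> {{1..int n}}) * part_cumulant M X \<V> \<pi>)"

end

theory Submission
  imports Defs
begin

text \<open>
  Put \<open>u_V(i) = \<bbbE>(\<Prod>k\<in>V. (X_k)_{i(k), i(-k)})\<close>, a tensor with one index for each element of \<open>\<plusminus>V\<close>. A premap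
  \<open>\<pi>\<close> is the same as the pair partition \<open>{{k, \<pi>(-k)}}\<close> of \<open>\<plusminus>V\<close>, and traces along \<open>\<pi>\<close> are pairings of
  \<open>u_V\<close> with the indicator tensor \<open>e_\<pi>\<close> of that partition. Since the Weingarten matrix inverts the Gram
  matrix of the \<open>e_\<pi>\<close>, the matrix cumulants are up to powers of \<open>N\<close> the coordinates of \<open>u_V\<close> in the
  \<open>e_\<pi>\<close>; here \<open>u_V\<close> is in their span because general position makes it invariant under the orthogonal
  group. For \<open>|V| \<le> N\<close> the coordinate at \<open>\<rho>\<close> is simply the entry \<open>u_V(i)\<close> at an index \<open>i\<close> whose level sets
  are the blocks of \<open>\<rho>\<close>. Fixing such an index for \<open>\<pi>\<close>, the vertex cumulant becomes a multiple of the
  classical cumulant of the set function \<open>V \<mapsto> u_V(i)\<close>. Independence makes this function multiplicative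
  across \<open>I\<close> and its complement, so its cumulant is zero. An entry of an invariant tensor at
  an index taking some value an odd number of times is zero, so sets \<open>V\<close> that are not unions of blocks
  of \<open>\<Pi>(\<pi>)\<close> contribute nothing, and premaps with cycles meeting both \<open>I\<close> and its complement need no
  separate treatment.
\<close>

section \<open>Cumulants of multiplicative set functions\<close>

text \<open>What makes the linear algebra elementary is \<open>n \<le> CARD('N)\<close>: a pair
  partition of \<plusminus>V has |V| blocks, so its blocks can be given distinct values, and at such
  an index exactly one e_\<rho> is nonzero. This gives the invertibility of the Gram matrix and lets
  coordinates be read off as single entries, without asymptotics or explicit Weingarten values. An
  index chosen for \<pi> also serves every restriction \<open>premap_restrict \<pi> V\<close> with V
  a union of blocks, because the restricted pairs are pairs of \<pi>; so all factors come from one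
  set function. The remaining power of N, with exponent |V| - #(\<pi>|_V)/2, is additive over the
  blocks of a partition and factors out of the sum. The main obstacle is the form of the Weingarten
  function, which is defined through an arbitrary choice of two pairings with prescribed join. Any
  two choices have to be related by a relabelling of the ground set, and the Kreweras complement has
  to be recognized as the join of the pair partitions of \<rho> and \<pi>.\<close>

definition signed_fact :: "nat \<Rightarrow> 'c::comm_ring_1" where
  "signed_fact k = (-1) ^ (k - 1) * of_nat (fact (k - 1))"

lemma signed_fact_1 [simp]: "signed_fact (Suc 0) = 1"
  by (simp add: signed_fact_def)

text \<open>In the recursion for \<open>log_coeff\<close> a partition with k blocks arises once by
  itself and k - 1 times, with the coefficient for one block fewer, by marking a block that avoids a
  fixed point. The two contributions cancel. Here \<open>signed_fact k\<close> is the Moebius value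
  mu(P, 1) of a partition P into k blocks.\<close>

lemma signed_fact_step:
  assumes "2 \<le> k"
  shows "of_nat (k - 1) * signed_fact (k - 1) + signed_fact k = (0 :: 'c::comm_ring_1)"
proof -
  obtain l where "k = Suc (Suc l)" using assms by (metis add_2_eq_Suc le_Suc_ex)
  then show ?thesis
    by (simp add: signed_fact_def algebra_simps)
qed

text \<open>The classical joint cumulant when f V is the expectation of a product over V. The name
  refers to generating functions: if f gives the square-free coefficients of a series with constant
  term 1, this is the coefficient of its logarithm.\<close>

definition log_coeff :: "('a set \<Rightarrow> 'c::comm_ring_1) \<Rightarrow> 'a set \<Rightarrow> 'c" where
  "log_coeff f A = (\<Sum>P\<in>{P. partition_on A P}. signed_fact (card P) * (\<Prod>V\<in>P. f V))"

text \<open>The moment-cumulant recursion. Expanding \<open>log_coeff f W\<close> for a proper W and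
  adding the complement \<open>A - W\<close> as a block gives a partition of A with a marked block
  that avoids x, and every such pair arises once. A partition with k blocks has k - 1 blocks
  avoiding x, so \<open>signed_fact_step\<close> leaves only the partition with one block.\<close>

lemma log_coeff_recursion:
  fixes f :: "'a set \<Rightarrow> 'c::comm_ring_1"
  assumes fin: "finite A" and x: "x \<in> A" and f0: "f {} = 1"
  shows "f A = (\<Sum>W\<in>{W. x \<in> W \<and> W \<subseteq> A}. log_coeff f W * f (A - W))"
proof -
  let ?PP = "\<lambda>A. {P. partition_on A P}"
  let ?t = "\<lambda>P. \<Prod>V\<in>P. f V"
  have finP: "finite (?PP B)" if "B \<subseteq> A" for B
    using that fin finite_subset finitely_many_partition_on by blast
  have finW: "finite {W. x \<in> W \<and> W \<subseteq> A}" "finite {W. x \<in> W \<and> W \<subset> A}"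
    using fin by (auto intro: finite_subset[of _ "Pow A"])
  have split: "{W. x \<in> W \<and> W \<subseteq> A} = insert A {W. x \<in> W \<and> W \<subset> A}"
    using x by auto
  define D1 where "D1 = (SIGMA W:{W. x \<in> W \<and> W \<subset> A}. ?PP W)"
  define D2 where "D2 = (SIGMA Q:?PP A. {B\<in>Q. x \<notin> B})"
  have "(\<Sum>W\<in>{W. x \<in> W \<and> W \<subset> A}. log_coeff f W * f (A - W))
      = (\<Sum>(W, P)\<in>D1. signed_fact (card P) * ?t P * f (A - W))"
    unfolding D1_def log_coeff_def sum_distrib_right
    by (subst sum.Sigma) (use finW finP in auto)
  also have "\<dots> = (\<Sum>(Q, B)\<in>D2. signed_fact (card Q - 1) * ?t Q)"
  proof (rule sum.reindex_bij_witness[of _ "\<lambda>(Q, B). (A - B, Q - {B})" "\<lambda>(W, P). (insert (A - W) P, A - W)"], goal_cases)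
    case (1 a)
    then obtain W P where a: "a = (W, P)" "x \<in> W" "W \<subset> A" "partition_on W P" by (auto simp: D1_def)
    have "A - W \<notin> P" using a unfolding partition_on_def by blast
    then show ?case using a by auto
  next
    case (2 a)
    then obtain W P where a: "a = (W, P)" "x \<in> W" "W \<subset> A" "partition_on W P" by (auto simp: D1_def)
    have eq: "A - (A - W) = W" using a by auto
    have "partition_on A (insert (A - W) P)"
      by (subst partition_on_insert) (use a eq in \<open>auto simp: partition_on_def disjnt_def\<close>)
    then show ?case using a by (auto simp: D2_def)
  next
    case (3 b)
    then obtain Q B where b: "b = (Q, B)" "B \<in> Q" "x \<notin> B" "partition_on A Q" by (auto simp: D2_def)
    have "A - (A - B) = B" using b by (auto simp: partition_on_def)
    then show ?case using b by auto
  next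
    case (4 b)
    then obtain Q B where b: "b = (Q, B)" "B \<in> Q" "x \<notin> B" "partition_on A Q" by (auto simp: D2_def)
    have "insert B (Q - {B}) = Q" using b by auto
    moreover have "disjnt B (\<Union>(Q - {B}))"
      using b by (auto simp: partition_on_def disjoint_def disjnt_def)
    ultimately have "partition_on (A - B) (Q - {B}) \<and> B \<subseteq> A \<and> B \<noteq> {}"
      using b partition_on_insert[of B "Q - {B}" A] by auto
    then show ?case using b x by (auto simp: D1_def)
  next
    case (5 a)
    then obtain W P where a: "a = (W, P)" "x \<in> W" "W \<subset> A" "partition_on W P" by (auto simp: D1_def)
    have "A - W \<notin> P" using a unfolding partition_on_def by blast
    moreover have "finite P" using a fin finite_elements finite_subset by (metis psubset_imp_subset)
    ultimately show ?case using a by (simp add: mult_ac)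
  qed
  also have "\<dots> = (\<Sum>Q\<in>?PP A. of_nat (card Q - 1) * signed_fact (card Q - 1) * ?t Q)"
  proof -
    have "card {B\<in>Q. x \<notin> B} = card Q - 1" and "finite Q" if Q: "partition_on A Q" for Q
    proof -
      show "finite Q" using Q fin finite_elements by blast
      obtain B where B: "B \<in> Q" "x \<in> B" using Q x by (auto simp: partition_on_def)
      have eq: "C = B" if "C \<in> Q" "x \<in> C" for C
        using partition_onD2[OF Q] B that unfolding disjoint_def by blast
      have "{B\<in>Q. x \<notin> B} = Q - {B}" using B(2) eq by blast
      then show "card {B\<in>Q. x \<notin> B} = card Q - 1" using B by simp
    qed
    then show ?thesis
      unfolding D2_def using finP[OF subset_refl]
      by (subst sum.Sigma[symmetric]) (simp_all add: mult.assoc)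
  qed
  finally have "(\<Sum>W\<in>{W. x \<in> W \<and> W \<subseteq> A}. log_coeff f W * f (A - W))
      = (\<Sum>Q\<in>?PP A. (of_nat (card Q - 1) * signed_fact (card Q - 1) + signed_fact (card Q)) * ?t Q)"
    unfolding split using finW by (simp add: f0 log_coeff_def sum.distrib algebra_simps)
  \<comment> \<open>For the one-block partition the first coefficient carries the factor 0, so the
    surviving term is f A.\<close>
  also have "\<dots> = (\<Sum>Q\<in>{{A}}. (of_nat (card Q - 1) * signed_fact (card Q - 1) + signed_fact (card Q)) * ?t Q)"
  proof (rule sum.mono_neutral_right)
    show "\<forall>Q\<in>?PP A - {{A}}. (of_nat (card Q - 1) * signed_fact (card Q - 1) + signed_fact (card Q)) * ?t Q = 0"
    proof
      fix Q assume Q: "Q \<in> ?PP A - {{A}}"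
      then have "finite Q" using fin finite_elements by blast
      moreover have "card Q \<noteq> 0" using Q x \<open>finite Q\<close> by (auto simp: partition_on_def)
      moreover have "card Q \<noteq> 1" using Q by (auto simp: card_1_singleton_iff partition_on_def)
      ultimately have "2 \<le> card Q" by linarith
      then show "(of_nat (card Q - 1) * signed_fact (card Q - 1) + signed_fact (card Q)) * ?t Q = 0"
        using signed_fact_step[of "card Q"] by (metis mult_zero_left)
    qed
  qed (use x finP partition_on_space[of A] in auto)
  finally show ?thesis by simp
qed

text \<open>Strong induction on the size, through the recursion at a point x of
  \<open>A \<inter> I\<close>. A proper W containing x that is not inside I meets both sides, so its
  term vanishes by induction. The W inside \<open>A \<inter> I\<close> rebuild f (A \<inter> I) with
  the common factor f (A - I), which is f A, so the term of W = A must be zero.\<close>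

lemma log_coeff_multiplicative:
  fixes f :: "'a set \<Rightarrow> 'c::comm_ring_1"
  assumes "finite A" and f0: "f {} = 1"
    and mult: "\<And>V. V \<subseteq> A \<Longrightarrow> f V = f (V \<inter> I) * f (V - I)"
    and "A \<inter> I \<noteq> {}" and "A - I \<noteq> {}"
  shows "log_coeff f A = 0"
  using assms(1,3-5)
proof (induction "card A" arbitrary: A rule: less_induct)
  case less
  obtain x where x: "x \<in> A" "x \<in> I" using less.prems by blast
  have AI: "A \<inter> I \<subset> A" "x \<in> A \<inter> I" using less.prems x by auto
  have split: "{W. x \<in> W \<and> W \<subseteq> A} = insert A ({W. x \<in> W \<and> W \<subseteq> A \<inter> I} \<union> {W. x \<in> W \<and> W \<subset> A \<and> W - I \<noteq> {}})"
    using x by auto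
  have fin: "finite {W. x \<in> W \<and> W \<subseteq> A \<inter> I}" "finite {W. x \<in> W \<and> W \<subset> A \<and> W - I \<noteq> {}}"
    using less.prems(1) by (auto intro: finite_subset[of _ "Pow A"])
  have zero: "log_coeff f W = 0" if "x \<in> W" "W \<subset> A" "W - I \<noteq> {}" for W
  proof (rule less.hyps)
    show "card W < card A" using that less.prems(1) by (simp add: psubset_card_mono)
    show "finite W" using that less.prems(1) by (meson finite_subset psubset_imp_subset)
    show "f V = f (V \<inter> I) * f (V - I)" if "V \<subseteq> W" for V
      using that \<open>W \<subset> A\<close> less.prems(2)[of V] by blast
  qed (use that x in auto)
  have "f A = (\<Sum>W\<in>{W. x \<in> W \<and> W \<subseteq> A}. log_coeff f W * f (A - W))"
    by (rule log_coeff_recursion) (use less.prems(1) x f0 in auto)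
  also have "\<dots> = log_coeff f A + (\<Sum>W\<in>{W. x \<in> W \<and> W \<subseteq> A \<inter> I}. log_coeff f W * f (A - W))"
  proof -
    let ?h = "\<lambda>W. log_coeff f W * f (A - W)"
    have "A \<notin> {W. x \<in> W \<and> W \<subseteq> A \<inter> I} \<union> {W. x \<in> W \<and> W \<subset> A \<and> W - I \<noteq> {}}"
      using AI by blast
    moreover have "{W. x \<in> W \<and> W \<subseteq> A \<inter> I} \<inter> {W. x \<in> W \<and> W \<subset> A \<and> W - I \<noteq> {}} = {}"
      by blast
    moreover have "sum ?h {W. x \<in> W \<and> W \<subset> A \<and> W - I \<noteq> {}} = 0"
      by (rule sum.neutral) (use zero in auto)
    ultimately show ?thesis
      unfolding split using fin by (simp add: f0 sum.union_disjoint)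
  qed
  also have "(\<Sum>W\<in>{W. x \<in> W \<and> W \<subseteq> A \<inter> I}. log_coeff f W * f (A - W))
      = (\<Sum>W\<in>{W. x \<in> W \<and> W \<subseteq> A \<inter> I}. log_coeff f W * f (A \<inter> I - W)) * f (A - I)"
    unfolding sum_distrib_right
  proof (rule sum.cong[OF refl])
    fix W assume W: "W \<in> {W. x \<in> W \<and> W \<subseteq> A \<inter> I}"
    then have "(A - W) \<inter> I = A \<inter> I - W" "(A - W) - I = A - I" by auto
    then show "log_coeff f W * f (A - W) = log_coeff f W * f (A \<inter> I - W) * f (A - I)"
      using less.prems(2)[of "A - W"] by (metis Diff_subset mult.assoc)
  qed
  also have "(\<Sum>W\<in>{W. x \<in> W \<and> W \<subseteq> A \<inter> I}. log_coeff f W * f (A \<inter> I - W)) = f (A \<inter> I)"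
    using log_coeff_recursion[of "A \<inter> I" x f] less.prems(1) x f0 by simp
  finally have "f A = log_coeff f A + f A"
    using less.prems(2)[OF subset_refl] by metis
  then show ?case by simp
qed

section \<open>Tensors invariant under the orthogonal group\<close>

text \<open>Indices are extensional functions so that there are finitely many of them. Tensors are
  nevertheless functions of arbitrary \<open>'a \<Rightarrow> 'b\<close>, which allows one index to
  be used with several sets S.\<close>

abbreviation (input) indices :: "'a set \<Rightarrow> ('a \<Rightarrow> 'b) set" where
  "indices S \<equiv> PiE S (\<lambda>_. UNIV)"

definition pair_partitions :: "'a set \<Rightarrow> 'a set set set" where
  "pair_partitions S = {P. partition_on S P \<and> (\<forall>B\<in>P. card B = 2)}"

text \<open>\<open>of_bool (block_const P j)\<close> is the entry at j of the indicator tensor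
  e_P.\<close>

definition block_const :: "'a set set \<Rightarrow> ('a \<Rightarrow> 'b) \<Rightarrow> bool" where
  "block_const P j \<longleftrightarrow> (\<forall>B\<in>P. \<forall>x\<in>B. \<forall>y\<in>B. j x = j y)"

definition block_of :: "'a set set \<Rightarrow> 'a \<Rightarrow> 'a set" where
  "block_of P x = (THE B. B \<in> P \<and> x \<in> B)"

lemma block_of_eq: "partition_on S P \<Longrightarrow> B \<in> P \<Longrightarrow> x \<in> B \<Longrightarrow> block_of P x = B"
  unfolding block_of_def partition_on_def disjoint_def by (intro the_equality) auto

lemma block_of_in:
  assumes "partition_on S P" "x \<in> S" shows "block_of P x \<in> P" "x \<in> block_of P x"
proof -
  obtain B where "B \<in> P" "x \<in> B" using assms by (auto simp: partition_on_def)
  then show "block_of P x \<in> P" "x \<in> block_of P x" using block_of_eq[OF assms(1)] by auto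
qed

text \<open>The inverse evaluates j at a chosen point of each block. This turns sums over indices
  constant on blocks into sums over one free value per block.\<close>

lemma bij_betw_block_const:
  assumes P: "partition_on S P"
  shows "bij_betw (\<lambda>y :: 'a set \<Rightarrow> 'b. restrict (\<lambda>x. y (block_of P x)) S)
    (indices P) {j \<in> indices S. block_const P j}"
proof (rule bij_betw_byWitness[where f' = "\<lambda>j. restrict (\<lambda>B. j (SOME x. x \<in> B)) P"])
  have some: "(SOME x. x \<in> B) \<in> B" if "B \<in> P" for B
    using partition_onD3[OF P] that by (metis equals0I someI_ex)
  have some': "(SOME x. x \<in> B) \<in> S" if "B \<in> P" for B
    using some[OF that] that partition_onD1[OF P] by auto
  have sub: "x \<in> S" if "B \<in> P" "x \<in> B" for x B
    using that partition_onD1[OF P] by auto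
  show "\<forall>y\<in>(indices P :: ('a set \<Rightarrow> 'b) set). restrict (\<lambda>B. restrict (\<lambda>x. y (block_of P x)) S (SOME x. x \<in> B)) P = y"
  proof
    fix y :: "'a set \<Rightarrow> 'b" assume y: "y \<in> indices P"
    have "y (block_of P (SOME x. x \<in> B)) = y B" if "B \<in> P" for B
      using block_of_eq[OF P that some[OF that]] by simp
    then have "restrict (\<lambda>B. restrict (\<lambda>x. y (block_of P x)) S (SOME x. x \<in> B)) P B = y B" for B
      using some'[of B] PiE_arb[OF y, of B] by (cases "B \<in> P") simp_all
    then show "restrict (\<lambda>B. restrict (\<lambda>x. y (block_of P x)) S (SOME x. x \<in> B)) P = y" by blast
  qed
  show "\<forall>j\<in>{j \<in> (indices S :: ('a \<Rightarrow> 'b) set). block_const P j}.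
      restrict (\<lambda>x. restrict (\<lambda>B. j (SOME x. x \<in> B)) P (block_of P x)) S = j"
  proof
    fix j :: "'a \<Rightarrow> 'b" assume j: "j \<in> {j \<in> indices S. block_const P j}"
    have "j (SOME y. y \<in> block_of P x) = j x" if "x \<in> S" for x
      using j some[of "block_of P x"] block_of_in[OF P that] unfolding block_const_def by blast
    then have "restrict (\<lambda>x. restrict (\<lambda>B. j (SOME x. x \<in> B)) P (block_of P x)) S x = j x" for x
      using j block_of_in(1)[OF P, of x] PiE_arb[of j S "\<lambda>_. UNIV" x] by (cases "x \<in> S") simp_all
    then show "restrict (\<lambda>x. restrict (\<lambda>B. j (SOME x. x \<in> B)) P (block_of P x)) S = j" by blast
  qed
  have "block_const P (restrict (\<lambda>x. y (block_of P x)) S)" for y :: "'a set \<Rightarrow> 'b"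
    unfolding block_const_def
  proof (intro ballI)
    fix B x x' assume "B \<in> P" "x \<in> B" "x' \<in> B"
    then show "restrict (\<lambda>x. y (block_of P x)) S x = restrict (\<lambda>x. y (block_of P x)) S x'"
      using block_of_eq[OF P, of B x] block_of_eq[OF P, of B x'] sub[of B x] sub[of B x'] by simp
  qed
  then show "(\<lambda>y :: 'a set \<Rightarrow> 'b. restrict (\<lambda>x. y (block_of P x)) S) ` indices P \<subseteq> {j \<in> indices S. block_const P j}"
    by auto
  show "(\<lambda>j :: 'a \<Rightarrow> 'b. restrict (\<lambda>B. j (SOME x. x \<in> B)) P) ` {j \<in> indices S. block_const P j} \<subseteq> indices P"
    by auto
qed

lemma prod_over_partition:
  assumes "finite S" and "partition_on S P"
  shows "prod f S = (\<Prod>B\<in>P. prod f B)"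
proof -
  have "prod f (\<Union>P) = (\<Prod>B\<in>P. prod f B)"
    using assms finite_subset[of _ S]
    by (subst prod.Union_disjoint) (auto simp: partition_on_def disjoint_def)
  then show ?thesis using partition_onD1[OF assms(2)] by simp
qed

lemma block_const_restrict: "partition_on S P \<Longrightarrow> block_const P (restrict i S) \<longleftrightarrow> block_const P i"
  unfolding block_const_def by (intro ball_cong refl) (auto dest: partition_onD1)

section \<open>The action of the orthogonal group on tensors\<close>

definition orth_act :: "real^'N^'N \<Rightarrow> 'a set \<Rightarrow> (('a \<Rightarrow> 'N) \<Rightarrow> complex) \<Rightarrow> ('a \<Rightarrow> 'N) \<Rightarrow> complex" where
  "orth_act R S u i = (\<Sum>j\<in>indices S. (\<Prod>k\<in>S. of_real (R $ i k $ j k)) * u j)"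

text \<open>The first condition says that u is a tensor with index positions in S only; in the
  second, \<open>orth_act R S\<close> is the tensor power of R over S.\<close>

definition orth_invariant :: "'a set \<Rightarrow> (('a \<Rightarrow> 'N::finite) \<Rightarrow> complex) \<Rightarrow> bool" where
  "orth_invariant S u \<longleftrightarrow> (\<forall>i. u (restrict i S) = u i) \<and>
     (\<forall>R. orthogonal_matrix R \<longrightarrow> (\<forall>i. orth_act R S u i = u i))"

lemma orth_invariant_cong:
  assumes "orth_invariant S u" "\<And>k. k \<in> S \<Longrightarrow> i k = j k"
  shows "u i = u j"
proof -
  have "restrict i S = restrict j S" using assms(2) by auto
  then show ?thesis using assms(1) unfolding orth_invariant_def by metis
qed

lemma prod_of_bool: "finite A \<Longrightarrow> (\<Prod>x\<in>A. of_bool (Q x)) = (of_bool (\<forall>x\<in>A. Q x) :: 'b::comm_semiring_1)"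
  by (induction A rule: finite_induct) auto

lemma orthogonal_matrix_entries:
  fixes R :: "real^'N^'N"
  assumes "orthogonal_matrix R"
  shows "(\<Sum>y\<in>UNIV. R $ a $ y * R $ b $ y) = (if a = b then 1 else 0)"
proof -
  have "R ** transpose R = mat 1" using assms by (simp add: orthogonal_matrix_def)
  then have "(R ** transpose R) $ a $ b = mat 1 $ a $ b" by simp
  then show ?thesis by (simp add: matrix_matrix_mult_def transpose_def mat_def)
qed

lemma orthogonal_matrixI:
  fixes R :: "real^'N^'N"
  assumes "\<And>a b. (\<Sum>y\<in>UNIV. R $ a $ y * R $ b $ y) = (if a = b then 1 else 0)"
  shows "orthogonal_matrix R"
proof -
  have "R ** transpose R = mat 1"
    using assms by (simp add: matrix_matrix_mult_def transpose_def mat_def vec_eq_iff)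
  then have "orthogonal_matrix (transpose R)" by (simp add: orthogonal_matrix)
  then show ?thesis by simp
qed

text \<open>Signed permutation matrices, which serve for a single change of sign and for pure
  permutations.\<close>

lemma orthogonal_matrix_monomial:
  fixes R :: "real^'N^'N"
  assumes "inj \<tau>" and "\<And>x. f x * f x = 1" and R: "\<And>x y. R $ x $ y = (if y = \<tau> x then f x else 0)"
  shows "orthogonal_matrix R"
proof (rule orthogonal_matrixI)
  fix a b
  have "R $ a $ y * R $ b $ y = (if y = \<tau> a then if a = b then 1 else 0 else 0)" for y
    using assms by (auto simp: R inj_eq)
  then show "(\<Sum>y\<in>UNIV. R $ a $ y * R $ b $ y) = (if a = b then 1 else 0)" by simp
qed

text \<open>The sum over block-constant j factors over the blocks, and a block {k, l} contributes
  the inner product of the rows i k and i l of R, which is 1 or 0 according to whether i k = i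
  l.\<close>

lemma orth_invariant_block_const:
  fixes P :: "'a set set"
  assumes fin: "finite S" and P: "P \<in> pair_partitions S"
  shows "orth_invariant S (\<lambda>i :: 'a \<Rightarrow> 'N::finite. of_bool (block_const P i))"
  unfolding orth_invariant_def
proof (intro conjI allI impI)
  have part: "partition_on S P" and two: "\<And>B. B \<in> P \<Longrightarrow> card B = 2"
    using P by (auto simp: pair_partitions_def)
  have finP: "finite P" using fin part by (rule finite_elements)
  fix i :: "'a \<Rightarrow> 'N"
  show "of_bool (block_const P (restrict i S)) = (of_bool (block_const P i) :: complex)"
    by (simp only: block_const_restrict[OF part])
  fix R :: "real^'N^'N" assume R: "orthogonal_matrix R"
  have "orth_act R S (\<lambda>i. of_bool (block_const P i)) i
      = (\<Sum>j\<in>{j \<in> indices S. block_const P j}. \<Prod>k\<in>S. of_real (R $ i k $ j k))"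
    unfolding orth_act_def using fin
    by (intro sum.mono_neutral_cong_right) (auto intro: finite_PiE)
  also have "\<dots> = (\<Sum>y\<in>indices P. \<Prod>k\<in>S. of_real (R $ i k $ restrict (\<lambda>x. y (block_of P x)) S k))"
    by (rule sum.reindex_bij_betw[symmetric, OF bij_betw_block_const[OF part]])
  also have "\<dots> = (\<Sum>y\<in>indices P. \<Prod>B\<in>P. \<Prod>k\<in>B. of_real (R $ i k $ y B))"
  proof (rule sum.cong[OF refl])
    fix y :: "'a set \<Rightarrow> 'N"
    show "(\<Prod>k\<in>S. of_real (R $ i k $ restrict (\<lambda>x. y (block_of P x)) S k)) =
        (\<Prod>B\<in>P. \<Prod>k\<in>B. complex_of_real (R $ i k $ y B))"
      unfolding prod_over_partition[OF fin part]
    proof (intro prod.cong refl)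
      fix B k assume B: "B \<in> P" "k \<in> B"
      then have "k \<in> S" using partition_onD1[OF part] by auto
      then show "complex_of_real (R $ i k $ restrict (\<lambda>x. y (block_of P x)) S k) = of_real (R $ i k $ y B)"
        using block_of_eq[OF part B] by simp
    qed
  qed
  also have "\<dots> = (\<Prod>B\<in>P. \<Sum>y\<in>UNIV. \<Prod>k\<in>B. of_real (R $ i k $ y))"
    by (rule prod_sum_PiE[symmetric]) (use finP in auto)
  also have "\<dots> = (\<Prod>B\<in>P. of_bool (\<forall>x\<in>B. \<forall>y\<in>B. i x = i y))"
  proof (rule prod.cong[OF refl])
    fix B assume "B \<in> P"
    then obtain k l where B: "B = {k, l}" "k \<noteq> l" using two by (meson card_2_iff)
    have "(\<Sum>y\<in>UNIV. \<Prod>k\<in>B. complex_of_real (R $ i k $ y)) = of_real (\<Sum>y\<in>UNIV. R $ i k $ y * R $ i l $ y)"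
      using B by simp
    then show "(\<Sum>y\<in>UNIV. \<Prod>k\<in>B. complex_of_real (R $ i k $ y)) = of_bool (\<forall>x\<in>B. \<forall>y\<in>B. i x = i y)"
      using B by (auto simp: orthogonal_matrix_entries[OF R])
  qed
  also have "\<dots> = of_bool (block_const P i)"
    unfolding prod_of_bool[OF finP] block_const_def ..
  finally show "orth_act R S (\<lambda>i. of_bool (block_const P i)) i = of_bool (block_const P i)" .
qed

lemma orth_act_monomial:
  assumes fin: "finite S" and u: "\<And>i. u (restrict i S) = u i"
    and R: "\<And>x y. y \<noteq> \<tau> x \<Longrightarrow> R $ x $ y = 0"
  shows "orth_act R S u i = (\<Prod>k\<in>S. of_real (R $ i k $ \<tau> (i k))) * u (\<lambda>k. \<tau> (i k))"
proof -
  let ?j = "restrict (\<lambda>k. \<tau> (i k)) S"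
  have "orth_act R S u i = (\<Sum>j\<in>{?j}. (\<Prod>k\<in>S. of_real (R $ i k $ j k)) * u j)"
    unfolding orth_act_def
  proof (rule sum.mono_neutral_right)
    show "\<forall>j\<in>indices S - {?j}. (\<Prod>k\<in>S. of_real (R $ i k $ j k)) * u j = 0"
    proof
      fix j assume j: "j \<in> indices S - {?j}"
      then obtain k where "k \<in> S" "j k \<noteq> \<tau> (i k)"
        by (metis (no_types, lifting) DiffE PiE_restrict restrict_ext singletonI)
      then show "(\<Prod>k\<in>S. of_real (R $ i k $ j k)) * u j = 0"
        using R fin by auto
    qed
  qed (use fin in \<open>auto intro: finite_PiE\<close>)
  then show ?thesis by (simp add: u)
qed

text \<open>The reflection e_a \<mapsto> - e_a fixes u and multiplies its entry at i by -1 once for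
  every occurrence of a.\<close>

lemma orth_invariant_odd:
  fixes u :: "('a \<Rightarrow> 'N::finite) \<Rightarrow> complex"
  assumes fin: "finite S" and u: "orth_invariant S u" and odd: "odd (card {k\<in>S. i k = a})"
  shows "u i = 0"
proof -
  define R :: "real^'N^'N" where "R = (\<chi> x y. if y = x then if x = a then - 1 else 1 else 0)"
  have "orthogonal_matrix R"
    by (rule orthogonal_matrix_monomial[of "\<lambda>x. x" "\<lambda>x. if x = a then - 1 else 1"]) (auto simp: R_def)
  then have "u i = orth_act R S u i" using u by (simp add: orth_invariant_def)
  also have "\<dots> = (\<Prod>k\<in>S. of_real (R $ i k $ i k)) * u i"
    using orth_act_monomial[of S u "\<lambda>x. x" R i] fin u by (simp add: R_def orth_invariant_def)
  also have "(\<Prod>k\<in>S. complex_of_real (R $ i k $ i k)) = (\<Prod>k\<in>S. if i k = a then - 1 else 1)"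
    by (rule prod.cong) (auto simp: R_def)
  also have "\<dots> = (- 1) ^ card {k\<in>S. i k = a}"
    using fin by (simp add: prod.If_cases Collect_conj_eq)
  also have "\<dots> = - 1" using odd by simp
  finally show ?thesis by simp
qed

lemma orth_invariant_permute:
  fixes u :: "('a \<Rightarrow> 'N::finite) \<Rightarrow> complex"
  assumes fin: "finite S" and u: "orth_invariant S u" and \<sigma>: "inj \<sigma>"
  shows "u (\<lambda>k. \<sigma> (i k)) = u i"
proof -
  define R :: "real^'N^'N" where "R = (\<chi> x y. if y = \<sigma> x then 1 else 0)"
  have "orthogonal_matrix R"
    by (rule orthogonal_matrix_monomial[of \<sigma> "\<lambda>_. 1"]) (use \<sigma> in \<open>auto simp: R_def\<close>)
  then have "u i = orth_act R S u i" using u by (simp add: orth_invariant_def)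
  also have "\<dots> = (\<Prod>k\<in>S. of_real (R $ i k $ \<sigma> (i k))) * u (\<lambda>k. \<sigma> (i k))"
    by (rule orth_act_monomial) (use fin u in \<open>auto simp: R_def orth_invariant_def\<close>)
  finally show ?thesis by (simp add: R_def)
qed

text \<open>The induced injection f k \<mapsto> g k between the images extends to a permutation
  because in a finite type the two complements have the same size.\<close>

lemma inj_extension:
  fixes f g :: "'a \<Rightarrow> 'b::finite"
  assumes "\<And>k l. k \<in> S \<Longrightarrow> l \<in> S \<Longrightarrow> f k = f l \<longleftrightarrow> g k = g l"
  obtains \<sigma> :: "'b \<Rightarrow> 'b" where "inj \<sigma>" "\<And>k. k \<in> S \<Longrightarrow> \<sigma> (f k) = g k"
proof -
  define h where "h = (\<lambda>x. g (inv_into S f x))"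
  have h: "h (f k) = g k" if "k \<in> S" for k
    using assms[of "inv_into S f (f k)" k] that
    by (simp add: h_def f_inv_into_f inv_into_into)
  have bij: "bij_betw h (f ` S) (g ` S)"
    unfolding bij_betw_def inj_on_def using h assms by (auto simp: image_iff)
  then have "card (- f ` S) = card (- g ` S)"
    using bij_betw_same_card[OF bij] by (simp add: card_Diff_subset Compl_eq_Diff_UNIV)
  then obtain h' where h': "bij_betw h' (- f ` S) (- g ` S)"
    using finite_same_card_bij[of "- f ` S" "- g ` S"] by auto
  define \<sigma> where "\<sigma> x = (if x \<in> f ` S then h x else h' x)" for x
  have "bij_betw \<sigma> (f ` S) (g ` S)" "bij_betw \<sigma> (- f ` S) (- g ` S)"
    using bij h' bij_betw_cong[of "f ` S" \<sigma> h] bij_betw_cong[of "- f ` S" \<sigma> h'] by (simp_all add: \<sigma>_def)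
  then have "bij_betw \<sigma> (f ` S \<union> - f ` S) (g ` S \<union> - g ` S)"
    by (rule bij_betw_combine) auto
  then have "inj \<sigma>" by (simp add: bij_betw_def)
  then show ?thesis using that[of \<sigma>] h by (simp add: \<sigma>_def)
qed

text \<open>Permutation matrices allow the values of an index to be renamed. Hence the entry at an
  index whose level sets are the blocks of P is determined by P and can serve as a
  coordinate.\<close>

lemma orth_invariant_same_kernel:
  fixes u :: "('a \<Rightarrow> 'N::finite) \<Rightarrow> complex"
  assumes fin: "finite S" and u: "orth_invariant S u"
    and ker: "\<And>k l. k \<in> S \<Longrightarrow> l \<in> S \<Longrightarrow> i k = i l \<longleftrightarrow> j k = j l"
  shows "u i = u j"
proof -
  obtain \<sigma> where \<sigma>: "inj \<sigma>" "\<And>k. k \<in> S \<Longrightarrow> \<sigma> (i k) = j k"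
    by (rule inj_extension[of S i j]) (use ker in auto)
  have "u i = u (\<lambda>k. \<sigma> (i k))" using orth_invariant_permute[OF fin u \<sigma>(1)] by simp
  also have "\<dots> = u j" by (rule orth_invariant_cong[OF u]) (use \<sigma> in auto)
  finally show ?thesis .
qed

section \<open>Plane reflections and the spanning property of the pair partitions\<close>

lemma orthogonal_matrix_plane:
  fixes R :: "real^'N^'N"
  assumes ab: "a \<noteq> b" and cs: "c * c + s * s = 1"
    and R: "\<And>x y. R $ x $ y = (if x = a then if y = a then c else if y = b then s else 0
        else if x = b then if y = a then s else if y = b then - c else 0
        else if y = x then 1 else 0)"
  shows "orthogonal_matrix R"
proof (rule orthogonal_matrixI)
  fix x x'
  \<comment> \<open>Splitting off the columns a and b leaves only the diagonal entry of a row
    outside the plane.\<close>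
  have "(\<Sum>y\<in>UNIV. R $ x $ y * R $ x' $ y)
      = (\<Sum>y\<in>UNIV. (if y = a then R $ x $ a * R $ x' $ a else 0)
        + (if y = b then R $ x $ b * R $ x' $ b else 0)
        + (if y = x then if x \<noteq> a \<and> x \<noteq> b \<and> x = x' then 1 else 0 else 0))"
    by (rule sum.cong[OF refl]) (use ab in \<open>auto simp: R\<close>)
  also have "\<dots> = R $ x $ a * R $ x' $ a + R $ x $ b * R $ x' $ b
      + (if x \<noteq> a \<and> x \<noteq> b \<and> x = x' then 1 else 0)"
    by (simp add: sum.distrib)
  also have "\<dots> = (if x = x' then 1 else 0)"
    using ab cs by (auto simp: R algebra_simps)
  finally show "(\<Sum>y\<in>UNIV. R $ x $ y * R $ x' $ y) = (if x = x' then 1 else 0)" .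
qed

text \<open>Each position k with i k = a independently keeps the value a with weight c or moves to b
  with weight s, and B is the set of positions that move. All other positions stay, since i never
  takes the value b and the rows outside the plane are unit vectors.\<close>

lemma orth_act_plane:
  fixes u :: "('a \<Rightarrow> 'N::finite) \<Rightarrow> complex"
  assumes fin: "finite S" and u: "\<And>i. u (restrict i S) = u i" and ab: "a \<noteq> b"
    and Ra: "\<And>y. R $ a $ y = (if y = a then c else if y = b then s else 0)"
    and Rx: "\<And>x y. x \<noteq> a \<Longrightarrow> x \<noteq> b \<Longrightarrow> R $ x $ y = (if y = x then 1 else 0)"
    and b: "b \<notin> i ` S" and A: "A = {k\<in>S. i k = a}"
  shows "orth_act R S u i
    = (\<Sum>B\<in>Pow A. of_real (c ^ card (A - B) * s ^ card B) * u (\<lambda>k. if k \<in> B then b else i k))"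
proof -
  define h where "h B = restrict (\<lambda>k. if k \<in> B then b else i k) S" for B
  have finA: "finite A" and AS: "A \<subseteq> S" using fin A by auto
  have inj: "inj_on h (Pow A)"
  proof (rule inj_onI)
    fix B C assume B: "B \<in> Pow A" "C \<in> Pow A" and eq: "h B = h C"
    have "D = {k\<in>S. h D k = b}" if "D \<subseteq> A" for D
      using that AS b by (auto simp: h_def)
    then show "B = C" using B eq by (metis PowD)
  qed
  have "orth_act R S u i = (\<Sum>j\<in>h ` Pow A. (\<Prod>k\<in>S. of_real (R $ i k $ j k)) * u j)"
    unfolding orth_act_def
  proof (rule sum.mono_neutral_right)
    show "finite (indices S :: ('a \<Rightarrow> 'N) set)" using fin by (simp add: finite_PiE)
    show "h ` Pow A \<subseteq> indices S" by (auto simp: h_def)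
    show "\<forall>j\<in>indices S - h ` Pow A. (\<Prod>k\<in>S. of_real (R $ i k $ j k)) * u j = 0"
    proof
      fix j assume j: "j \<in> indices S - h ` Pow A"
      have "\<exists>k\<in>S. R $ i k $ j k = 0"
      proof (rule ccontr)
        assume "\<not> ?thesis"
        then have nz: "R $ i k $ j k \<noteq> 0" if "k \<in> S" for k using that by auto
        define B where "B = {k\<in>A. j k = b}"
        have "j k = h B k" for k
        proof (cases "k \<in> S")
          case False then show ?thesis using j by (simp add: h_def PiE_arb[of j S "\<lambda>_. UNIV"])
        next
          case True
          then have "i k \<noteq> b" using b by auto
          show ?thesis
          proof (cases "i k = a")
            case True
            then have "j k = a \<or> j k = b" using nz[OF \<open>k \<in> S\<close>] by (auto simp: Ra split: if_splits)
            then show ?thesis using True \<open>k \<in> S\<close> ab by (auto simp: h_def B_def A)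
          next
            case False
            then have "j k = i k" using nz[OF \<open>k \<in> S\<close>] \<open>i k \<noteq> b\<close> by (auto simp: Rx split: if_splits)
            then show ?thesis using False \<open>k \<in> S\<close> by (auto simp: h_def B_def A)
          qed
        qed
        then have "j = h B" by blast
        moreover have "B \<in> Pow A" by (auto simp: B_def)
        ultimately show False using j by blast
      qed
      then show "(\<Prod>k\<in>S. of_real (R $ i k $ j k)) * u j = 0" using fin by auto
    qed
  qed
  also have "\<dots> = (\<Sum>B\<in>Pow A. (\<Prod>k\<in>S. of_real (R $ i k $ h B k)) * u (h B))"
    by (rule sum.reindex[OF inj, unfolded o_def])
  also have "\<dots> = (\<Sum>B\<in>Pow A. of_real (c ^ card (A - B) * s ^ card B) * u (\<lambda>k. if k \<in> B then b else i k))"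
  proof (rule sum.cong[OF refl])
    fix B assume "B \<in> Pow A"
    then have B: "B \<subseteq> A" by simp
    have S: "S = B \<union> (A - B) \<union> (S - A)" using B AS by auto
    have fins: "finite B" "finite (A - B)" "finite (S - A)" using B finA fin finite_subset by auto
    have p1: "(\<Prod>k\<in>B. R $ i k $ h B k) = s ^ card B"
    proof -
      have "R $ i k $ h B k = s" if "k \<in> B" for k
      proof -
        have "k \<in> S" "i k = a" using that B by (auto simp: A)
        then show ?thesis using that ab by (simp add: h_def Ra)
      qed
      then show ?thesis by simp
    qed
    have p2: "(\<Prod>k\<in>A - B. R $ i k $ h B k) = c ^ card (A - B)"
    proof -
      have "R $ i k $ h B k = c" if "k \<in> A - B" for k
      proof -
        have "k \<in> S" "i k = a" "k \<notin> B" using that by (auto simp: A)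
        then show ?thesis by (simp add: h_def Ra)
      qed
      then show ?thesis by simp
    qed
    have p3: "(\<Prod>k\<in>S - A. R $ i k $ h B k) = 1"
    proof (rule prod.neutral, rule ballI)
      fix k assume k: "k \<in> S - A"
      then have "i k \<noteq> a" "i k \<noteq> b" "k \<notin> B" using b B by (auto simp: A)
      then show "R $ i k $ h B k = 1" using k by (simp add: h_def Rx)
    qed
    have "(\<Prod>k\<in>S. R $ i k $ h B k) = (\<Prod>k\<in>B \<union> (A - B) \<union> (S - A). R $ i k $ h B k)"
      using S by simp
    also have "\<dots> = s ^ card B * c ^ card (A - B)"
    proof -
      have "B \<inter> (A - B) = {}" "(B \<union> (A - B)) \<inter> (S - A) = {}" using B by auto
      then show ?thesis using fins by (simp only: prod.union_disjoint finite_UnI p1 p2 p3 mult_1_right)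
    qed
    finally have "(\<Prod>k\<in>S. R $ i k $ h B k) = c ^ card (A - B) * s ^ card B" by simp
    moreover have "u (h B) = u (\<lambda>k. if k \<in> B then b else i k)" by (simp only: h_def u)
    ultimately show "(\<Prod>k\<in>S. of_real (R $ i k $ h B k)) * u (h B)
        = of_real (c ^ card (A - B) * s ^ card B) * u (\<lambda>k. if k \<in> B then b else i k)"
      by (simp only: of_real_prod[symmetric])
  qed
  finally show ?thesis .
qed

text \<open>
  This is the first fundamental theorem for the orthogonal group in the stable range. A value \<open>a\<close> taken at least four times is split by
  the reflection \<open>e_a \<mapsto> 3/5 e_a + 4/5 e_b\<close> with a value \<open>b\<close> not yet taken. In the resulting equation the
  two terms having as few values as before contribute \<open>(3/5)^m + (4/5)^m < 1\<close> times the original entry,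
  and all other terms have more values.
\<close>

lemma orth_invariant_zero:
  fixes u :: "('a \<Rightarrow> 'N::finite) \<Rightarrow> complex"
  assumes fin: "finite S" and small: "card S \<le> 2 * CARD('N)" and u: "orth_invariant S u"
    and zero: "\<And>i. (\<And>k. k \<in> S \<Longrightarrow> card {l\<in>S. i l = i k} = 2) \<Longrightarrow> u i = 0"
  shows "u i = 0"
\<comment> \<open>The number of distinct values increases in the inductive step and is bounded by
  CARD('N).\<close>
proof (induction "CARD('N) - card (i ` S)" arbitrary: i rule: less_induct)
  case less
  show ?case
  proof (cases "\<exists>k\<in>S. odd (card {l\<in>S. i l = i k})")
    case True
    then show ?thesis using orth_invariant_odd[OF fin u] by blast
  next
    case False
    show ?thesis
    proof (cases "\<forall>k\<in>S. card {l\<in>S. i l = i k} = 2")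
      case True
      then show ?thesis using zero by blast
    next
      case nz: False
      have ge2: "2 \<le> card {l\<in>S. i l = i k}" if "k \<in> S" for k
      proof -
        have "k \<in> {l\<in>S. i l = i k}" using that by simp
        then have "card {l\<in>S. i l = i k} \<noteq> 0" using fin by (auto simp: card_eq_0_iff)
        moreover have "even (card {l\<in>S. i l = i k})" using False that by blast
        ultimately show ?thesis by (metis One_nat_def less_2_cases_iff not_le odd_one)
      qed
      obtain k0 where k0: "k0 \<in> S" "card {l\<in>S. i l = i k0} \<noteq> 2" using nz by blast
      define a where "a = i k0"
      define A where "A = {k\<in>S. i k = a}"
      have finA: "finite A" and AS: "A \<subseteq> S" using fin by (auto simp: A_def)
      have A4: "4 \<le> card A"
      proof -
        have "2 \<le> card A" "card A \<noteq> 2" "even (card A)"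
          using ge2[OF k0(1)] k0 False by (auto simp: A_def a_def)
        then show ?thesis by presburger
      qed
      \<comment> \<open>Every value occurs at least twice and a at least four times, so 4 + 2 (v -
        1) \<le> card S for the number v of values. Together with card S \<le> 2 N this gives v < N
        and thus a free value b.\<close>
      have "card S = (\<Sum>x\<in>i ` S. card {l\<in>S. i l = x})"
        using fin sum.image_gen[of S "\<lambda>_. 1::nat" i] by simp
      also have "\<dots> = card A + (\<Sum>x\<in>i ` S - {a}. card {l\<in>S. i l = x})"
        using fin k0 by (subst sum.remove[of _ a]) (auto simp: A_def a_def)
      also have "\<dots> \<ge> 4 + (\<Sum>x\<in>i ` S - {a}. 2)"
        using ge2 by (intro add_mono A4 sum_mono) auto
      finally have "4 + 2 * card (i ` S - {a}) \<le> card S" by simp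
      moreover have "card (i ` S) = Suc (card (i ` S - {a}))"
        using fin k0 by (subst card_Suc_Diff1) (auto simp: a_def)
      ultimately have less_N: "card (i ` S) < CARD('N)" using small by linarith
      then obtain b where b: "b \<notin> i ` S" by (metis UNIV_I nat_neq_iff subsetI top.extremum_uniqueI)
      have ab: "a \<noteq> b" using b k0 by (auto simp: a_def)
      define R :: "real^'N^'N" where
        "R = (\<chi> x y. if x = a then if y = a then 3/5 else if y = b then 4/5 else 0
          else if x = b then if y = a then 4/5 else if y = b then - (3/5) else 0
          else if y = x then 1 else 0)"
      let ?i = "\<lambda>B k. if k \<in> B then b else i k"
      let ?c = "\<lambda>B. of_real ((3/5) ^ card (A - B) * (4/5) ^ card B) :: complex"
      have "orthogonal_matrix R"
        by (rule orthogonal_matrix_plane[OF ab, of "3/5" "4/5"]) (auto simp: R_def)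
      then have "u i = orth_act R S u i" using u by (simp add: orth_invariant_def)
      also have "\<dots> = (\<Sum>B\<in>Pow A. ?c B * u (?i B))"
        by (rule orth_act_plane[OF fin _ ab])
          (use u b ab in \<open>auto simp: R_def A_def orth_invariant_def\<close>)
      also have "\<dots> = (\<Sum>B\<in>{{}, A}. ?c B * u (?i B))"
      proof (rule sum.mono_neutral_right)
        show "\<forall>B\<in>Pow A - {{}, A}. ?c B * u (?i B) = 0"
        proof
          fix B assume B: "B \<in> Pow A - {{}, A}"
          have "?i B ` S = insert b (i ` S)"
          proof
            show "insert b (i ` S) \<subseteq> ?i B ` S"
            proof
              fix x assume "x \<in> insert b (i ` S)"
              then consider "x = b" | "x = a" | k where "k \<in> S" "x = i k" "x \<noteq> a" by blast
              then show "x \<in> ?i B ` S"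
              proof cases
                case 1
                obtain k where "k \<in> B" using B by blast
                then show ?thesis using 1 B AS by (intro image_eqI[of _ _ k]) auto
              next
                case 2
                obtain k where "k \<in> A" "k \<notin> B" using B by blast
                then show ?thesis using 2 by (intro image_eqI[of _ _ k]) (auto simp: A_def)
              next
                case 3
                then show ?thesis using B by (intro image_eqI[of _ _ k]) (auto simp: A_def)
              qed
            qed
          qed auto
          then have "card (?i B ` S) = Suc (card (i ` S))" using b fin by simp
          then have "u (?i B) = 0" using less_N by (intro less.hyps) simp
          then show "?c B * u (?i B) = 0" by simp
        qed
      qed (use finA in auto)
      also have "\<dots> = of_real ((3/5) ^ card A) * u i + of_real ((4/5) ^ card A) * u (?i A)"
        using A4 by (subst sum.insert) (auto simp: card_eq_0_iff)
      \<comment> \<open>Moving all occurrences of a to the fresh value b only renames a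
        value.\<close>
      also have "u (?i A) = u i"
      proof (rule orth_invariant_same_kernel[OF fin u])
        fix k l assume "k \<in> S" "l \<in> S"
        then show "(?i A k = ?i A l) = (i k = i l)" using b by (auto simp: A_def)
      qed
      finally have eq: "u i = of_real ((3/5) ^ card A + (4/5) ^ card A) * u i"
        unfolding of_real_add distrib_right .
      \<comment> \<open>The relation (3/5)^2 + (4/5)^2 = 1 makes the matrix orthogonal with rational
        entries. With an exponent of at least 4 the sum drops below 1, whereas for a value taken
        twice the equation would say nothing.\<close>
      have "(3/5::real) ^ card A + (4/5) ^ card A \<le> (3/5) ^ 4 + (4/5) ^ 4"
        using A4 by (intro add_mono power_decreasing) auto
      also have "\<dots> < 1" by (simp add: power_divide)
      finally have "(3/5::real) ^ card A + (4/5) ^ card A \<noteq> 1" by simp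
      then show ?thesis using eq by (metis mult_cancel_right1 of_real_eq_1_iff)
    qed
  qed
qed

text \<open>A block of P on which i is constant has two elements and lies in a level set of i with
  two elements, hence equals it. So among the tensors e_P exactly one, for P = P0, is nonzero at
  i.\<close>

lemma pair_partition_of_kernel:
  assumes fin: "finite S" and two: "\<And>k. k \<in> S \<Longrightarrow> card {l\<in>S. i l = i k} = 2"
  defines "P0 \<equiv> (\<lambda>k. {l\<in>S. i l = i k}) ` S"
  shows "P0 \<in> pair_partitions S"
    and "\<And>k l. k \<in> S \<Longrightarrow> l \<in> S \<Longrightarrow> block_of P0 k = block_of P0 l \<longleftrightarrow> i k = i l"
    and "\<And>P. P \<in> pair_partitions S \<Longrightarrow> block_const P i \<longleftrightarrow> P = P0"
proof -
  have part: "partition_on S P0"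
    by (rule partition_onI) (auto simp: P0_def disjnt_def)
  then show P0: "P0 \<in> pair_partitions S" using two by (auto simp: pair_partitions_def P0_def)
  have bl: "block_of P0 k = {l\<in>S. i l = i k}" if "k \<in> S" for k
    by (rule block_of_eq[OF part]) (use that in \<open>auto simp: P0_def\<close>)
  show "block_of P0 k = block_of P0 l \<longleftrightarrow> i k = i l" if "k \<in> S" "l \<in> S" for k l
    using that by (auto simp: bl)
  show "block_const P i \<longleftrightarrow> P = P0" if P: "P \<in> pair_partitions S" for P
  proof
    assume "P = P0" then show "block_const P i" by (auto simp: block_const_def P0_def)
  next
    assume bc: "block_const P i"
    have pP: "partition_on S P" using P by (simp add: pair_partitions_def)
    have eq: "block_of P k = {l\<in>S. i l = i k}" if "k \<in> S" for k
    proof (rule card_subset_eq)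
      show "block_of P k \<subseteq> {l\<in>S. i l = i k}"
        using bc block_of_in[OF pP that] partition_onD1[OF pP] unfolding block_const_def by blast
      show "card (block_of P k) = card {l\<in>S. i l = i k}"
        using P block_of_in[OF pP that] two[OF that] by (simp add: pair_partitions_def)
    qed (use fin in simp)
    have "P = block_of P ` S"
    proof
      show "P \<subseteq> block_of P ` S"
      proof
        fix B assume B: "B \<in> P"
        then obtain k where "k \<in> B" using partition_onD3[OF pP] by (metis equals0I)
        then have "k \<in> S" "block_of P k = B" using B block_of_eq[OF pP B] partition_onD1[OF pP] by auto
        then show "B \<in> block_of P ` S" by blast
      qed
    qed (use block_of_in[OF pP] in auto)
    also have "\<dots> = P0" unfolding P0_def by (rule image_cong) (simp_all add: eq)
    finally show "P = P0" .
  qed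
qed

lemma finite_pair_partitions: "finite S \<Longrightarrow> finite (pair_partitions S)"
  unfolding pair_partitions_def by (rule finite_subset[OF _ finitely_many_partition_on[of S]]) auto

text \<open>The difference v of the two sides is invariant, and it vanishes at every index whose
  level sets are pairs, because only one e_P is nonzero there; \<open>orth_invariant_zero\<close>
  then gives v = 0. The function g supplies for each P an index with the blocks of P as level sets
  on S.\<close>

lemma orth_invariant_expansion:
  fixes u :: "('a \<Rightarrow> 'N::finite) \<Rightarrow> complex"
  assumes fin: "finite S" and small: "card S \<le> 2 * CARD('N)" and u: "orth_invariant S u"
    and g: "\<And>P k l. P \<in> pair_partitions S \<Longrightarrow> k \<in> S \<Longrightarrow> l \<in> S \<Longrightarrow>
      g P k = g P l \<longleftrightarrow> block_of P k = block_of P l"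
  shows "u i = (\<Sum>P\<in>pair_partitions S. u (g P) * of_bool (block_const P i))"
proof -
  define v where "v i = u i - (\<Sum>P\<in>pair_partitions S. u (g P) * of_bool (block_const P i))" for i
  let ?e = "\<lambda>P i. of_bool (block_const P i) :: complex"
  have e: "orth_invariant S (\<lambda>i :: 'a \<Rightarrow> 'N. ?e P i)" if "P \<in> pair_partitions S" for P
    using orth_invariant_block_const[OF fin that] .
  have "v i = 0"
  proof (rule orth_invariant_zero[OF fin small])
    show "orth_invariant S v"
      unfolding orth_invariant_def
    proof (intro conjI allI impI)
      fix i :: "'a \<Rightarrow> 'N"
      show "v (restrict i S) = v i"
        using u e unfolding v_def orth_invariant_def by (auto intro!: sum.cong)
      fix R :: "real^'N^'N" assume R: "orthogonal_matrix R"
      have "orth_act R S v i = orth_act R S u i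
          - (\<Sum>P\<in>pair_partitions S. u (g P) * orth_act R S (?e P) i)"
        unfolding orth_act_def v_def
        by (simp add: sum_distrib_left sum_subtractf right_diff_distrib mult_ac)
          (rule sum.swap)
      also have "\<dots> = v i"
        using u e R unfolding v_def orth_invariant_def by (auto intro!: sum.cong)
      finally show "orth_act R S v i = v i" .
    qed
    fix i :: "'a \<Rightarrow> 'N" assume two: "\<And>k. k \<in> S \<Longrightarrow> card {l\<in>S. i l = i k} = 2"
    define P0 where "P0 = (\<lambda>k. {l\<in>S. i l = i k}) ` S"
    note P0 = pair_partition_of_kernel[OF fin two, folded P0_def]
    have "(\<Sum>P\<in>pair_partitions S. u (g P) * ?e P i)
        = (\<Sum>P\<in>pair_partitions S. if P = P0 then u (g P0) else 0)"
      by (rule sum.cong[OF refl]) (use P0(3) in auto)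
    also have "\<dots> = u (g P0)" using P0(1) finite_pair_partitions[OF fin] by simp
    also have "\<dots> = u i"
      by (rule orth_invariant_same_kernel[OF fin u]) (use g P0 in simp)
    finally show "v i = 0" by (simp add: v_def)
  qed
  then show ?thesis by (simp add: v_def)
qed

section \<open>Joins of pair partitions and the Weingarten matrix\<close>

definition join_rel :: "'a set set \<Rightarrow> 'a set set \<Rightarrow> ('a \<times> 'a) set" where
  "join_rel P Q = {(x, y). \<exists>B\<in>P \<union> Q. x \<in> B \<and> y \<in> B}"

lemma part_join_eq: "part_join A P Q = A // (join_rel P Q)\<^sup>+"
  by (simp add: part_join_def join_rel_def)

lemma partition_on_part_join:
  "partition_on A P \<Longrightarrow> partition_on A Q \<Longrightarrow> partition_on A (part_join A P Q)"
  using part_join_least_upper_bound(1) by (auto simp: refines_def)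

text \<open>In terms of tensors, the entrywise product of e_P and e_Q is the indicator tensor of the
  join.\<close>

lemma block_const_part_join:
  assumes P: "partition_on A P" and Q: "partition_on A Q"
  shows "block_const (part_join A P Q) j \<longleftrightarrow> block_const P j \<and> block_const Q j"
proof
  assume J: "block_const (part_join A P Q) j"
  show "block_const P j \<and> block_const Q j"
    using part_join_least_upper_bound(1,2)[OF P Q] J unfolding refines_def block_const_def by (meson subsetD)
next
  assume PQ: "block_const P j \<and> block_const Q j"
  have step: "j x = j y" if "(x, y) \<in> join_rel P Q" for x y
    using that PQ unfolding join_rel_def block_const_def by blast
  have steps: "j x = j y" if "(x, y) \<in> (join_rel P Q)\<^sup>+" for x y
    using that by (induction rule: trancl_induct) (metis step)+
  show "block_const (part_join A P Q) j"
    unfolding block_const_def part_join_eq by (metis ImageE quotientE singletonD steps)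
qed

lemma part_join_image:
  assumes h: "inj_on h A" and P: "partition_on A P" and Q: "partition_on A Q"
  shows "part_join (h ` A) ((`) h ` P) ((`) h ` Q) = (`) h ` part_join A P Q"
proof -
  let ?r = "join_rel P Q" and ?r' = "join_rel ((`) h ` P) ((`) h ` Q)"
  have sub: "B \<subseteq> A" if "B \<in> P \<union> Q" for B using that P Q by (auto simp: partition_on_def)
  have fwd: "(h x, h y) \<in> ?r'\<^sup>+" if "(x, y) \<in> ?r\<^sup>+" for x y
    using that
  proof (induction rule: trancl_induct)
    case (base y)
    then have "(h x, h y) \<in> ?r'" by (auto simp: join_rel_def)
    then show ?case by blast
  next
    case (step y z)
    then have "(h y, h z) \<in> ?r'" by (auto simp: join_rel_def)
    with step show ?case by (meson trancl.trancl_into_trancl)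
  qed
  have step: "\<exists>y. z = h y \<and> (x, y) \<in> ?r \<and> y \<in> A" if hx: "(h x, z) \<in> ?r'" "x \<in> A" for x z
  proof -
    obtain B where B: "B \<in> P \<union> Q" "h x \<in> h ` B" "z \<in> h ` B" using hx by (auto simp: join_rel_def)
    then have "x \<in> B" using sub[of B] h hx(2) by (auto simp: inj_on_def)
    then show ?thesis using B sub[of B] by (auto simp: join_rel_def)
  qed
  have bwd: "\<exists>y. z = h y \<and> (x, y) \<in> ?r\<^sup>+ \<and> y \<in> A" if "(h x, z) \<in> ?r'\<^sup>+" "x \<in> A" for x z
    using that
  proof (induction rule: trancl_induct)
    case (base z)
    then show ?case using step by blast
  next
    case (step w z)
    then show ?case using \<open>\<And>x z. (h x, z) \<in> ?r' \<Longrightarrow> x \<in> A \<Longrightarrow> \<exists>y. z = h y \<and> (x, y) \<in> ?r \<and> y \<in> A\<close>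
      by (metis trancl.trancl_into_trancl)
  qed
  have cls: "?r'\<^sup>+ `` {h x} = h ` (?r\<^sup>+ `` {x})" if "x \<in> A" for x
    using fwd bwd that by blast
  have "part_join (h ` A) ((`) h ` P) ((`) h ` Q) = (\<lambda>x. ?r'\<^sup>+ `` {h x}) ` A"
    by (auto simp: part_join_eq quotient_def)
  also have "\<dots> = (\<lambda>x. h ` (?r\<^sup>+ `` {x})) ` A" by (rule image_cong) (auto simp: cls)
  also have "\<dots> = (`) h ` part_join A P Q" by (auto simp: part_join_eq quotient_def)
  finally show ?thesis .
qed

text \<open>This is the Gram matrix entry of e_P and e_Q: one free value per block of the
  join.\<close>

lemma card_block_const:
  assumes fin: "finite A" and P: "partition_on A P" and Q: "partition_on A Q"
  shows "card {j \<in> indices A :: ('a \<Rightarrow> 'N::finite) set. block_const P j \<and> block_const Q j}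
    = CARD('N) ^ card (part_join A P Q)"
proof -
  have J: "partition_on A (part_join A P Q)" by (rule partition_on_part_join[OF P Q])
  have "card {j \<in> indices A :: ('a \<Rightarrow> 'N::finite) set. block_const P j \<and> block_const Q j}
      = card (indices (part_join A P Q) :: ('a set \<Rightarrow> 'N) set)"
    using bij_betw_same_card[OF bij_betw_block_const[OF J, where 'b = 'N]] by (simp add: block_const_part_join[OF P Q])
  then show ?thesis using finite_elements[OF fin J] by (simp add: card_PiE)
qed

lemma image_pair_partitions:
  assumes h: "bij_betw h A A'"
  shows "bij_betw ((`) ((`) h)) (pair_partitions A) (pair_partitions A')"
proof -
  have into: "(`) ((`) h) P \<in> pair_partitions A'" if h: "bij_betw h A A'" and P: "P \<in> pair_partitions A"
    for h :: "'c \<Rightarrow> 'd" and A A' P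
  proof -
    have part: "partition_on A P" using P by (simp add: pair_partitions_def)
    have inj: "inj_on h A" and im: "h ` A = A'" using h by (auto simp: bij_betw_def)
    have "partition_on (h ` A) ((`) h ` P - {{}})" by (rule partition_on_inj_image[OF part inj])
    moreover have "(`) h ` P - {{}} = (`) h ` P" using partition_onD3[OF part] by auto
    moreover have "card (h ` B) = 2" if "B \<in> P" for B
    proof -
      have "B \<subseteq> A" using that partition_onD1[OF part] by auto
      then have "card (h ` B) = card B" by (intro card_image inj_on_subset[OF inj])
      then show ?thesis using P that by (simp add: pair_partitions_def)
    qed
    ultimately show ?thesis by (auto simp: pair_partitions_def im)
  qed
  have inv: "(`) ((`) g) ((`) ((`) h) P) = P" if "\<And>x. x \<in> A \<Longrightarrow> g (h x) = x" and P: "P \<in> pair_partitions A"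
    for h :: "'c \<Rightarrow> 'd" and g A P
  proof -
    have "g ` h ` B = B" if "B \<in> P" for B
    proof -
      have "x \<in> A" if "x \<in> B" for x using that \<open>B \<in> P\<close> P by (auto simp: pair_partitions_def partition_on_def)
      then show ?thesis using \<open>\<And>x. x \<in> A \<Longrightarrow> g (h x) = x\<close> by (force simp: image_image)
    qed
    then show ?thesis by (simp add: image_image)
  qed
  let ?g = "inv_into A h"
  show ?thesis
  proof (rule bij_betw_byWitness[where f' = "(`) ((`) ?g)"])
    show "\<forall>P\<in>pair_partitions A. (`) ((`) ?g) ((`) ((`) h) P) = P"
      using inv[of A ?g h] h by (auto simp: bij_betw_def)
    show "\<forall>P\<in>pair_partitions A'. (`) ((`) h) ((`) ((`) ?g) P) = P"
      using inv[of A' h ?g] h by (auto simp: bij_betw_def f_inv_into_f)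
  qed (use into[OF h] into[OF bij_betw_inv_into[OF h]] in auto)
qed

text \<open>P has half as many blocks as S has elements, hence at most CARD('N), so distinct blocks
  can get distinct values. Evaluation at g is then dual to e_P.\<close>

lemma ex_dual_index:
  fixes S :: "'a set"
  assumes fin: "finite S" and P: "P \<in> pair_partitions S" and small: "card S \<le> 2 * CARD('N::finite)"
  obtains g :: "'a \<Rightarrow> 'N::finite" where "\<And>k l. k \<in> S \<Longrightarrow> l \<in> S \<Longrightarrow> g k = g l \<longleftrightarrow> block_of P k = block_of P l"
    and "\<And>Q. Q \<in> pair_partitions S \<Longrightarrow> block_const Q g \<longleftrightarrow> Q = P"
proof -
  have part: "partition_on S P" and two: "\<And>B. B \<in> P \<Longrightarrow> card B = 2" using P by (auto simp: pair_partitions_def)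
  have "card (\<Union>P) = sum card P"
    by (rule card_Union_disjoint)
      (use part partition_onD1[OF part] fin in \<open>auto simp: partition_on_def pairwise_def disjnt_def disjoint_def intro: finite_subset\<close>)
  then have "card S = 2 * card P" using partition_onD1[OF part] two by simp
  then obtain f :: "'a set \<Rightarrow> 'N" where f: "inj_on f P"
    using card_le_inj[of P "UNIV :: 'N set"] finite_elements[OF fin part] small by auto
  define g where "g k = f (block_of P k)" for k
  have g: "g k = g l \<longleftrightarrow> block_of P k = block_of P l" if "k \<in> S" "l \<in> S" for k l
    using f block_of_in(1)[OF part] that by (auto simp: g_def inj_on_eq_iff)
  have fib: "{l\<in>S. g l = g k} = block_of P k" if k: "k \<in> S" for k
  proof
    show "{l\<in>S. g l = g k} \<subseteq> block_of P k" using g[OF _ k] block_of_in(2)[OF part] by auto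
    show "block_of P k \<subseteq> {l\<in>S. g l = g k}"
    proof
      fix l assume l: "l \<in> block_of P k"
      have "block_of P k \<in> P" using block_of_in(1)[OF part k] .
      then have "block_of P l = block_of P k" "l \<in> S"
        using block_of_eq[OF part _ l] partition_onD1[OF part] l by auto
      then show "l \<in> {l\<in>S. g l = g k}" by (simp add: g_def)
    qed
  qed
  have two': "card {l\<in>S. g l = g k} = 2" if "k \<in> S" for k
    using fib[OF that] two block_of_in(1)[OF part that] by simp
  have ker: "block_const Q g \<longleftrightarrow> Q = (\<lambda>k. {l\<in>S. g l = g k}) ` S" if "Q \<in> pair_partitions S" for Q
    by (rule pair_partition_of_kernel(3)[OF fin _ that]) (rule two')
  have "block_const P g"
    unfolding block_const_def g_def using block_of_eq[OF part] by metis
  then have "P = (\<lambda>k. {l\<in>S. g l = g k}) ` S" using ker[OF P] by blast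
  then show ?thesis using that[of g] g ker by metis
qed

section \<open>Inverses of matrices on finite index sets\<close>

definition is_inverse_on :: "'i set \<Rightarrow> ('i \<Rightarrow> 'i \<Rightarrow> real) \<Rightarrow> ('i \<Rightarrow> 'i \<Rightarrow> real) \<Rightarrow> bool" where
  "is_inverse_on S G W \<longleftrightarrow> (\<forall>a b. a \<notin> S \<or> b \<notin> S \<longrightarrow> W a b = 0) \<and>
     (\<forall>a\<in>S. \<forall>b\<in>S. (\<Sum>c\<in>S. G a c * W c b) = (if a = b then 1 else 0) \<and>
                    (\<Sum>c\<in>S. W a c * G c b) = (if a = b then 1 else 0))"

lemma matrix_assoc_on:
  fixes A B C :: "'i \<Rightarrow> 'i \<Rightarrow> real"
  shows "(\<Sum>c\<in>S. (\<Sum>d\<in>S. A a d * B d c) * C c b) = (\<Sum>d\<in>S. A a d * (\<Sum>c\<in>S. B d c * C c b))"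
  unfolding sum_distrib_left sum_distrib_right by (subst sum.swap) (simp add: mult.assoc)

lemma left_right_inverse_on:
  fixes G W V :: "'i \<Rightarrow> 'i \<Rightarrow> real"
  assumes fin: "finite S"
    and V: "\<And>a b. a \<in> S \<Longrightarrow> b \<in> S \<Longrightarrow> (\<Sum>c\<in>S. V a c * G c b) = (if a = b then 1 else 0)"
    and W: "\<And>a b. a \<in> S \<Longrightarrow> b \<in> S \<Longrightarrow> (\<Sum>c\<in>S. G a c * W c b) = (if a = b then 1 else 0)"
    and ab: "a \<in> S" "b \<in> S"
  shows "V a b = W a b"
proof -
  have "V a b = (\<Sum>d\<in>S. V a d * (\<Sum>c\<in>S. G d c * W c b))"
    using ab fin by (simp add: W if_distrib[of "(*) _"] cong: sum.cong if_cong)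
  also have "\<dots> = (\<Sum>c\<in>S. (\<Sum>d\<in>S. V a d * G d c) * W c b)" by (rule matrix_assoc_on[symmetric])
  also have "\<dots> = W a b" using ab fin by (simp add: V if_distrib[of "\<lambda>x. x * _"] cong: sum.cong if_cong)
  finally show ?thesis .
qed

lemma inverse_matrix_on_eqI:
  assumes fin: "finite S" and W: "is_inverse_on S G W"
  shows "inverse_matrix_on S G = W"
  unfolding inverse_matrix_on_def is_inverse_on_def[symmetric]
proof (rule the_equality[where P = "is_inverse_on S G", OF W])
  fix V assume V: "is_inverse_on S G V"
  show "V = W"
  proof (intro ext)
    fix a b
    show "V a b = W a b"
    proof (cases "a \<in> S \<and> b \<in> S")
      case True
      then show ?thesis using left_right_inverse_on[OF fin, of V G W a b] V W
        unfolding is_inverse_on_def by blast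
    next
      case False
      then show ?thesis using V W unfolding is_inverse_on_def by metis
    qed
  qed
qed

text \<open>Elimination of one unknown: with y solving for b and w for the column x on T, the pivot
  is the Schur complement s. If s were zero, the vector with entries - w on T and 1 at x would be in
  the kernel. Injectivity is assumed for every subset because the pivots come from principal
  submatrices; Gram matrices of independent vectors inherit it.\<close>

lemma linear_system_solvable:
  fixes G :: "'i \<Rightarrow> 'i \<Rightarrow> 'k::field"
  assumes "finite T"
    and "\<And>U v. U \<subseteq> T \<Longrightarrow> (\<And>a. a \<in> U \<Longrightarrow> (\<Sum>c\<in>U. G a c * v c) = 0) \<Longrightarrow> (\<And>a. a \<in> U \<Longrightarrow> v a = 0)"
  shows "\<exists>v. \<forall>a\<in>T. (\<Sum>c\<in>T. G a c * v c) = b a"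
  using assms
proof (induction T arbitrary: b rule: finite_induct)
  case empty
  then show ?case by simp
next
  case (insert x T)
  have sol: "\<exists>v. \<forall>a\<in>T. (\<Sum>c\<in>T. G a c * v c) = b a" for b
  proof (rule insert.IH)
    fix U v a assume "U \<subseteq> T" "\<And>a. a \<in> U \<Longrightarrow> (\<Sum>c\<in>U. G a c * v c) = 0" "a \<in> U"
    then show "v a = 0" using insert.prems[of U v a] by blast
  qed
  obtain y where y: "\<And>a. a \<in> T \<Longrightarrow> (\<Sum>c\<in>T. G a c * y c) = b a" using sol[of b] by blast
  obtain w where w: "\<And>a. a \<in> T \<Longrightarrow> (\<Sum>c\<in>T. G a c * w c) = G a x" using sol[of "\<lambda>a. G a x"] by blast
  have upd: "(\<Sum>c\<in>insert x T. G a c * ((\<lambda>c. f c)(x := t)) c) = G a x * t + (\<Sum>c\<in>T. G a c * f c)" for a f t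
  proof -
    have "(\<Sum>c\<in>T. G a c * (f(x := t)) c) = (\<Sum>c\<in>T. G a c * f c)"
      by (rule sum.cong[OF refl]) (use insert.hyps in auto)
    then show ?thesis using insert.hyps by simp
  qed
  define s where "s = G x x - (\<Sum>c\<in>T. G x c * w c)"
  have "s \<noteq> 0"
  proof
    assume s0: "s = 0"
    let ?v = "(\<lambda>c. - w c)(x := 1)"
    have "(\<Sum>c\<in>insert x T. G a c * ?v c) = 0" if "a \<in> insert x T" for a
      unfolding upd using that s0 w by (auto simp: s_def sum_negf)
    then have "?v x = 0" by (intro insert.prems[of "insert x T" ?v x]) auto
    then show False by simp
  qed
  define t where "t = (b x - (\<Sum>c\<in>T. G x c * y c)) / s"
  have "(\<Sum>c\<in>insert x T. G a c * ((\<lambda>c. y c - t * w c)(x := t)) c) = b a" if a: "a \<in> insert x T" for a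
  proof -
    have lin: "(\<Sum>c\<in>T. G a c * (y c - t * w c)) = (\<Sum>c\<in>T. G a c * y c) - t * (\<Sum>c\<in>T. G a c * w c)" for a
      by (simp add: right_diff_distrib sum_subtractf sum_distrib_left mult.left_commute)
    show ?thesis
    proof (cases "a = x")
      case True
      have "G x x * t + ((\<Sum>c\<in>T. G x c * y c) - t * (\<Sum>c\<in>T. G x c * w c)) = t * s + (\<Sum>c\<in>T. G x c * y c)"
        by (simp add: s_def algebra_simps)
      also have "\<dots> = b x" using \<open>s \<noteq> 0\<close> by (simp add: t_def)
      finally show ?thesis unfolding upd lin using True by simp
    next
      case False
      then show ?thesis unfolding upd lin using a y w by simp
    qed
  qed
  then show ?case by blast
qed

text \<open>The quadratic form of G is a sum of squares over J. A kernel vector v on a subset of S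
  therefore gives a combination of the rows e c that is zero at every j, and the index dual to a
  isolates v a.\<close>

lemma is_inverse_on_gram:
  fixes e :: "'i \<Rightarrow> 'j \<Rightarrow> real"
  assumes fin: "finite S" "finite J"
    and G: "\<And>a b. a \<in> S \<Longrightarrow> b \<in> S \<Longrightarrow> G a b = (\<Sum>j\<in>J. e a j * e b j)"
    and dual: "\<And>a. a \<in> S \<Longrightarrow> \<exists>j\<in>J. \<forall>b\<in>S. e b j = (if b = a then 1 else 0)"
  shows "\<exists>W. is_inverse_on S G W"
proof -
  have "v a = 0" if U: "U \<subseteq> S" and ker: "\<And>a. a \<in> U \<Longrightarrow> (\<Sum>c\<in>U. G a c * v c) = 0" and a: "a \<in> U" for U v a
  proof -
    have finU: "finite U" using U fin finite_subset by blast
    have "(\<Sum>j\<in>J. (\<Sum>c\<in>U. v c * e c j)\<^sup>2) = (\<Sum>a\<in>U. v a * (\<Sum>c\<in>U. G a c * v c))"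
    proof -
      have "(\<Sum>a\<in>U. v a * (\<Sum>c\<in>U. G a c * v c)) = (\<Sum>a\<in>U. \<Sum>c\<in>U. \<Sum>j\<in>J. (v a * e a j) * (v c * e c j))"
        unfolding sum_distrib_left
      proof (intro sum.cong refl)
        fix a c assume "a \<in> U" "c \<in> U"
        then have "G a c = (\<Sum>j\<in>J. e a j * e c j)" using U by (intro G) auto
        then show "v a * (G a c * v c) = (\<Sum>j\<in>J. (v a * e a j) * (v c * e c j))"
          by (simp add: sum_distrib_left sum_distrib_right mult_ac)
      qed
      also have "\<dots> = (\<Sum>a\<in>U. \<Sum>j\<in>J. \<Sum>c\<in>U. (v a * e a j) * (v c * e c j))"
        by (rule sum.cong[OF refl], rule sum.swap)
      also have "\<dots> = (\<Sum>j\<in>J. \<Sum>a\<in>U. \<Sum>c\<in>U. (v a * e a j) * (v c * e c j))"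
        by (rule sum.swap)
      also have "\<dots> = (\<Sum>j\<in>J. (\<Sum>c\<in>U. v c * e c j)\<^sup>2)"
        by (simp add: power2_eq_square sum_product)
      finally show ?thesis by simp
    qed
    also have "\<dots> = 0" using ker by simp
    finally have z: "\<forall>j\<in>J. (\<Sum>c\<in>U. v c * e c j)\<^sup>2 = 0"
      using fin by (subst (asm) sum_nonneg_eq_0_iff) auto
    obtain j where j: "j \<in> J" "\<And>b. b \<in> S \<Longrightarrow> e b j = (if b = a then 1 else 0)" using dual[of a] a U by blast
    have "(\<Sum>c\<in>U. v c * e c j) = (\<Sum>c\<in>U. if c = a then v a else 0)"
      by (rule sum.cong[OF refl]) (use j(2) U in auto)
    then show "v a = 0" using z j(1) a finU by simp
  qed
  then have "\<exists>v. \<forall>a\<in>S. (\<Sum>c\<in>S. G a c * v c) = (if a = b then 1 else 0)" for b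
    by (intro linear_system_solvable fin) blast
  \<comment> \<open>\<open>W b\<close> solves the system for the unit vector at b, so it is the
    column b of the inverse. Symmetry of G makes W also a left inverse, and then W itself is
    symmetric on S.\<close>
  then obtain W where W: "\<And>a b. a \<in> S \<Longrightarrow> (\<Sum>c\<in>S. G a c * W b c) = (if a = b then 1 else 0)"
    by metis
  have right: "(\<Sum>c\<in>S. G a c * W b c) = (if a = b then 1 else 0)" if "a \<in> S" "b \<in> S" for a b
    using W that by blast
  have sym: "G a b = G b a" if "a \<in> S" "b \<in> S" for a b
    using that G by (simp add: mult.commute)
  have left: "(\<Sum>c\<in>S. W a c * G c b) = (if a = b then 1 else 0)" if "a \<in> S" "b \<in> S" for a b
  proof -
    have "(\<Sum>c\<in>S. W a c * G c b) = (\<Sum>c\<in>S. G b c * W a c)"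
      by (rule sum.cong[OF refl]) (use that sym in auto)
    then show ?thesis using W[of b a] that by auto
  qed
  have eq: "W a b = W b a" if "a \<in> S" "b \<in> S" for a b
    using left_right_inverse_on[OF fin(1), of W G "\<lambda>a b. W b a" a b] left right that by blast
  define V where "V a b = (if a \<in> S \<and> b \<in> S then W b a else 0)" for a b
  have "is_inverse_on S G V"
    unfolding is_inverse_on_def
  proof (intro conjI ballI allI impI)
    fix a b assume ab: "a \<in> S" "b \<in> S"
    have "(\<Sum>c\<in>S. G a c * V c b) = (\<Sum>c\<in>S. G a c * W b c)"
      by (rule sum.cong[OF refl]) (use ab in \<open>auto simp: V_def\<close>)
    then show "(\<Sum>c\<in>S. G a c * V c b) = (if a = b then 1 else 0)" using right[OF ab] by simp
    have "(\<Sum>c\<in>S. V a c * G c b) = (\<Sum>c\<in>S. W a c * G c b)"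
    proof (rule sum.cong[OF refl])
      fix c assume "c \<in> S"
      then show "V a c * G c b = W a c * G c b" using ab eq[of a c] by (simp add: V_def)
    qed
    then show "(\<Sum>c\<in>S. V a c * G c b) = (if a = b then 1 else 0)" using left[OF ab] by simp
  qed (auto simp: V_def)
  then show ?thesis by blast
qed

text \<open>The permuted inverse is again a left inverse of G, and left and right inverses
  agree.\<close>

lemma inverse_matrix_on_symmetry:
  assumes fin: "finite S" and W: "is_inverse_on S G (inverse_matrix_on S G)"
    and \<phi>: "bij_betw \<phi> S S" and G: "\<And>a b. a \<in> S \<Longrightarrow> b \<in> S \<Longrightarrow> G (\<phi> a) (\<phi> b) = G a b"
    and ab: "a \<in> S" "b \<in> S"
  shows "inverse_matrix_on S G (\<phi> a) (\<phi> b) = inverse_matrix_on S G a b"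
proof -
  let ?W = "inverse_matrix_on S G"
  have \<phi>S: "\<phi> a \<in> S" if "a \<in> S" for a using that \<phi> by (auto simp: bij_betw_def)
  have \<phi>_eq: "\<phi> a = \<phi> b \<longleftrightarrow> a = b" if "a \<in> S" "b \<in> S" for a b
    using that \<phi> by (auto simp: bij_betw_def inj_on_def)
  have "(\<Sum>c\<in>S. ?W (\<phi> a) (\<phi> c) * G c b) = (if a = b then 1 else 0)" if "a \<in> S" "b \<in> S" for a b
  proof -
    have "(\<Sum>c\<in>S. ?W (\<phi> a) (\<phi> c) * G c b) = (\<Sum>c\<in>S. ?W (\<phi> a) (\<phi> c) * G (\<phi> c) (\<phi> b))"
      by (rule sum.cong[OF refl]) (use that G in auto)
    also have "\<dots> = (\<Sum>c\<in>S. ?W (\<phi> a) c * G c (\<phi> b))"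
      by (rule sum.reindex_bij_betw[OF \<phi>])
    finally show ?thesis using W that \<phi>S \<phi>_eq unfolding is_inverse_on_def by simp
  qed
  then show ?thesis
    using left_right_inverse_on[OF fin, of "\<lambda>a b. ?W (\<phi> a) (\<phi> b)" G ?W a b] W ab
    unfolding is_inverse_on_def by blast
qed

section \<open>Pair partitions as involutions, and walks along their joins\<close>

definition partner :: "'a set set \<Rightarrow> 'a \<Rightarrow> 'a" where
  "partner P x = (THE y. y \<noteq> x \<and> y \<in> block_of P x)"

lemma partner:
  assumes P: "P \<in> pair_partitions S" and x: "x \<in> S"
  shows "partner P x \<in> S" "partner P x \<noteq> x" "block_of P x = {x, partner P x}" "partner P (partner P x) = x"
proof -
  have part: "partition_on S P" using P by (simp add: pair_partitions_def)
  have bl: "block_of P x \<in> P" "x \<in> block_of P x" using block_of_in[OF part x] .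
  then have "card (block_of P x) = 2" using P by (simp add: pair_partitions_def)
  then obtain y where y: "block_of P x = {x, y}" "y \<noteq> x" using bl(2) by (metis card_2_iff insertE insert_commute singletonD)
  have py: "partner P x = y" unfolding partner_def y(1) by (rule the_equality) (use y in auto)
  have by': "block_of P y = {x, y}" using block_of_eq[OF part bl(1), of y] y by simp
  have "partner P y = x" unfolding partner_def by' by (rule the_equality) (use y in auto)
  then show "partner P x \<noteq> x" "block_of P x = {x, partner P x}" "partner P (partner P x) = x"
    using py y by auto
  show "partner P x \<in> S" using py y bl partition_onD1[OF part] by auto
qed

lemma pair_partition_eq_partner:
  assumes P: "P \<in> pair_partitions S"
  shows "P = (\<lambda>x. {x, partner P x}) ` S"
proof -
  have part: "partition_on S P" using P by (simp add: pair_partitions_def)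
  have "P = block_of P ` S"
  proof
    show "P \<subseteq> block_of P ` S"
    proof
      fix B assume B: "B \<in> P"
      then obtain k where "k \<in> B" using partition_onD3[OF part] by (metis equals0I)
      then have "k \<in> S" "block_of P k = B" using B block_of_eq[OF part B] partition_onD1[OF part] by auto
      then show "B \<in> block_of P ` S" by blast
    qed
  qed (use block_of_in[OF part] in auto)
  also have "\<dots> = (\<lambda>x. {x, partner P x}) ` S" by (rule image_cong) (use partner(3)[OF P] in auto)
  finally show ?thesis .
qed

lemma join_rel_partner:
  assumes P: "P \<in> pair_partitions S" and Q: "Q \<in> pair_partitions S"
  shows "(x, y) \<in> join_rel P Q \<longleftrightarrow> x \<in> S \<and> y \<in> {x, partner P x, partner Q x}"
proof -
  have "(\<exists>B\<in>P. x \<in> B \<and> y \<in> B) \<longleftrightarrow> x \<in> S \<and> y \<in> {x, partner P x}" if P: "P \<in> pair_partitions S" for P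
  proof -
    have part: "partition_on S P" using P by (simp add: pair_partitions_def)
    have "(\<exists>B\<in>P. x \<in> B \<and> y \<in> B) \<longleftrightarrow> x \<in> S \<and> y \<in> block_of P x"
      using block_of_eq[OF part] block_of_in[OF part] partition_onD1[OF part] by (metis UnionI)
    then show ?thesis using partner(3)[OF P] by auto
  qed
  from this[OF P] this[OF Q] show ?thesis by (auto simp: join_rel_def)
qed

text \<open>
  A block of the join of two pair partitions is traversed by applying the two partner maps in turn:
  position \<open>k\<close> of the walk is matched to position \<open>walk_even k\<close> by one and to \<open>walk_odd L k\<close> by the
  other partition, where \<open>L\<close> is the size of the block.
\<close>

definition walk_even :: "nat \<Rightarrow> nat" where
  "walk_even k = (if even k then Suc k else k - 1)"

definition walk_odd :: "nat \<Rightarrow> nat \<Rightarrow> nat" where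
  "walk_odd L k = (if odd k then if Suc k = L then 0 else Suc k else if k = 0 then L - 1 else k - 1)"

text \<open>The walk from x alternates between two involutions without fixed points, so it can be
  run backwards, and it first returns to x after an even number L of steps. It is injective before
  that, and its range is closed under both involutions, hence equal to the block of x in the
  join.\<close>

lemma alternating_walk:
  assumes fin: "finite S" and P: "P \<in> pair_partitions S" and Q: "Q \<in> pair_partitions S" and C: "C \<in> part_join S P Q"
  shows "\<exists>z. bij_betw z {..<card C} C \<and> (\<forall>k<card C. walk_odd (card C) k < card C \<and> walk_even k < card C \<and>
    partner P (z k) = z (walk_odd (card C) k) \<and> partner Q (z k) = z (walk_even k))"
proof -
  obtain x where x: "x \<in> S" and Cx: "C = (join_rel P Q)\<^sup>+ `` {x}"
    using C unfolding part_join_eq by (auto elim: quotientE)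
  note pP = partner[OF P] and pQ = partner[OF Q]
  define s where "s k = (if even k then partner Q else partner P)" for k :: nat
  define z where "z = rec_nat x (\<lambda>k y. s k y)"
  have z0: "z 0 = x" and zS: "z (Suc k) = s k (z k)" for k by (simp_all add: z_def)
  have z_in: "z k \<in> S" for k
    by (induction k) (use x pP(1) pQ(1) in \<open>auto simp: z0 zS s_def\<close>)
  have s_inv: "s k (s k y) = y" if "y \<in> S" for k y using that pP(4) pQ(4) by (simp add: s_def)
  have z_back: "s k (z (Suc k)) = z k" for k using s_inv[OF z_in] by (simp add: zS)
  have s_fpf: "s k y \<noteq> y" if "y \<in> S" for k y using that pP(2) pQ(2) by (simp add: s_def)
  have s_par: "s k = s l" if "even k = even l" for k l using that by (simp add: s_def)
  \<comment> \<open>Both positions have the same parity, so the same involution undoes their last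
    steps.\<close>
  have shift: "z d = z 0" if "z (d + i) = z i" "even d" for d i
    using that
  proof (induction i)
    case (Suc i)
    have "s (d + i) (z (Suc (d + i))) = s i (z (Suc i))" using Suc.prems s_par[of "d + i" i] by simp
    then show ?case using Suc z_back by simp
  qed simp
  \<comment> \<open>A coincidence at odd distance d can be shortened from both ends to one at
    distance d - 2, and finally to a fixed point of one of the involutions.\<close>
  have odd_ne: "z (d + i) \<noteq> z i" if "odd d" for d i
    using that
  proof (induction d arbitrary: i rule: less_induct)
    case (less d)
    show ?case
    proof
      assume eq: "z (d + i) = z i"
      show False
      proof (cases "d = 1")
        case True
        then show False using eq s_fpf[OF z_in] by (simp add: zS)
      next
        case False
        then obtain e where e: "d = Suc (Suc e)" using less.prems by (metis One_nat_def odd_pos old.nat.exhaust less_numeral_extra(3))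
        have "z (e + Suc i) = s (e + Suc i) (z (Suc (e + Suc i)))" by (rule z_back[symmetric])
        also have "z (Suc (e + Suc i)) = z i" using eq e by simp
        also have "s (e + Suc i) = s i" using less.prems e by (intro s_par) auto
        finally have "z (e + Suc i) = z (Suc i)" by (simp add: zS)
        then show False using less.IH[of e "Suc i"] less.prems e by auto
      qed
    qed
  qed
  \<comment> \<open>Pigeonhole on the even positions gives a repetition, and stepping back from it
    reaches the start.\<close>
  have "\<exists>d>0. even d \<and> z d = z 0"
  proof -
    have "finite (range (\<lambda>k. z (2 * k)))" using fin z_in by (meson finite_subset image_subsetI)
    then have "\<not> inj (\<lambda>k. z (2 * k))" using finite_imageD infinite_UNIV_nat by blast
    then obtain i j where "i < j" "z (2 * i) = z (2 * j)"
      unfolding inj_def by (metis linorder_neqE_nat)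
    moreover from \<open>i < j\<close> have "2 * j = 2 * (j - i) + 2 * i" by simp
    ultimately show ?thesis using shift[of "2 * (j - i)" "2 * i"] by (intro exI[of _ "2 * (j - i)"]) auto
  qed
  then obtain L where L: "L > 0" "even L" "z L = z 0"
    and least: "\<And>d. d > 0 \<Longrightarrow> even d \<Longrightarrow> z d = z 0 \<Longrightarrow> L \<le> d"
    using exists_least_iff[of "\<lambda>d. d > 0 \<and> even d \<and> z d = z 0"] by (metis not_le)
  have inj: "inj_on z {..<L}"
  proof (rule linorder_inj_onI')
    fix i j assume ij: "i \<in> {..<L}" "j \<in> {..<L}" "i < j"
    show "z i \<noteq> z j"
    proof
      assume eq: "z i = z j"
      then have "z (j - i + i) = z i" using ij by simp
      moreover from this have "even (j - i)" using odd_ne by blast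
      ultimately have "z (j - i) = z 0" by (rule shift)
      then show False using least[of "j - i"] ij \<open>even (j - i)\<close> by auto
    qed
  qed
  have L2: "2 \<le> L" using L(1,2) by presburger
  have odd_lt: "walk_odd L k < L" if "k < L" for k
    using that L2 by (auto simp: walk_odd_def)
  have even_lt: "walk_even k < L" if "k < L" for k
    using that L(2) by (cases "Suc k = L") (auto simp: walk_even_def)
  have stepQ: "partner Q (z k) = z (walk_even k)" if "k < L" for k
  proof (cases "even k")
    case True
    then show ?thesis by (simp add: walk_even_def zS s_def)
  next
    case False
    then obtain l where l: "k = Suc l" "even l" by (cases k) auto
    then show ?thesis using z_back[of l] by (simp add: walk_even_def s_def)
  qed
  have stepP: "partner P (z k) = z (walk_odd L k)" if "k < L" for k
  proof (cases "odd k")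
    case True
    then have "partner P (z k) = z (Suc k)" by (simp add: zS s_def)
    then show ?thesis using True L(3) by (simp add: walk_odd_def)
  next
    case False
    show ?thesis
    proof (cases "k = 0")
      case True
      obtain l where l: "L = Suc l" "odd l" using L(1,2) by (cases L) auto
      then show ?thesis using True L(3) z_back[of l] by (simp add: walk_odd_def s_def)
    next
      case False
      then obtain l where l: "k = Suc l" "odd l" using \<open>\<not> odd k\<close> by (cases k) auto
      then show ?thesis using z_back[of l] by (simp add: walk_odd_def s_def)
    qed
  qed
  have "C = z ` {..<L}"
  proof
    show "C \<subseteq> z ` {..<L}"
    proof
      fix y assume "y \<in> C"
      then have "(x, y) \<in> (join_rel P Q)\<^sup>+" by (simp add: Cx)
      then show "y \<in> z ` {..<L}"
      proof (induction rule: trancl_induct)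
        case (base y)
        then have "y \<in> {z 0, partner P (z 0), partner Q (z 0)}" using join_rel_partner[OF P Q] z0 by auto
        then show ?case using stepP[of 0] stepQ[of 0] odd_lt[of 0] even_lt[of 0] L(1) by auto
      next
        case (step y w)
        then obtain k where k: "k < L" "y = z k" by auto
        then have "w \<in> {z k, partner P (z k), partner Q (z k)}" using join_rel_partner[OF P Q] step by auto
        then show ?case using stepP[OF k(1)] stepQ[OF k(1)] odd_lt[OF k(1)] even_lt[OF k(1)] k by auto
      qed
    qed
    have xx: "(x, x) \<in> join_rel P Q" using join_rel_partner[OF P Q] x by simp
    have "(x, z k) \<in> (join_rel P Q)\<^sup>+" for k
    proof (induction k)
      case (Suc k)
      have "(z k, z (Suc k)) \<in> join_rel P Q"
        using join_rel_partner[OF P Q] z_in[of k] by (simp add: zS s_def)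
      with Suc show ?case by (rule trancl.trancl_into_trancl)
    qed (use xx z0 in auto)
    then show "z ` {..<L} \<subseteq> C" by (auto simp: Cx)
  qed
  moreover from this have "card C = L" using card_image[OF inj] by simp
  ultimately show ?thesis
    using inj stepP stepQ odd_lt even_lt by (intro exI[of _ z]) (auto simp: bij_betw_def)
qed

text \<open>The positions of the partners along a walk depend only on the size of the block.
  Matching the walks of corresponding blocks position by position therefore carries both pair
  partitions along.\<close>

lemma join_isomorphism:
  assumes fin: "finite S" "finite S'"
    and P: "P \<in> pair_partitions S" and Q: "Q \<in> pair_partitions S"
    and P': "P' \<in> pair_partitions S'" and Q': "Q' \<in> pair_partitions S'"
    and f: "bij_betw f (part_join S P Q) (part_join S' P' Q')"
    and card: "\<And>C. C \<in> part_join S P Q \<Longrightarrow> card (f C) = card C"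
  obtains g where "bij_betw g S S'" "(`) g ` P = P'" "(`) g ` Q = Q'"
proof -
  let ?J = "part_join S P Q" and ?J' = "part_join S' P' Q'"
  have part: "partition_on S P" "partition_on S Q" "partition_on S' P'" "partition_on S' Q'"
    using P Q P' Q' by (auto simp: pair_partitions_def)
  have J: "partition_on S ?J" and J': "partition_on S' ?J'" using part partition_on_part_join by auto
  have fJ: "f C \<in> ?J'" if "C \<in> ?J" for C using that f by (auto simp: bij_betw_def)
  obtain z where z: "\<And>C. C \<in> ?J \<Longrightarrow> bij_betw (z C) {..<card C} C"
    and zP: "\<And>C k. C \<in> ?J \<Longrightarrow> k < card C \<Longrightarrow> walk_odd (card C) k < card C \<and> walk_even k < card C \<and>
      partner P (z C k) = z C (walk_odd (card C) k) \<and> partner Q (z C k) = z C (walk_even k)"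
    using alternating_walk[OF fin(1) P Q] by metis
  obtain z' where z': "\<And>C. C \<in> ?J' \<Longrightarrow> bij_betw (z' C) {..<card C} C"
    and zP': "\<And>C k. C \<in> ?J' \<Longrightarrow> k < card C \<Longrightarrow> walk_odd (card C) k < card C \<and> walk_even k < card C \<and>
      partner P' (z' C k) = z' C (walk_odd (card C) k) \<and> partner Q' (z' C k) = z' C (walk_even k)"
    using alternating_walk[OF fin(2) P' Q'] by metis
  define g where "g x = (let C = block_of ?J x in z' (f C) (inv_into {..<card C} (z C) x))" for x
  have gz: "g (z C k) = z' (f C) k" if C: "C \<in> ?J" and k: "k < card C" for C k
  proof -
    have "z C k \<in> C" using z[OF C] k by (auto simp: bij_betw_def)
    then have "block_of ?J (z C k) = C" using block_of_eq[OF J C] by simp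
    then show ?thesis using z[OF C] k by (simp add: g_def bij_betw_def)
  qed
  have bij_C: "bij_betw g C (f C)" if C: "C \<in> ?J" for C
  proof -
    have "bij_betw (z' (f C) \<circ> inv_into {..<card C} (z C)) C (f C)"
      using bij_betw_inv_into[OF z[OF C]] z'[OF fJ[OF C]] card[OF C] by (auto intro: bij_betw_trans)
    moreover have "g x = (z' (f C) \<circ> inv_into {..<card C} (z C)) x" if "x \<in> C" for x
      using block_of_eq[OF J C that] by (simp add: g_def)
    ultimately show ?thesis using bij_betw_cong[of C g] by metis
  qed
  have "bij_betw g (\<Union>C\<in>?J. C) (\<Union>C\<in>?J. f C)"
  proof (rule bij_betw_UNION_disjoint)
    show "disjoint_family_on f ?J"
      unfolding disjoint_family_on_def
    proof (intro ballI impI)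
      fix C D assume CD: "C \<in> ?J" "D \<in> ?J" "C \<noteq> D"
      then have "f C \<noteq> f D" using f by (auto simp: bij_betw_def inj_on_eq_iff)
      then show "f C \<inter> f D = {}" using disjointD[OF partition_onD2[OF J']] fJ CD by blast
    qed
  qed (use bij_C in auto)
  moreover have "(\<Union>C\<in>?J. f C) = \<Union>?J'" using f by (auto simp: bij_betw_def)
  ultimately have bij: "bij_betw g S S'" using partition_onD1[OF J] partition_onD1[OF J'] by simp
  have comm: "g (partner P x) = partner P' (g x) \<and> g (partner Q x) = partner Q' (g x)" if x: "x \<in> S" for x
  proof -
    define C where "C = block_of ?J x"
    have C: "C \<in> ?J" "x \<in> C" using block_of_in[OF J x] by (auto simp: C_def)
    then obtain k where k: "k < card C" "x = z C k" using z[OF C(1)] by (auto simp: bij_betw_def)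
    have k': "k < card (f C)" using k card[OF C(1)] by simp
    show ?thesis
      using zP[OF C(1) k(1)] zP'[OF fJ[OF C(1)] k'] gz[OF C(1)] k card[OF C(1)] by simp
  qed
  have img: "(`) g ` R = R'" if R: "R \<in> pair_partitions S" and R': "R' \<in> pair_partitions S'"
    and c: "\<And>x. x \<in> S \<Longrightarrow> g (partner R x) = partner R' (g x)" for R R'
  proof -
    have "(`) g ` R = (\<lambda>x. {g x, partner R' (g x)}) ` S"
      unfolding pair_partition_eq_partner[OF R, THEN arg_cong[where f = "\<lambda>X. (`) g ` X"]] image_image
      by (rule image_cong) (auto simp: c)
    also have "\<dots> = (\<lambda>y. {y, partner R' y}) ` g ` S" by (simp add: image_image)
    also have "\<dots> = R'" using pair_partition_eq_partner[OF R'] bij by (simp add: bij_betw_def)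
    finally show ?thesis .
  qed
  show thesis
    by (rule that[OF bij]) (use img[OF P P'] img[OF Q Q'] comm in auto)
qed

section \<open>The Weingarten matrix\<close>

lemma pairings_eq: "pairings n = pair_partitions {1..2 * n}"
  by (simp add: pairings_def pair_partitions_def)

text \<open>Justifies the definite description in \<open>inverse_matrix_on\<close>: the Gram matrix
  of the e_P is invertible, because n \<le> CARD('N) provides dual indices.\<close>

lemma weingarten_matrix_is_inverse:
  assumes small: "n \<le> CARD('N::finite)"
  shows "is_inverse_on (pairings n) (\<lambda>P Q. real CARD('N) ^ card (part_join {1..2 * n} P Q))
    (weingarten_matrix CARD('N) n)"
proof -
  let ?S = "{1..2 * n}" and ?G = "\<lambda>P Q. real CARD('N) ^ card (part_join {1..2 * n} P Q)"
  let ?e = "\<lambda>P (j :: nat \<Rightarrow> 'N). of_bool (block_const P j) :: real"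
  have fin: "finite (pairings n)" unfolding pairings_eq by (intro finite_pair_partitions) simp
  have "\<exists>W. is_inverse_on (pairings n) ?G W"
  proof (rule is_inverse_on_gram[where e = ?e and J = "indices ?S"])
    fix P Q assume PQ: "P \<in> pairings n" "Q \<in> pairings n"
    then have part: "partition_on ?S P" "partition_on ?S Q" by (auto simp: pairings_def)
    have c: "card {j \<in> indices ?S :: (nat \<Rightarrow> 'N) set. block_const P j \<and> block_const Q j}
        = CARD('N) ^ card (part_join ?S P Q)"
      by (rule card_block_const[OF _ part]) simp
    have "?G P Q = real (card {j \<in> indices ?S :: (nat \<Rightarrow> 'N) set. block_const P j \<and> block_const Q j})"
      unfolding c by (rule of_nat_power[symmetric])
    also have "\<dots> = (\<Sum>j\<in>{j \<in> indices ?S :: (nat \<Rightarrow> 'N) set. block_const P j \<and> block_const Q j}. 1)" by simp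
    also have "\<dots> = (\<Sum>j\<in>indices ?S. ?e P j * ?e Q j)"
      by (rule sum.mono_neutral_cong_left) (auto simp: finite_PiE)
    finally show "?G P Q = (\<Sum>j\<in>indices ?S. ?e P j * ?e Q j)" .
  next
    fix P assume P: "P \<in> pairings n"
    obtain g :: "nat \<Rightarrow> 'N" where "\<And>k l. k \<in> ?S \<Longrightarrow> l \<in> ?S \<Longrightarrow> g k = g l \<longleftrightarrow> block_of P k = block_of P l"
      and g: "\<And>Q. Q \<in> pairings n \<Longrightarrow> block_const Q g \<longleftrightarrow> Q = P"
      unfolding pairings_eq
      by (rule ex_dual_index[of ?S P, where 'N = 'N]) (use P small in \<open>auto simp: pairings_eq\<close>)
    have "block_const Q (restrict g ?S) \<longleftrightarrow> Q = P" if "Q \<in> pairings n" for Q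
      using block_const_restrict[of ?S Q g] g that by (simp add: pairings_def)
    then show "\<exists>j\<in>indices ?S. \<forall>Q\<in>pairings n. ?e Q j = (if Q = P then 1 else 0)"
      by (intro bexI[of _ "restrict g ?S"]) auto
  qed (use fin in \<open>auto simp: finite_PiE\<close>)
  then show ?thesis unfolding weingarten_matrix_def using inverse_matrix_on_eqI[OF fin] by metis
qed

text \<open>Two choices whose joins have the same block sizes differ by a permutation of the ground
  set, which leaves the Gram matrix and hence its inverse invariant. So the choice made in
  \<open>Weingarten\<close> does not matter.\<close>

lemma weingarten_matrix_depends_on_join_type:
  assumes small: "n \<le> CARD('N::finite)"
    and PQ: "P \<in> pairings n" "Q \<in> pairings n" "P' \<in> pairings n" "Q' \<in> pairings n"
    and type: "join_type n U P Q" "join_type n U P' Q'"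
  shows "weingarten_matrix CARD('N) n P Q = weingarten_matrix CARD('N) n P' Q'"
proof -
  let ?S = "{1..2 * n}"
  obtain f where f: "bij_betw f (part_join ?S P Q) U" "\<And>B. B \<in> part_join ?S P Q \<Longrightarrow> card B = 2 * card (f B)"
    using type(1) by (auto simp: join_type_def)
  obtain f' where f': "bij_betw f' (part_join ?S P' Q') U" "\<And>B. B \<in> part_join ?S P' Q' \<Longrightarrow> card B = 2 * card (f' B)"
    using type(2) by (auto simp: join_type_def)
  let ?f = "inv_into (part_join ?S P' Q') f' \<circ> f"
  have bij: "bij_betw ?f (part_join ?S P Q) (part_join ?S P' Q')"
    by (rule bij_betw_trans[OF f(1) bij_betw_inv_into[OF f'(1)]])
  have "card (?f C) = card C" if C: "C \<in> part_join ?S P Q" for C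
  proof -
    have "?f C \<in> part_join ?S P' Q'" using bij C by (auto simp: bij_betw_def)
    then have "card (?f C) = 2 * card (f' (?f C))" by (rule f'(2))
    also have "f' (?f C) = f C"
      using f(1) f'(1) C by (auto simp: bij_betw_def intro!: f_inv_into_f)
    finally show ?thesis using f(2)[OF C] by simp
  qed
  then obtain g where g: "bij_betw g ?S ?S" "(`) g ` P = P'" "(`) g ` Q = Q'"
    using join_isomorphism[OF _ _ _ _ _ _ bij] PQ unfolding pairings_eq by (metis finite_atLeastAtMost)
  have fin: "finite (pairings n)" unfolding pairings_eq by (intro finite_pair_partitions) simp
  have inj: "inj_on g ?S" and im: "g ` ?S = ?S" using g(1) by (auto simp: bij_betw_def)
  have "weingarten_matrix CARD('N) n ((`) ((`) g) P) ((`) ((`) g) Q) = weingarten_matrix CARD('N) n P Q"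
    unfolding weingarten_matrix_def
  proof (rule inverse_matrix_on_symmetry[OF fin])
    show "bij_betw ((`) ((`) g)) (pairings n) (pairings n)"
      unfolding pairings_eq by (rule image_pair_partitions[OF g(1)])
    fix A B assume "A \<in> pairings n" "B \<in> pairings n"
    then have "partition_on ?S A" "partition_on ?S B" by (auto simp: pairings_def)
    then have J: "part_join ?S ((`) g ` A) ((`) g ` B) = (`) g ` part_join ?S A B"
      and part: "partition_on ?S (part_join ?S A B)"
      using part_join_image[OF inj] partition_on_part_join unfolding im by auto
    have "part_join ?S A B \<subseteq> Pow ?S" using partition_onD1[OF part] by auto
    then have "inj_on ((`) g) (part_join ?S A B)" using inj_on_image_Pow[OF inj] inj_on_subset by blast
    then show "real CARD('N) ^ card (part_join ?S ((`) g ` A) ((`) g ` B)) = real CARD('N) ^ card (part_join ?S A B)"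
      unfolding J by (simp add: card_image)
  qed (use weingarten_matrix_is_inverse[OF small] PQ in \<open>auto simp: weingarten_matrix_def\<close>)
  then show ?thesis using g by simp
qed

lemma Weingarten_eq:
  assumes small: "n \<le> CARD('N::finite)" and n: "card (\<Union>U) = n"
    and PQ: "P \<in> pairings n" "Q \<in> pairings n" "join_type n U P Q"
  shows "Weingarten CARD('N) U = weingarten_matrix CARD('N) n P Q"
proof -
  define R where "R = (SOME (P, Q). P \<in> pairings n \<and> Q \<in> pairings n \<and> join_type n U P Q)"
  have "case R of (P, Q) \<Rightarrow> P \<in> pairings n \<and> Q \<in> pairings n \<and> join_type n U P Q"
    unfolding R_def by (rule someI[of _ "(P, Q)"]) (use PQ in simp)
  then obtain P' Q' where R: "R = (P', Q')" "P' \<in> pairings n" "Q' \<in> pairings n" "join_type n U P' Q'"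
    by (cases R) auto
  have "Weingarten CARD('N) U = weingarten_matrix CARD('N) n P' Q'"
    unfolding Weingarten_def Let_def n R_def[symmetric] R(1) by simp
  also have "\<dots> = weingarten_matrix CARD('N) n P Q"
    by (rule weingarten_matrix_depends_on_join_type[OF small]) (use R PQ in auto)
  finally show ?thesis .
qed

text \<open>Pairings live on \<open>{1..2 * n}\<close>, whereas the index positions of mixed moments
  are signed integers; any numbering h transports the inversion relation.\<close>

lemma weingarten_matrix_inverse_transport:
  assumes small: "n \<le> CARD('N::finite)" and h: "bij_betw h S {1..2 * n}"
    and P: "P \<in> pair_partitions S" and R: "R \<in> pair_partitions S"
  shows "(\<Sum>Q\<in>pair_partitions S. weingarten_matrix CARD('N) n ((`) h ` P) ((`) h ` Q)
    * real CARD('N) ^ card (part_join S Q R)) = of_bool (P = R)"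
proof -
  let ?h = "(`) ((`) h)" and ?S = "{1..2 * n}" and ?W = "weingarten_matrix CARD('N) n"
  have bij: "bij_betw ?h (pair_partitions S) (pairings n)"
    unfolding pairings_eq by (rule image_pair_partitions[OF h])
  have inj: "inj_on h S" and im: "h ` S = ?S" using h by (auto simp: bij_betw_def)
  have card: "card (part_join ?S (?h Q) (?h R)) = card (part_join S Q R)" if Q: "Q \<in> pair_partitions S" for Q
  proof -
    have "partition_on S Q" "partition_on S R" using Q R by (auto simp: pair_partitions_def)
    then have J: "part_join ?S (?h Q) (?h R) = (`) h ` part_join S Q R"
      and part: "partition_on S (part_join S Q R)"
      using part_join_image[OF inj] partition_on_part_join unfolding im by auto
    have "part_join S Q R \<subseteq> Pow S" using partition_onD1[OF part] by auto
    then have "inj_on ((`) h) (part_join S Q R)" using inj_on_image_Pow[OF inj] inj_on_subset by blast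
    then show ?thesis unfolding J by (simp add: card_image)
  qed
  have "(\<Sum>Q\<in>pair_partitions S. ?W (?h P) (?h Q) * real CARD('N) ^ card (part_join S Q R))
      = (\<Sum>Q\<in>pair_partitions S. ?W (?h P) (?h Q) * real CARD('N) ^ card (part_join ?S (?h Q) (?h R)))"
    by (rule sum.cong[OF refl]) (simp only: card)
  also have "\<dots> = (\<Sum>Q\<in>pairings n. ?W (?h P) Q * real CARD('N) ^ card (part_join ?S Q (?h R)))"
    by (rule sum.reindex_bij_betw[OF bij])
  also have "\<dots> = (if ?h P = ?h R then 1 else 0)"
  proof -
    have "?h P \<in> pairings n" "?h R \<in> pairings n" using P R bij unfolding bij_betw_def by auto
    then show ?thesis using weingarten_matrix_is_inverse[OF small] unfolding is_inverse_on_def by blast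
  qed
  also have "?h P = ?h R \<longleftrightarrow> P = R" using bij P R by (auto simp: bij_betw_def inj_on_eq_iff)
  finally show ?thesis by simp
qed

section \<open>Mixed moments of matrix entries\<close>

text \<open>Unlike integrability alone, having all moments is stable under products.\<close>

definition all_moments :: "'w measure \<Rightarrow> ('w \<Rightarrow> complex) \<Rightarrow> bool" where
  "all_moments M f \<longleftrightarrow> f \<in> borel_measurable M \<and> (\<forall>p. integrable M (\<lambda>\<omega>. norm (f \<omega>) ^ p))"

text \<open>By xy \<le> x^2 + y^2, the p-th moment of a product is bounded by the moments of order
  2p of the factors.\<close>

lemma all_moments_mult:
  assumes f: "all_moments M f" and g: "all_moments M g"
  shows "all_moments M (\<lambda>\<omega>. f \<omega> * g \<omega>)"
  unfolding all_moments_def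
proof (intro conjI allI)
  have [measurable]: "f \<in> borel_measurable M" "g \<in> borel_measurable M"
    using f g by (auto simp: all_moments_def)
  show "(\<lambda>\<omega>. f \<omega> * g \<omega>) \<in> borel_measurable M" by measurable
  fix p
  have "integrable M (\<lambda>\<omega>. norm (f \<omega>) ^ (2 * p) + norm (g \<omega>) ^ (2 * p))"
    using f g by (auto simp: all_moments_def)
  then show "integrable M (\<lambda>\<omega>. norm (f \<omega> * g \<omega>) ^ p)"
  proof (rule Bochner_Integration.integrable_bound)
    show "AE \<omega> in M. norm (norm (f \<omega> * g \<omega>) ^ p) \<le> norm (norm (f \<omega>) ^ (2 * p) + norm (g \<omega>) ^ (2 * p))"
    proof (rule AE_I2)
      fix \<omega>
      have "x * y \<le> x\<^sup>2 + y\<^sup>2" if "0 \<le> x" "0 \<le> y" for x y :: real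
        using sum_squares_bound[of x y] mult_nonneg_nonneg[OF that] by linarith
      from this[of "norm (f \<omega>) ^ p" "norm (g \<omega>) ^ p"]
      show "norm (norm (f \<omega> * g \<omega>) ^ p) \<le> norm (norm (f \<omega>) ^ (2 * p) + norm (g \<omega>) ^ (2 * p))"
        by (simp add: norm_mult power_mult_distrib power_mult[symmetric] mult.commute)
    qed
  qed measurable
qed

lemma all_moments_const: "prob_space M \<Longrightarrow> all_moments M (\<lambda>_. c)"
  by (simp add: all_moments_def finite_measure.integrable_const prob_space.finite_measure)

lemma all_moments_prod:
  assumes "prob_space M" and "\<And>k. k \<in> K \<Longrightarrow> all_moments M (f k)"
  shows "all_moments M (\<lambda>\<omega>. \<Prod>k\<in>K. f k \<omega>)"
  using assms(2)
proof (induction K rule: infinite_finite_induct)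
  case (insert k K)
  then show ?case by (simp add: all_moments_mult)
qed (use all_moments_const[OF assms(1)] in auto)

lemma all_moments_integrable:
  assumes "all_moments M f" shows "integrable M f"
proof -
  have "integrable M (\<lambda>\<omega>. norm (f \<omega>) ^ 1)" "f \<in> borel_measurable M"
    using assms unfolding all_moments_def by blast+
  then show ?thesis by (simp add: integrable_norm_iff)
qed

lemma entry_measurable [measurable]:
  "(\<lambda>B :: complex^'N^'N. B $ i $ j) \<in> borel_measurable borel"
  by (intro borel_measurable_continuous_onI continuous_intros)

lemma random_matrix_entry: "random_matrix M A \<Longrightarrow> all_moments M (\<lambda>\<omega>. A \<omega> $ i $ j)"
  unfolding random_matrix_def all_moments_def
  using measurable_compose[OF _ entry_measurable] by blast

definition mixed_moment ::
    "'w measure \<Rightarrow> (int \<Rightarrow> 'w \<Rightarrow> complex^'N^'N) \<Rightarrow> int set \<Rightarrow> (int \<Rightarrow> 'N) \<Rightarrow> complex" where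
  "mixed_moment M X W i = (\<integral>\<omega>. (\<Prod>k\<in>W. X k \<omega> $ i k $ i (- k)) \<partial>M)"

lemma integrable_entries:
  assumes "prob_space M" and "\<And>k. k \<in> W \<Longrightarrow> random_matrix M (X k)"
  shows "integrable M (\<lambda>\<omega>. \<Prod>k\<in>W. X k \<omega> $ i k $ i (- k))"
  by (intro all_moments_integrable all_moments_prod random_matrix_entry assms)

text \<open>The products over \<open>W \<inter> I\<close> and \<open>W - I\<close> are measurable
  functions of the two independent families.\<close>

lemma mixed_moment_indep:
  fixes X :: "int \<Rightarrow> 'w \<Rightarrow> complex^'N^'N"
  assumes M: "prob_space M" and rm: "\<And>k. k \<in> T \<Longrightarrow> random_matrix M (X k)" and fin: "finite T"
    and indep: "prob_space.indep_var M
       (PiM I (\<lambda>_. borel)) (\<lambda>\<omega>. \<lambda>k\<in>I. X k \<omega>)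
       (PiM (T - I) (\<lambda>_. borel)) (\<lambda>\<omega>. \<lambda>k\<in>T - I. X k \<omega>)"
    and W: "W \<subseteq> T"
  shows "mixed_moment M X W i = mixed_moment M X (W \<inter> I) i * mixed_moment M X (W - I) i"
proof -
  interpret prob_space M by fact
  let ?f = "\<lambda>W (x :: int \<Rightarrow> complex^'N^'N). \<Prod>k\<in>W. x k $ i k $ i (- k)"
  have meas: "?f W \<in> borel_measurable (PiM J (\<lambda>_. borel))" if "W \<subseteq> J" for W J
  proof (intro borel_measurable_prod)
    fix k assume "k \<in> W"
    then have [measurable]: "(\<lambda>x. x k) \<in> measurable (PiM J (\<lambda>_. borel)) (borel :: (complex^'N^'N) measure)"
      using that by (intro measurable_component_singleton) auto
    show "(\<lambda>x. x k $ i k $ i (- k)) \<in> borel_measurable (PiM J (\<lambda>_. borel :: (complex^'N^'N) measure))"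
      by measurable
  qed
  have finW: "finite W" using W fin finite_subset by blast
  have "indep_var borel (?f (W \<inter> I) \<circ> (\<lambda>\<omega>. \<lambda>k\<in>I. X k \<omega>)) borel (?f (W - I) \<circ> (\<lambda>\<omega>. \<lambda>k\<in>T - I. X k \<omega>))"
    by (rule indep_var_compose[OF indep]) (use W in \<open>auto intro!: meas\<close>)
  moreover have "?f (W \<inter> I) \<circ> (\<lambda>\<omega>. \<lambda>k\<in>I. X k \<omega>) = (\<lambda>\<omega>. \<Prod>k\<in>W \<inter> I. X k \<omega> $ i k $ i (- k))"
    by (auto intro!: prod.cong)
  moreover have "?f (W - I) \<circ> (\<lambda>\<omega>. \<lambda>k\<in>T - I. X k \<omega>) = (\<lambda>\<omega>. \<Prod>k\<in>W - I. X k \<omega> $ i k $ i (- k))"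
    by (rule ext) (use W in \<open>auto intro!: prod.cong\<close>)
  ultimately have ind: "indep_var borel (\<lambda>\<omega>. \<Prod>k\<in>W \<inter> I. X k \<omega> $ i k $ i (- k))
      borel (\<lambda>\<omega>. \<Prod>k\<in>W - I. X k \<omega> $ i k $ i (- k))" by simp
  have "mixed_moment M X W i = (\<integral>\<omega>. (\<Prod>k\<in>W \<inter> I. X k \<omega> $ i k $ i (- k)) * (\<Prod>k\<in>W - I. X k \<omega> $ i k $ i (- k)) \<partial>M)"
    unfolding mixed_moment_def by (simp only: prod.Int_Diff[OF finW, of _ I, symmetric])
  also have "\<dots> = mixed_moment M X (W \<inter> I) i * mixed_moment M X (W - I) i"
    unfolding mixed_moment_def
    by (rule indep_var_lebesgue_integral[OF ind]) (use W rm in \<open>auto intro!: integrable_entries[OF M]\<close>)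
  finally show ?thesis .
qed

section \<open>Orthogonal invariance of mixed moments\<close>

lemma orth_conj_mult: "orth_conj R (orth_conj Q A) = orth_conj (R ** Q) A"
proof -
  let ?c = "\<lambda>Q :: real^'N^'N. (\<chi> i j. complex_of_real (Q $ i $ j))"
  have "?c (R ** Q) = ?c R ** ?c Q"
    by (simp add: vec_eq_iff matrix_matrix_mult_def)
  then show ?thesis
    by (simp add: orth_conj_def Let_def matrix_transpose_mul matrix_mul_assoc)
qed

lemma orth_conj_entry:
  "orth_conj R A $ x $ y = (\<Sum>(a, b)\<in>UNIV. of_real (R $ x $ a) * of_real (R $ y $ b) * A $ a $ b)"
proof -
  have "orth_conj R A $ x $ y = (\<Sum>b\<in>UNIV. \<Sum>a\<in>UNIV. of_real (R $ x $ a) * of_real (R $ y $ b) * A $ a $ b)"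
    by (simp add: orth_conj_def Let_def matrix_matrix_mult_def transpose_def sum_distrib_right sum_distrib_left mult_ac)
  also have "\<dots> = (\<Sum>a\<in>UNIV. \<Sum>b\<in>UNIV. of_real (R $ x $ a) * of_real (R $ y $ b) * A $ a $ b)"
    by (rule sum.swap)
  finally show ?thesis by (simp add: sum.cartesian_product)
qed

lemma borel_measurable_matrixI:
  fixes f :: "'w \<Rightarrow> complex^'N^'M"
  assumes "\<And>i j. (\<lambda>\<omega>. f \<omega> $ i $ j) \<in> borel_measurable M"
  shows "f \<in> borel_measurable M"
  by (rule borel_measurable_euclidean_space[THEN iffD2])
    (use assms in \<open>auto simp: Basis_vec_def inner_axis Basis_complex_def\<close>)

lemma real_entry_measurable [measurable]:
  "(\<lambda>B :: real^'N^'N. B $ i $ j) \<in> borel_measurable borel"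
  by (intro borel_measurable_continuous_onI continuous_intros)

lemma orth_conj_measurable:
  assumes [measurable]: "f \<in> borel_measurable M" "g \<in> borel_measurable M"
  shows "(\<lambda>x. orth_conj (f x) (g x)) \<in> borel_measurable M"
proof (rule borel_measurable_matrixI)
  fix i j
  show "(\<lambda>x. orth_conj (f x) (g x) $ i $ j) \<in> borel_measurable M"
    unfolding orth_conj_entry split_def by measurable
qed

lemma matrix_mult_measurable:
  "(\<lambda>Q :: real^'N^'N. R ** Q) \<in> borel_measurable borel"
  unfolding matrix_matrix_mult_def
  by (intro borel_measurable_continuous_onI continuous_on_vec_lambda continuous_intros)

text \<open>Conjugating by a fixed R replaces (Q_1, Q_2) by (R Q_1, R Q_2), and by left invariance
  of Haar measure this does not change their joint law with X. So the joint law of the X_k is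
  invariant under simultaneous conjugation.\<close>

lemma general_position_integral:
  fixes X :: "int \<Rightarrow> 'w \<Rightarrow> complex^'N^'N" and R :: "real^'N^'N"
  assumes M: "prob_space M" and rm: "\<And>k. k \<in> T \<Longrightarrow> random_matrix M (X k)"
    and gp: "indep_orth_general_position M X T I" and R: "orthogonal_matrix R"
    and f: "f \<in> borel_measurable (PiM T (\<lambda>_. borel :: (complex^'N^'N) measure))"
  shows "(\<integral>\<omega>. f (\<lambda>k\<in>T. orth_conj R (X k \<omega>)) \<partial>M) = (\<integral>\<omega>. (f (\<lambda>k\<in>T. X k \<omega>) :: complex) \<partial>M)"
proof -
  let ?P = "PiM T (\<lambda>_. borel :: (complex^'N^'N) measure)"
  obtain \<mu> where haar: "haar_orthogonal \<mu>" and dist: "distr M ?P (\<lambda>\<omega>. \<lambda>k\<in>T. X k \<omega>) =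
      distr (\<mu> \<Otimes>\<^sub>M (\<mu> \<Otimes>\<^sub>M M)) ?P
         (\<lambda>(Q\<^sub>1, Q\<^sub>2, \<omega>). \<lambda>k\<in>T. orth_conj (if k \<in> I then Q\<^sub>1 else Q\<^sub>2) (X k \<omega>))"
    using gp by (auto simp: indep_orth_general_position_def)
  let ?O = "\<mu> \<Otimes>\<^sub>M (\<mu> \<Otimes>\<^sub>M M)"
  define Z where "Z = (\<lambda>(Q\<^sub>1, Q\<^sub>2, \<omega>). \<lambda>k\<in>T. orth_conj (if k \<in> I then Q\<^sub>1 else Q\<^sub>2) (X k \<omega>))"
  let ?X = "\<lambda>\<omega>. \<lambda>k\<in>T. X k \<omega>"
  define F where "F = (\<lambda>x. \<lambda>k\<in>T. orth_conj R (x k))"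
  define \<tau> where "\<tau> = (\<lambda>(Q\<^sub>1 :: real^'N^'N, Q\<^sub>2 :: real^'N^'N, \<omega> :: 'w). (R ** Q\<^sub>1, R ** Q\<^sub>2, \<omega>))"
  note dist = dist[folded Z_def]
  interpret M: prob_space M by fact
  interpret mu: prob_space \<mu> using haar by (simp add: haar_orthogonal_def)
  interpret muM: pair_prob_space \<mu> M ..
  have sets [measurable_cong]: "sets \<mu> = sets borel" using haar by (simp add: haar_orthogonal_def)
  have Xm [measurable]: "X k \<in> borel_measurable M" if "k \<in> T" for k
    using rm[OF that] by (simp add: random_matrix_def)
  have X_meas: "?X \<in> measurable M ?P" by (intro measurable_restrict Xm)
  have F_meas: "F \<in> measurable ?P ?P"
    unfolding F_def by (intro measurable_restrict orth_conj_measurable measurable_component_singleton) auto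
  have Z_meas: "Z \<in> measurable ?O ?P"
    unfolding Z_def split_def
  proof (intro measurable_restrict orth_conj_measurable)
    fix k assume k: "k \<in> T"
    note [measurable] = Xm[OF k]
    show "(\<lambda>p. if k \<in> I then fst p else fst (snd p)) \<in> borel_measurable ?O" by measurable
    show "(\<lambda>p. X k (snd (snd p))) \<in> borel_measurable ?O" by measurable
  qed
  have r_meas: "(\<lambda>Q. R ** Q) \<in> measurable \<mu> \<mu>"
    using matrix_mult_measurable[of R] by (simp cong: measurable_cong_sets add: sets)
  have r_inv: "distr \<mu> \<mu> (\<lambda>Q. R ** Q) = \<mu>"
  proof -
    have "distr \<mu> \<mu> (\<lambda>Q. R ** Q) = distr \<mu> borel (\<lambda>Q. R ** Q)" by (rule distr_cong) (auto simp: sets)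
    then show ?thesis using haar R by (simp add: haar_orthogonal_def)
  qed
  have id_inv: "distr M M (\<lambda>\<omega>. \<omega>) = M" by (rule distr_id2) simp
  let ?\<tau>2 = "\<lambda>(Q, \<omega>). (R ** Q, \<omega>)"
  have \<tau>2_meas: "?\<tau>2 \<in> measurable (\<mu> \<Otimes>\<^sub>M M) (\<mu> \<Otimes>\<^sub>M M)"
    unfolding split_def by (intro measurable_Pair measurable_compose[OF measurable_fst r_meas] measurable_snd)
  \<comment> \<open>The invariance of the triple product is obtained one factor at a time, starting
    with the inner product measure.\<close>
  have \<tau>2_inv: "distr (\<mu> \<Otimes>\<^sub>M M) (\<mu> \<Otimes>\<^sub>M M) ?\<tau>2 = \<mu> \<Otimes>\<^sub>M M"
    using pair_measure_distr[OF r_meas, of "\<lambda>\<omega>. \<omega>" M M] unfolding r_inv id_inv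
    by (simp add: M.sigma_finite_measure_axioms)
  have \<tau>_eq: "\<tau> = (\<lambda>(Q, p). (R ** Q, ?\<tau>2 p))" by (simp add: \<tau>_def split_def fun_eq_iff)
  have \<tau>_inv: "distr ?O ?O \<tau> = ?O"
    using pair_measure_distr[OF r_meas \<tau>2_meas] unfolding r_inv \<tau>2_inv \<tau>_eq
    by (simp add: muM.P.sigma_finite_measure_axioms)
  have \<tau>_meas: "\<tau> \<in> measurable ?O ?O"
    unfolding \<tau>_eq case_prod_beta'[of "\<lambda>Q p. (R ** Q, ?\<tau>2 p)"]
    by (intro measurable_Pair measurable_compose[OF measurable_fst r_meas] measurable_compose[OF measurable_snd \<tau>2_meas])
  have "distr M ?P (F \<circ> ?X) = distr (distr M ?P ?X) ?P F"
    by (rule distr_distr[OF F_meas X_meas, symmetric])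
  also have "\<dots> = distr ?O ?P (F \<circ> Z)"
    unfolding dist by (rule distr_distr[OF F_meas Z_meas])
  \<comment> \<open>Conjugation by R after conjugation by Q is conjugation by R Q, for both
    families.\<close>
  also have "\<dots> = distr ?O ?P (Z \<circ> \<tau>)"
  proof (rule arg_cong[of _ _ "distr ?O ?P"], rule ext)
    fix p show "(F \<circ> Z) p = (Z \<circ> \<tau>) p"
    proof (cases p, rule ext)
      fix Q\<^sub>1 Q\<^sub>2 \<omega> k assume "p = (Q\<^sub>1, Q\<^sub>2, \<omega>)"
      then show "(F \<circ> Z) p k = (Z \<circ> \<tau>) p k"
        by (cases "k \<in> T"; cases "k \<in> I") (simp_all add: F_def Z_def \<tau>_def orth_conj_mult)
    qed
  qed
  also have "\<dots> = distr (distr ?O ?O \<tau>) ?P Z"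
    by (rule distr_distr[OF Z_meas \<tau>_meas, symmetric])
  also have "\<dots> = distr M ?P ?X" unfolding \<tau>_inv dist by (rule refl)
  finally have eq: "distr M ?P (F \<circ> ?X) = distr M ?P ?X" .
  have "(\<integral>\<omega>. f ((F \<circ> ?X) \<omega>) \<partial>M) = (\<integral>x. f x \<partial>distr M ?P (F \<circ> ?X))"
    by (rule integral_distr[symmetric, OF measurable_comp[OF X_meas F_meas] f])
  also have "\<dots> = (\<integral>\<omega>. f (?X \<omega>) \<partial>M)"
    unfolding eq by (rule integral_distr[OF X_meas f])
  finally have "(\<integral>\<omega>. f ((F \<circ> ?X) \<omega>) \<partial>M) = (\<integral>\<omega>. f (?X \<omega>) \<partial>M)" .
  moreover have "(F \<circ> ?X) \<omega> = (\<lambda>k\<in>T. orth_conj R (X k \<omega>))" for \<omega>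
    by (rule ext) (simp add: F_def restrict_def)
  ultimately show ?thesis by simp
qed

lemma positive_disjoint_neg:
  assumes pos: "\<And>k. k \<in> W \<Longrightarrow> (0::int) < k" shows "W \<inter> uminus ` W = {}"
proof -
  have "- k \<notin> W" if "k \<in> W" for k using pos[of k] pos[of "- k"] that by auto
  then show ?thesis by auto
qed

lemma prod_signed:
  assumes W: "finite W" "\<And>k. k \<in> W \<Longrightarrow> 0 < k"
  shows "prod f (signed W) = (\<Prod>k\<in>W. f k * f (- k))"
proof -
  have "W \<inter> uminus ` W = {}" using W(2) by (rule positive_disjoint_neg)
  then have "prod f (signed W) = prod f W * prod f (uminus ` W)"
    unfolding signed_def using W(1) by (simp add: prod.union_disjoint)
  also have "prod f (uminus ` W) = (\<Prod>k\<in>W. f (- k))" by (subst prod.reindex) (auto simp: inj_on_def)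
  finally show ?thesis by (simp add: prod.distrib)
qed

text \<open>The entries of R A R^T are sums of R_xa R_yb A_ab, so a product over W yields one entry
  of R for each element of \<plusminus>W: at k for the row index and at - k for the column index.
  Expanding and integrating gives exactly \<open>orth_act\<close>.\<close>

lemma orth_invariant_mixed_moment:
  fixes X :: "int \<Rightarrow> 'w \<Rightarrow> complex^'N^'N"
  assumes M: "prob_space M" and rm: "\<And>k. k \<in> T \<Longrightarrow> random_matrix M (X k)"
    and gp: "indep_orth_general_position M X T I"
    and T: "finite T" "\<And>k. k \<in> T \<Longrightarrow> 0 < k" and W: "W \<subseteq> T"
  shows "orth_invariant (signed W) (mixed_moment M X W)"
  unfolding orth_invariant_def
proof (intro conjI allI impI)
  fix i :: "int \<Rightarrow> 'N"
  have finW: "finite W" using W T finite_subset by blast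
  have posW: "0 < k" if "k \<in> W" for k using W T that by blast
  have in_signed: "k \<in> signed W" "- k \<in> signed W" if "k \<in> W" for k using that by (auto simp: signed_def)
  have prod_W: "prod f (signed W) = (\<Prod>k\<in>W. f k * f (- k))" for f :: "int \<Rightarrow> complex"
    by (rule prod_signed) (use finW posW in auto)
  show "mixed_moment M X W (restrict i (signed W)) = mixed_moment M X W i"
    unfolding mixed_moment_def using in_signed by (simp cong: prod.cong)
  fix R :: "real^'N^'N" assume R: "orthogonal_matrix R"
  let ?f = "\<lambda>x :: int \<Rightarrow> complex^'N^'N. \<Prod>k\<in>W. x k $ i k $ i (- k)"
  let ?c = "\<lambda>k a b. complex_of_real (R $ i k $ a) * of_real (R $ i (- k) $ b)"
  have meas: "?f \<in> borel_measurable (PiM T (\<lambda>_. borel))"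
  proof (intro borel_measurable_prod)
    fix k assume "k \<in> W"
    then have [measurable]: "(\<lambda>x. x k) \<in> measurable (PiM T (\<lambda>_. borel)) (borel :: (complex^'N^'N) measure)"
      using W by (intro measurable_component_singleton) auto
    show "(\<lambda>x. x k $ i k $ i (- k)) \<in> borel_measurable (PiM T (\<lambda>_. borel :: (complex^'N^'N) measure))"
      by measurable
  qed
  have "mixed_moment M X W i = (\<integral>\<omega>. ?f (\<lambda>k\<in>T. X k \<omega>) \<partial>M)"
    unfolding mixed_moment_def using W by (intro Bochner_Integration.integral_cong refl prod.cong) auto
  also have "\<dots> = (\<integral>\<omega>. ?f (\<lambda>k\<in>T. orth_conj R (X k \<omega>)) \<partial>M)"
    by (rule general_position_integral[OF M rm gp R meas, symmetric])
  also have "\<dots> = (\<integral>\<omega>. (\<Prod>k\<in>W. \<Sum>p\<in>UNIV. ?c k (fst p) (snd p) * X k \<omega> $ fst p $ snd p) \<partial>M)"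
    using W by (intro Bochner_Integration.integral_cong refl prod.cong) (auto simp: orth_conj_entry split_def)
  also have "\<dots> = (\<integral>\<omega>. (\<Sum>g\<in>indices W. \<Prod>k\<in>W. ?c k (fst (g k)) (snd (g k)) * X k \<omega> $ fst (g k) $ snd (g k)) \<partial>M)"
    using finW by (subst prod_sum_PiE) auto
  also have "\<dots> = (\<integral>\<omega>. (\<Sum>j\<in>indices (signed W). (\<Prod>k\<in>signed W. of_real (R $ i k $ j k))
      * (\<Prod>k\<in>W. X k \<omega> $ j k $ j (- k))) \<partial>M)"
  proof (rule Bochner_Integration.integral_cong[OF refl])
    fix \<omega>
    show "(\<Sum>g\<in>indices W. \<Prod>k\<in>W. ?c k (fst (g k)) (snd (g k)) * X k \<omega> $ fst (g k) $ snd (g k))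
      = (\<Sum>j\<in>indices (signed W). (\<Prod>k\<in>signed W. of_real (R $ i k $ j k))
          * (\<Prod>k\<in>W. X k \<omega> $ j k $ j (- k)))"
    \<comment> \<open>The pair g k of summation indices for the matrix X_k is recoded as j k = fst
      (g k) and j (- k) = snd (g k).\<close>
    proof (rule sum.reindex_bij_witness[of _ "\<lambda>j. \<lambda>k\<in>W. (j k, j (- k))"
          "\<lambda>g. \<lambda>k\<in>signed W. if k \<in> W then fst (g k) else snd (g (- k))"], goal_cases)
      case (1 g)
      have "- k \<notin> W" if "k \<in> W" for k using posW[of k] posW[of "- k"] that by auto
      then have "(\<lambda>k\<in>W. ((\<lambda>k\<in>signed W. if k \<in> W then fst (g k) else snd (g (- k))) k,
          (\<lambda>k\<in>signed W. if k \<in> W then fst (g k) else snd (g (- k))) (- k))) k = g k" for k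
        using in_signed[of k] PiE_arb[OF 1, of k] by (cases "k \<in> W") simp_all
      then show ?case by blast
    next
      case (3 j)
      have "k \<in> W \<or> - k \<in> W" if "k \<in> signed W" for k using that by (auto simp: signed_def)
      then have "(\<lambda>k\<in>signed W. if k \<in> W then fst ((\<lambda>k\<in>W. (j k, j (- k))) k)
          else snd ((\<lambda>k\<in>W. (j k, j (- k))) (- k))) k = j k" for k
        using PiE_arb[OF 3, of k] by (cases "k \<in> signed W") auto
      then show ?case by blast
    next
      case (5 g)
      have neg: "- k \<notin> W" if "k \<in> W" for k using posW[of k] posW[of "- k"] that by auto
      show ?case
        unfolding prod_W prod.distrib[symmetric]
        by (rule prod.cong[OF refl]) (use in_signed neg in \<open>auto simp: mult_ac\<close>)
    qed auto
  qed
  also have "\<dots> = (\<Sum>j\<in>indices (signed W). (\<Prod>k\<in>signed W. of_real (R $ i k $ j k)) * mixed_moment M X W j)"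
  proof -
    have "integrable M (\<lambda>\<omega>. \<Prod>k\<in>W. X k \<omega> $ j k $ j (- k))" for j
      by (rule integrable_entries[OF M]) (use W rm in auto)
    then show ?thesis by (simp add: mixed_moment_def Bochner_Integration.integral_sum)
  qed
  finally show "orth_act R (signed W) (mixed_moment M X W) i = mixed_moment M X W i"
    by (simp add: orth_act_def)
qed

section \<open>Premaps as pair partitions\<close>

locale premap =
  fixes I :: "int set" and \<pi> :: "int \<Rightarrow> int"
  assumes finite_I: "finite I" and pos_I: "k \<in> I \<Longrightarrow> 0 < k" and premap: "\<pi> \<in> premaps I"
begin

lemma perm: "\<pi> permutes signed I" using premap by (simp add: premaps_def)

lemma finite_signed: "finite (signed I)" using finite_I by (simp add: signed_def)

lemma permutation: "permutation \<pi>" using perm finite_signed permutation_permutes by blast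

lemma signed_neg_iff: "- k \<in> signed I \<longleftrightarrow> k \<in> signed I" by (force simp: signed_def)

lemma signed_iff: "k \<in> signed I \<longleftrightarrow> \<bar>k\<bar> \<in> I"
  using pos_I[of k] pos_I[of "- k"] by (cases "k < 0") (force simp: signed_def)+

lemma zero_notin: "0 \<notin> signed I" using pos_I[of 0] by (auto simp: signed_def)

lemma in_signed: "\<pi> k \<in> signed I \<longleftrightarrow> k \<in> signed I" using perm by (rule permutes_in_image)

lemma neg: "\<pi> (- k) = - inv \<pi> k"
proof (cases "k \<in> signed I")
  case True
  then show ?thesis using premap signed_neg_iff[of k] by (force simp: premaps_def)
next
  case False
  then show ?thesis using signed_neg_iff[of k] permutes_not_in[OF perm, of "- k"]
      permutes_not_in[OF permutes_inv[OF perm], of k] by simp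
qed

text \<open>So k \<mapsto> \<pi> (- k) is an involution; \<open>neq_neg\<close> says that it has no
  fixed point on \<open>signed I\<close>.\<close>

lemma neg_neg [simp]: "\<pi> (- \<pi> (- k)) = k"
  by (simp add: neg permutes_inverses[OF perm])

lemma neq_neg: "k \<in> signed I \<Longrightarrow> \<pi> (- k) \<noteq> k"
proof
  assume k: "k \<in> signed I" and eq: "\<pi> (- k) = k"
  have "k \<in> orbit \<pi> (- k)" using orbit.base[of \<pi> "- k"] eq by simp
  then show False using premap k signed_neg_iff[of k] by (auto simp: premaps_def)
qed

lemma orbit_self: "k \<in> orbit \<pi> k" using permutation by (rule permutation_self_in_orbit)

lemma orbit_eq: "l \<in> orbit \<pi> k \<Longrightarrow> orbit \<pi> l = orbit \<pi> k"
  using permutation cyclic_on_orbit' orbit_cyclic_eq3 by metis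

lemma orbit_image: "orbit \<pi> (\<pi> k) = orbit \<pi> k"
  by (rule orbit_eq) (rule orbit.base)

lemma orbit_neg: "orbit \<pi> (- k) = uminus ` orbit \<pi> k"
proof -
  have "(\<pi> ^^ n) (- k) = - (inv \<pi> ^^ n) k" for n
    by (induction n) (simp_all add: neg)
  then have "orbit \<pi> (- k) = uminus ` orbit (inv \<pi>) k"
    by (auto simp: orbit_altdef)
  then show ?thesis using orbit_inv_eq[OF permutation] by simp
qed

lemma orbit_subset_signed: "k \<in> signed I \<Longrightarrow> orbit \<pi> k \<subseteq> signed I"
  using perm by (rule permutes_orbit_subset)

lemma finite_orbit_premap: "finite (orbit \<pi> k)" using finite_orbit[OF orbit_self] .

lemma neg_notin_orbit: "k \<in> signed I \<Longrightarrow> - k \<notin> orbit \<pi> k"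
  using premap by (auto simp: premaps_def)

text \<open>The cycle of - k is the negative of that of k. An element m of least absolute value is
  unique in its cycle, since - m is not in it, so its sign decides which of the two cycles is
  positive.\<close>

lemma positive_cycle_neg:
  assumes k: "k \<in> signed I"
  shows "positive_cycle (orbit \<pi> (- k)) \<longleftrightarrow> \<not> positive_cycle (orbit \<pi> k)"
proof -
  let ?c = "orbit \<pi> k"
  have fin: "finite (abs ` ?c)" and ne: "abs ` ?c \<noteq> {}" using finite_orbit_premap orbit_self by auto
  then obtain m where m: "m \<in> ?c" "\<bar>m\<bar> = Min (abs ` ?c)" by (metis Min_in imageE)
  have le: "\<bar>m\<bar> \<le> \<bar>l\<bar>" if "l \<in> ?c" for l using m(2) that fin by simp
  have mS: "m \<in> signed I" using m(1) orbit_subset_signed[OF k] by auto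
  then have m0: "m \<noteq> 0" using zero_notin by auto
  have nm: "- m \<notin> ?c" using neg_notin_orbit[OF mS] orbit_eq[OF m(1)] by simp
  have pos: "positive_cycle ?c \<longleftrightarrow> 0 < m"
  proof
    assume "positive_cycle ?c"
    then obtain m' where m': "m' \<in> ?c" "0 < m'" "\<And>l. l \<in> ?c \<Longrightarrow> m' \<le> \<bar>l\<bar>" by (auto simp: positive_cycle_def)
    have abs_m: "m' = \<bar>m\<bar>" using le[OF m'(1)] m'(3)[OF m(1)] m'(2) by linarith
    show "0 < m"
    proof (rule ccontr)
      assume "\<not> 0 < m"
      then have "m' = - m" using abs_m by simp
      then show False using m'(1) nm by simp
    qed
  next
    assume "0 < m"
    then have "0 < m \<and> (\<forall>l\<in>?c. m \<le> \<bar>l\<bar>)" using le by auto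
    then show "positive_cycle ?c" unfolding positive_cycle_def using m(1) by blast
  qed
  have neg_cycle: "positive_cycle (uminus ` ?c) \<longleftrightarrow> (\<exists>m\<in>?c. m < 0 \<and> (\<forall>l\<in>?c. - m \<le> \<bar>l\<bar>))"
    by (simp add: positive_cycle_def)
  have "positive_cycle (uminus ` ?c) \<longleftrightarrow> m < 0"
  proof
    assume "positive_cycle (uminus ` ?c)"
    then obtain m' where m': "m' \<in> ?c" "m' < 0" "\<And>l. l \<in> ?c \<Longrightarrow> - m' \<le> \<bar>l\<bar>"
      unfolding neg_cycle by blast
    have abs_m: "- m' = \<bar>m\<bar>" using le[OF m'(1)] m'(3)[OF m(1)] m'(2) by linarith
    show "m < 0"
    proof (rule ccontr)
      assume "\<not> m < 0"
      then have "m' = - m" using abs_m by simp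
      then show False using m'(1) nm by simp
    qed
  next
    assume "m < 0"
    then have "m < 0 \<and> (\<forall>l\<in>?c. - m \<le> \<bar>l\<bar>)" using le by auto
    then show "positive_cycle (uminus ` ?c)" unfolding neg_cycle using m(1) by blast
  qed
  then show ?thesis using pos m0 by (auto simp: orbit_neg)
qed

text \<open>The set on which \<pi>_+ acts as \<pi>. It contains exactly one of k and - k for each k
  in \<open>signed I\<close>, so \<open>abs\<close> maps it bijectively to I.\<close>

definition plus_set :: "int set" where
  "plus_set = {k \<in> signed I. positive_cycle (orbit \<pi> k)}"

lemma plus_set_subset: "plus_set \<subseteq> signed I" by (auto simp: plus_set_def)

lemma plus_set_neg: "k \<in> signed I \<Longrightarrow> - k \<in> plus_set \<longleftrightarrow> k \<notin> plus_set"
  using positive_cycle_neg signed_neg_iff by (auto simp: plus_set_def)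

lemma plus_set_image: "\<pi> k \<in> plus_set \<longleftrightarrow> k \<in> plus_set"
  by (simp add: plus_set_def in_signed orbit_image)

lemma premap_plus_eq: "premap_plus \<pi> k = (if k \<in> plus_set then \<pi> k else k)"
  using permutes_not_in[OF perm, of k] by (auto simp: premap_plus_def plus_set_def)

lemma premap_plus_perm: "premap_plus \<pi> permutes signed I"
  by (rule premap_plus_permutes[OF finite_I perm])

text \<open>For p = \<open>premap_plus \<pi>\<close> this says that p carries the pairs {k, - k} to
  the pairs {p k, p (- k)} of \<pi>. It is what links the Kreweras complement to pair
  partitions.\<close>

lemma premap_plus_neg: "\<pi> (- premap_plus \<pi> k) = premap_plus \<pi> (- k)" if k: "k \<in> signed I"
proof (cases "k \<in> plus_set")
  case True
  then have "- k \<notin> plus_set" using plus_set_neg[OF k] by simp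
  then show ?thesis using True neg_neg[of "- k"] by (simp add: premap_plus_eq)
next
  case False
  then have "- k \<in> plus_set" using plus_set_neg[OF k] by simp
  then show ?thesis using False by (simp add: premap_plus_eq)
qed

lemma bij_abs_plus_set: "bij_betw abs plus_set I"
proof -
  have "inj_on abs plus_set"
  proof (rule inj_onI)
    fix k l assume kl: "k \<in> plus_set" "l \<in> plus_set" "\<bar>k\<bar> = \<bar>l\<bar>"
    then have "l = k \<or> l = - k" by (auto simp: abs_if split: if_splits)
    then show "k = l" using kl plus_set_neg[of k] plus_set_subset by auto
  qed
  moreover have "abs ` plus_set = I"
  proof
    show "abs ` plus_set \<subseteq> I" using plus_set_subset signed_iff by auto
    show "I \<subseteq> abs ` plus_set"
    proof
      fix k assume k: "k \<in> I"
      then have "k \<in> signed I" "\<bar>k\<bar> = k" "\<bar>- k\<bar> = k" using pos_I[OF k] by (auto simp: signed_def)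
      then show "k \<in> abs ` plus_set" using plus_set_neg[of k] by (metis image_eqI)
    qed
  qed
  ultimately show ?thesis by (simp add: bij_betw_def)
qed

abbreviation pos_cycles :: "int set set" where
  "pos_cycles \<equiv> {c \<in> pcycles I \<pi>. positive_cycle c}"

lemma finite_pcycles: "finite (pcycles I \<pi>)" using finite_signed by (simp add: pcycles_def)

lemma pcycles_cases:
  assumes "c \<in> pcycles I \<pi>"
  obtains k where "k \<in> signed I" "c = orbit \<pi> k" "uminus ` c = orbit \<pi> (- k)"
  using assms orbit_neg unfolding pcycles_def by blast

lemma pcycles_neg:
  assumes "c \<in> pcycles I \<pi>" shows "uminus ` c \<in> pcycles I \<pi>"
proof -
  obtain k where "k \<in> signed I" "uminus ` c = orbit \<pi> (- k)" using assms by (rule pcycles_cases)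
  then show ?thesis using signed_neg_iff[of k] unfolding pcycles_def by blast
qed

lemma pcycles_positive_neg:
  assumes "c \<in> pcycles I \<pi>" shows "positive_cycle (uminus ` c) \<longleftrightarrow> \<not> positive_cycle c"
proof -
  obtain k where "k \<in> signed I" "c = orbit \<pi> k" "uminus ` c = orbit \<pi> (- k)" using assms by (rule pcycles_cases)
  then show ?thesis using positive_cycle_neg[of k] by simp
qed

lemma card_pcycles: "card (pcycles I \<pi>) = 2 * card pos_cycles"
proof -
  let ?neg = "{c \<in> pcycles I \<pi>. \<not> positive_cycle c}"
  have inv: "uminus ` uminus ` c = c" for c :: "int set" by (simp add: image_image)
  have "bij_betw (\<lambda>c :: int set. uminus ` c) pos_cycles ?neg"
  proof (rule bij_betw_byWitness[where f' = "\<lambda>c. uminus ` c"])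
    show "(\<lambda>c. uminus ` c) ` pos_cycles \<subseteq> ?neg"
      using pcycles_neg pcycles_positive_neg by blast
    show "(\<lambda>c. uminus ` c) ` ?neg \<subseteq> pos_cycles"
      using pcycles_neg pcycles_positive_neg by blast
  qed (simp_all only: inv, simp_all)
  then have "card pos_cycles = card ?neg" by (rule bij_betw_same_card)
  moreover have "pcycles I \<pi> = pos_cycles \<union> ?neg" by auto
  then have "card (pcycles I \<pi>) = card pos_cycles + card ?neg"
    using card_Un_disjoint[of pos_cycles ?neg] finite_pcycles by auto
  ultimately show ?thesis by simp
qed

lemma card_premap_part: "card (premap_part I \<pi>) = card pos_cycles"
proof -
  have "premap_part I \<pi> = (`) abs ` pos_cycles"
  proof
    show "premap_part I \<pi> \<subseteq> (`) abs ` pos_cycles"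
    proof
      fix B assume "B \<in> premap_part I \<pi>"
      then obtain c where c: "c \<in> pcycles I \<pi>" "B = abs ` c" by (auto simp: premap_part_def)
      have B': "B = abs ` uminus ` c" using c by (simp add: image_image)
      show "B \<in> (`) abs ` pos_cycles"
      proof (cases "positive_cycle c")
        case True
        then show ?thesis using c by blast
      next
        case False
        then have "uminus ` c \<in> pos_cycles" using pcycles_neg[OF c(1)] pcycles_positive_neg[OF c(1)] by simp
        then show ?thesis unfolding B' by (rule imageI)
      qed
    qed
  qed (auto simp: premap_part_def)
  moreover have "inj_on ((`) abs) pos_cycles"
  proof (rule inj_onI)
    fix c d assume cd: "c \<in> pos_cycles" "d \<in> pos_cycles" "abs ` c = abs ` d"
    then obtain k l where k: "k \<in> signed I" "c = orbit \<pi> k" and l: "l \<in> signed I" "d = orbit \<pi> l"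
      by (auto simp: pcycles_def)
    have "\<bar>k\<bar> \<in> abs ` d" using cd(3) k orbit_self by auto
    then obtain m where "m \<in> d" "\<bar>k\<bar> = \<bar>m\<bar>" by auto
    then have "k \<in> d \<or> - k \<in> d" by (auto simp: abs_if split: if_splits)
    then show "c = d"
    proof
      assume "k \<in> d" then show ?thesis using orbit_eq k l by simp
    next
      assume "- k \<in> d"
      then have "orbit \<pi> (- k) = d" using orbit_eq l by simp
      then show ?thesis using positive_cycle_neg[OF k(1)] cd k by auto
    qed
  qed
  ultimately show ?thesis by (simp add: card_image)
qed

lemma Union_premap_part: "\<Union>(premap_part I \<pi>) = I"
proof -
  have "\<Union>(pcycles I \<pi>) = signed I"
    unfolding pcycles_def using orbit_self orbit_subset_signed by blast
  then have "\<Union>(premap_part I \<pi>) = abs ` signed I" by (auto simp: premap_part_def)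
  also have "\<dots> = I"
  proof
    show "I \<subseteq> abs ` signed I"
    proof
      fix k assume "k \<in> I"
      then have "k \<in> signed I" "k = \<bar>k\<bar>" using pos_I[of k] by (auto simp: signed_def)
      then show "k \<in> abs ` signed I" by blast
    qed
  qed (use signed_iff in auto)
  finally show ?thesis .
qed

definition pair_part :: "int set set" where
  "pair_part = (\<lambda>k. {k, \<pi> (- k)}) ` signed I"

end

lemma pair_partition_of_involution:
  assumes "\<And>k. k \<in> S \<Longrightarrow> p k \<in> S" "\<And>k. k \<in> S \<Longrightarrow> p (p k) = k" "\<And>k. k \<in> S \<Longrightarrow> p k \<noteq> k"
  shows "(\<lambda>k. {k, p k}) ` S \<in> pair_partitions S"
    and "k \<in> S \<Longrightarrow> block_of ((\<lambda>k. {k, p k}) ` S) k = {k, p k}"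
proof -
  let ?P = "(\<lambda>k. {k, p k}) ` S"
  have eq: "{k, p k} = {x, p x}" if "k \<in> S" "x \<in> {k, p k}" for k x
    using that assms(2)[of k] by (elim insertE) (simp_all add: insert_commute)
  have part: "partition_on S ?P"
  proof (rule partition_onI)
    fix A B assume "A \<in> ?P" "B \<in> ?P" "A \<noteq> B"
    then obtain k l where kl: "k \<in> S" "l \<in> S" "A = {k, p k}" "B = {l, p l}" by auto
    then have "A = B" if "x \<in> A" "x \<in> B" for x using that eq[of k x] eq[of l x] by simp
    then show "disjnt A B" using \<open>A \<noteq> B\<close> by (auto simp: disjnt_def)
  qed (use assms(1) in auto)
  moreover have "card B = 2" if "B \<in> ?P" for B using that assms(3) by fastforce
  ultimately show "?P \<in> pair_partitions S" by (auto simp: pair_partitions_def)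
  show "block_of ?P k = {k, p k}" if "k \<in> S"
    by (rule block_of_eq[OF part]) (use that in auto)
qed

context premap begin

lemma pair_part: "pair_part \<in> pair_partitions (signed I)"
  unfolding pair_part_def
  by (rule pair_partition_of_involution) (use in_signed signed_neg_iff neq_neg in auto)

lemma block_of_pair_part: "k \<in> signed I \<Longrightarrow> block_of pair_part k = {k, \<pi> (- k)}"
  unfolding pair_part_def
  by (rule pair_partition_of_involution) (use in_signed signed_neg_iff neq_neg in auto)

lemma block_const_pair_part: "block_const pair_part j \<longleftrightarrow> (\<forall>k\<in>signed I. j (- k) = j (\<pi> k))"
proof -
  have "block_const pair_part j \<longleftrightarrow> (\<forall>k\<in>signed I. j k = j (\<pi> (- k)))"
    unfolding block_const_def pair_part_def by auto
  also have "\<dots> \<longleftrightarrow> (\<forall>k\<in>signed I. j (- k) = j (\<pi> k))"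
    using signed_neg_iff by (metis minus_minus)
  finally show ?thesis .
qed

end

text \<open>It suffices to exclude K k = - k. If K^m k = - k, removing one application of K at each
  end gives the same relation for K k with m - 2, down to m = 1, or to m = 0, where k would be
  0.\<close>

lemma premapsI:
  assumes perm: "K permutes signed I" and "finite I" and pos: "\<And>k. k \<in> I \<Longrightarrow> 0 < k"
    and inv_K: "\<And>k. k \<in> signed I \<Longrightarrow> inv K k = - K (- k)"
    and ne: "\<And>k. k \<in> signed I \<Longrightarrow> K k \<noteq> - k"
  shows "K \<in> premaps I"
proof -
  have S: "- k \<in> signed I \<longleftrightarrow> k \<in> signed I" for k by (force simp: signed_def)
  have z: "0 \<notin> signed I" using pos[of 0] by (auto simp: signed_def)
  have "(K ^^ m) k \<noteq> - k" if "k \<in> signed I" for m k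
    using that
  proof (induction m arbitrary: k rule: less_induct)
    case (less m)
    consider "m = 0" | "m = 1" | l where "m = Suc (Suc l)" by (metis One_nat_def not0_implies_Suc)
    then show ?case
    proof cases
      case 1 then show ?thesis using less.prems z by auto
    next
      case 2 then show ?thesis using ne less.prems by simp
    next
      case 3
      have Kk: "K k \<in> signed I" using less.prems permutes_in_image[OF perm] by blast
      show ?thesis
      proof
        assume "(K ^^ m) k = - k"
        then have "K ((K ^^ l) (K k)) = - k" using 3 by (simp add: funpow_swap1)
        then have "(K ^^ l) (K k) = inv K (- k)" using permutes_inverses(2)[OF perm] by metis
        also have "\<dots> = - K k" using inv_K S less.prems by simp
        finally show False using less.IH[of l "K k"] Kk 3 by simp
      qed
    qed
  qed
  then have "- k \<notin> orbit K k" if "k \<in> signed I" for k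
    using that unfolding orbit_altdef by (auto dest: sym)
  moreover have "K k = - inv K (- k)" if "k \<in> signed I" for k using inv_K[of "- k"] S that by simp
  ultimately show ?thesis using perm by (simp add: premaps_def)
qed

text \<open>The inverse sends P to k \<mapsto> \<open>partner P (- k)\<close>. Sums over premaps
  thereby become sums over all pair partitions, which up to numbering index the Weingarten
  matrix.\<close>

lemma bij_betw_pair_part:
  assumes fin: "finite I" and pos: "\<And>k. k \<in> I \<Longrightarrow> 0 < k"
  shows "bij_betw (premap.pair_part I) (premaps I) (pair_partitions (signed I))"
proof -
  have pm: "premap I \<pi>" if "\<pi> \<in> premaps I" for \<pi> using that assms by unfold_locales auto
  have S: "- k \<in> signed I \<longleftrightarrow> k \<in> signed I" for k by (force simp: signed_def)
  have "inj_on (premap.pair_part I) (premaps I)"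
  proof (rule inj_onI)
    fix \<pi> \<sigma> assume pi: "\<pi> \<in> premaps I" and sigma: "\<sigma> \<in> premaps I"
      and eq: "premap.pair_part I \<pi> = premap.pair_part I \<sigma>"
    interpret pi: premap I \<pi> using pm[OF pi] .
    interpret sigma: premap I \<sigma> using pm[OF sigma] .
    have "\<pi> k = \<sigma> k" for k
    proof (cases "k \<in> signed I")
      case True
      then have "{- k, \<pi> k} = {- k, \<sigma> k}"
        using pi.block_of_pair_part[of "- k"] sigma.block_of_pair_part[of "- k"] eq S by simp
      then show ?thesis by (auto simp: doubleton_eq_iff)
    next
      case False
      then show ?thesis using permutes_not_in[OF pi.perm] permutes_not_in[OF sigma.perm] by simp
    qed
    then show "\<pi> = \<sigma>" by blast
  qed
  moreover have "P \<in> premap.pair_part I ` premaps I" if P: "P \<in> pair_partitions (signed I)" for P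
  proof -
    define K where "K k = (if k \<in> signed I then partner P (- k) else k)" for k
    note part = partner[OF P]
    have K_in: "K k \<in> signed I" if "k \<in> signed I" for k using that part S by (simp add: K_def)
    have K_inv: "K (- K (- k)) = k" for k
      using part(1)[of k] part(4)[of k] S by (cases "k \<in> signed I") (simp_all add: K_def)
    have K_inv': "- K (- K k) = k" for k using K_inv[of "- k"] by simp
    have bij: "bij K" by (rule o_bij[of "\<lambda>k. - K (- k)"]) (auto simp: fun_eq_iff K_inv K_inv')
    have perm: "K permutes signed I" using bij unfolding permutes_def bij_iff by (auto simp: K_def)
    have inv_K: "inv K k = - K (- k)" for k
      using K_inv[of k] bij_is_inj[OF bij] by (intro inv_f_eq)
    have K: "K \<in> premaps I"
      by (rule premapsI[OF perm fin pos]) (use inv_K part(2) S in \<open>auto simp: K_def\<close>)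
    interpret K: premap I K using pm[OF K] .
    have "K.pair_part = (\<lambda>k. {k, partner P k}) ` signed I"
      unfolding K.pair_part_def by (rule image_cong) (auto simp: K_def S)
    then show ?thesis using pair_partition_eq_partner[OF P] K by auto
  qed
  ultimately show ?thesis
    using premap.pair_part[OF pm] by (auto simp: bij_betw_def)
qed

text \<open>Composing the two involutions moves by \<kappa> or its inverse, so a block of the join
  is a cycle of \<kappa> together with its mirror image. Taking absolute values gives the
  corresponding block of \<Pi>(\<kappa>) and halves the size. E is the mirror image of the pair
  partition of \<kappa>, the form in which it arises from the Kreweras complement.\<close>

lemma join_delta_orbit:
  assumes "premap I \<kappa>"
  defines "D \<equiv> (\<lambda>k. {k, - k}) ` signed I" and "E \<equiv> (\<lambda>k. {k, - \<kappa> k}) ` signed I"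
  shows "D \<in> pair_partitions (signed I)" and "E \<in> pair_partitions (signed I)"
    and "\<exists>f. bij_betw f (part_join (signed I) D E) (premap_part I \<kappa>) \<and>
      (\<forall>C\<in>part_join (signed I) D E. card C = 2 * card (f C))"
proof -
  interpret premap I \<kappa> by fact
  let ?S = "signed I"
  have kk: "- \<kappa> (- \<kappa> k) = k" for k using neg_neg[of "- k"] by simp
  have ne: "- \<kappa> k \<noteq> k" if k: "k \<in> ?S" for k
  proof
    assume "- \<kappa> k = k"
    then have "- k \<in> orbit \<kappa> k" using orbit.base[of \<kappa> k] by (metis minus_minus)
    then show False using neg_notin_orbit[OF k] by simp
  qed
  have ne0: "- k \<noteq> k" if "k \<in> ?S" for k using that zero_notin by auto
  show D: "D \<in> pair_partitions ?S"
    unfolding D_def by (rule pair_partition_of_involution) (use signed_neg_iff ne0 in auto)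
  show E: "E \<in> pair_partitions ?S"
    unfolding E_def by (rule pair_partition_of_involution) (use signed_neg_iff in_signed ne kk in auto)
  have rel: "(x, y) \<in> join_rel D E \<longleftrightarrow> x \<in> ?S \<and> y \<in> {x, - x, - \<kappa> x}" for x y
  proof -
    have "x \<in> ?S \<Longrightarrow> block_of D x = {x, - x}"
      unfolding D_def by (rule pair_partition_of_involution) (use signed_neg_iff ne0 in auto)
    moreover have "x \<in> ?S \<Longrightarrow> block_of E x = {x, - \<kappa> x}"
      unfolding E_def by (rule pair_partition_of_involution) (use signed_neg_iff in_signed ne kk in auto)
    ultimately show ?thesis
      unfolding join_rel_partner[OF D E] using partner(2,3)[OF D, of x] partner(2,3)[OF E, of x]
      by (auto simp: doubleton_eq_iff)
  qed
  define B where "B x = orbit \<kappa> x \<union> uminus ` orbit \<kappa> x" for x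
  have inv_in: "inv \<kappa> y \<in> orbit \<kappa> x" if "y \<in> orbit \<kappa> x" for x y
  proof -
    have "orbit \<kappa> (\<kappa> (inv \<kappa> y)) = orbit \<kappa> (inv \<kappa> y)" by (rule orbit_image)
    then have "inv \<kappa> y \<in> orbit \<kappa> y" using orbit_self[of "inv \<kappa> y"] permutes_inverses(1)[OF perm] by simp
    then show ?thesis using orbit_eq[OF that] by simp
  qed
  have cls: "(join_rel D E)\<^sup>+ `` {x} = B x" if x: "x \<in> ?S" for x
  proof
    show "(join_rel D E)\<^sup>+ `` {x} \<subseteq> B x"
    proof
      fix y assume "y \<in> (join_rel D E)\<^sup>+ `` {x}"
      then have "(x, y) \<in> (join_rel D E)\<^sup>+" by simp
      then show "y \<in> B x"
      proof (induction rule: trancl_induct)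
        case (base y)
        then show ?case using rel orbit_self[of x] orbit.base[of \<kappa> x] by (auto simp: B_def)
      next
        case (step y z)
        have z: "z = y \<or> z = - y \<or> z = - \<kappa> y" using step(2) rel by auto
        from step.IH consider "y \<in> orbit \<kappa> x" | w where "w \<in> orbit \<kappa> x" "y = - w"
          unfolding B_def by blast
        then show ?case
        proof cases
          case 1
          then have "\<kappa> y \<in> orbit \<kappa> x" by (rule orbit.step)
          then show ?thesis using z 1 by (auto simp: B_def)
        next
          case 2
          have "- \<kappa> y = inv \<kappa> w" using 2 neg[of w] by simp
          then show ?thesis using z 2 inv_in[OF 2(1)] by (auto simp: B_def)
        qed
      qed
    qed
    have orb: "(x, y) \<in> (join_rel D E)\<^sup>+" if "y \<in> orbit \<kappa> x" for y
      using that
    proof (induction rule: orbit.induct)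
      case base
      have "(x, - \<kappa> x) \<in> join_rel D E" "(- \<kappa> x, \<kappa> x) \<in> join_rel D E"
        using rel x in_signed signed_neg_iff by auto
      then show ?case by (meson r_into_trancl trancl.trancl_into_trancl)
    next
      case (step y)
      have "y \<in> ?S" using step(1) orbit_subset_signed[OF x] by auto
      then have "(y, - \<kappa> y) \<in> join_rel D E" "(- \<kappa> y, \<kappa> y) \<in> join_rel D E"
        using rel in_signed signed_neg_iff by auto
      with step.IH show ?case by (meson trancl.trancl_into_trancl)
    qed
    show "B x \<subseteq> (join_rel D E)\<^sup>+ `` {x}"
    proof
      fix y assume "y \<in> B x"
      then consider "y \<in> orbit \<kappa> x" | w where "w \<in> orbit \<kappa> x" "y = - w" unfolding B_def by blast
      then show "y \<in> (join_rel D E)\<^sup>+ `` {x}"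
      proof cases
        case 1 then show ?thesis using orb by simp
      next
        case 2
        then have "w \<in> ?S" using orbit_subset_signed[OF x] by auto
        then have "(w, y) \<in> join_rel D E" using rel 2 by simp
        then show ?thesis using orb[OF 2(1)] by (simp add: trancl.trancl_into_trancl)
      qed
    qed
  qed
  have J: "part_join ?S D E = B ` ?S"
    unfolding part_join_eq quotient_def using cls by auto
  have abs_B: "abs ` B x = abs ` orbit \<kappa> x" for x by (auto simp: B_def image_Un image_image)
  have B_eq: "B x = signed (abs ` orbit \<kappa> x)" for x
  proof
    show "B x \<subseteq> signed (abs ` orbit \<kappa> x)"
    proof
      fix y assume "y \<in> B x"
      then obtain w where w: "w \<in> orbit \<kappa> x" "y = w \<or> y = - w" unfolding B_def by blast
      then have "\<bar>w\<bar> \<in> abs ` orbit \<kappa> x" "y = \<bar>w\<bar> \<or> y = - \<bar>w\<bar>" by auto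
      then show "y \<in> signed (abs ` orbit \<kappa> x)" unfolding signed_def by blast
    qed
    show "signed (abs ` orbit \<kappa> x) \<subseteq> B x"
    proof
      fix y assume "y \<in> signed (abs ` orbit \<kappa> x)"
      then obtain w where w: "w \<in> orbit \<kappa> x" "y = \<bar>w\<bar> \<or> y = - \<bar>w\<bar>" unfolding signed_def by blast
      then have "y = w \<or> y = - w" by auto
      then show "y \<in> B x" using w(1) unfolding B_def by blast
    qed
  qed
  have card_B: "card (B x) = 2 * card (abs ` B x)" if x: "x \<in> ?S" for x
  proof -
    let ?a = "abs ` orbit \<kappa> x"
    have pos: "0 < k" if k: "k \<in> ?a" for k
    proof -
      obtain w where w: "w \<in> orbit \<kappa> x" "k = \<bar>w\<bar>" using k by blast
      then have "w \<noteq> 0" using orbit_subset_signed[OF x] zero_notin by blast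
      then show ?thesis using w by simp
    qed
    have fin: "finite ?a" using finite_orbit_premap by simp
    have "?a \<inter> uminus ` ?a = {}" using pos by (rule positive_disjoint_neg)
    then have "card (?a \<union> uminus ` ?a) = card ?a + card (uminus ` ?a)"
      using fin by (intro card_Un_disjoint) auto
    moreover have "card (uminus ` ?a) = card ?a" by (rule card_image) (simp add: inj_on_def)
    moreover have "card (B x) = card (?a \<union> uminus ` ?a)" by (simp only: B_eq signed_def)
    ultimately show ?thesis unfolding abs_B by linarith
  qed
  have "inj_on ((`) abs) (part_join ?S D E)"
  proof (rule inj_onI)
    fix C C' assume "C \<in> part_join ?S D E" "C' \<in> part_join ?S D E" and eq: "abs ` C = abs ` C'"
    then obtain x x' where "C = B x" "C' = B x'" unfolding J by blast
    then show "C = C'" using eq abs_B B_eq by metis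
  qed
  moreover have "(`) abs ` part_join ?S D E = premap_part I \<kappa>"
    unfolding J premap_part_def pcycles_def image_image abs_B ..
  ultimately show "\<exists>f. bij_betw f (part_join ?S D E) (premap_part I \<kappa>) \<and>
      (\<forall>C\<in>part_join ?S D E. card C = 2 * card (f C))"
    using card_B unfolding J by (intro exI[of _ "(`) abs"]) (auto simp: bij_betw_def)
qed

text \<open>The permutation \<rho>_+ maps the pairs {k, - k} to those of \<rho>, and for K =
  \<open>kreweras \<rho> \<pi>\<close> it maps the pairs {k, - K k} to those of \<pi>. So the pair
  partitions of \<rho> and \<pi> are a relabelling of the situation of
  \<open>join_delta_orbit\<close>, and the Weingarten function at \<Pi>(K) is the matrix entry at
  \<rho> and \<pi>.\<close>

lemma join_type_kreweras:
  assumes fin: "finite I" and pos: "\<And>k. k \<in> I \<Longrightarrow> 0 < k"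
    and \<rho>: "\<rho> \<in> premaps I" and \<pi>: "\<pi> \<in> premaps I" and h: "bij_betw h (signed I) {1..2 * n}"
  shows "join_type n (premap_part I (kreweras \<rho> \<pi>))
    ((`) h ` premap.pair_part I \<rho>) ((`) h ` premap.pair_part I \<pi>)"
proof -
  let ?S = "signed I" and ?K = "kreweras \<rho> \<pi>" and ?r = "premap_plus \<rho>"
  have K: "?K \<in> premaps I" by (rule kreweras_premap[OF fin \<rho> \<pi>])
  interpret rho: premap I \<rho> using fin pos \<rho> by unfold_locales
  interpret pi: premap I \<pi> using fin pos \<pi> by unfold_locales
  have pK: "premap I ?K" using fin pos K by unfold_locales
  define D where "D = (\<lambda>k. {k, - k}) ` ?S"
  define E where "E = (\<lambda>k. {k, - ?K k}) ` ?S"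
  note DE = join_delta_orbit[OF pK, folded D_def E_def]
  have r: "?r permutes ?S" by (rule rho.premap_plus_perm)
  have rS: "?r ` ?S = ?S" and r_inj: "inj_on ?r ?S" using permutes_image[OF r] permutes_inj_on[OF r] by auto
  have D: "(`) ?r ` D = rho.pair_part"
  proof -
    have "(`) ?r ` D = (\<lambda>k. {?r k, \<rho> (- ?r k)}) ` ?S"
      unfolding D_def image_image by (rule image_cong) (simp_all add: rho.premap_plus_neg)
    also have "\<dots> = (\<lambda>k. {k, \<rho> (- k)}) ` ?r ` ?S" by (simp add: image_image)
    finally show ?thesis by (simp add: rS rho.pair_part_def)
  qed
  have E: "(`) ?r ` E = pi.pair_part"
  proof -
    have "?r (- ?K k) = \<pi> (- ?r k)" for k
      using permutes_inverses(1)[OF r] by (simp add: kreweras_def premap_minus_def pi.neg)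
    then have "(`) ?r ` E = (\<lambda>k. {?r k, \<pi> (- ?r k)}) ` ?S"
      unfolding E_def image_image by simp
    also have "\<dots> = (\<lambda>k. {k, \<pi> (- k)}) ` ?r ` ?S" by (simp add: image_image)
    finally show ?thesis by (simp add: rS pi.pair_part_def)
  qed
  define H where "H = h \<circ> ?r"
  have H: "bij_betw H ?S {1..2 * n}"
    unfolding H_def by (rule bij_betw_trans[OF _ h]) (simp add: bij_betw_def r_inj rS)
  have Hinj: "inj_on H ?S" and HS: "H ` ?S = {1..2 * n}" using H by (auto simp: bij_betw_def)
  have img: "(`) h ` rho.pair_part = (`) H ` D" "(`) h ` pi.pair_part = (`) H ` E"
    unfolding D[symmetric] E[symmetric] H_def by (auto simp: image_image image_comp)
  let ?J = "part_join ?S D E"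
  have part: "partition_on ?S D" "partition_on ?S E" using DE by (auto simp: pair_partitions_def)
  have J: "part_join {1..2 * n} ((`) H ` D) ((`) H ` E) = (`) H ` ?J"
    using part_join_image[OF Hinj part] by (simp only: HS)
  have JS: "?J \<subseteq> Pow ?S" using partition_onD1[OF partition_on_part_join[OF part]] by auto
  have inj: "inj_on ((`) H) ?J" using inj_on_image_Pow[OF Hinj] JS inj_on_subset by blast
  obtain f where f: "bij_betw f ?J (premap_part I ?K)" "\<And>C. C \<in> ?J \<Longrightarrow> card C = 2 * card (f C)"
    using DE(3) by blast
  let ?f = "f \<circ> inv_into ?J ((`) H)"
  have "bij_betw ?f ((`) H ` ?J) (premap_part I ?K)"
    by (rule bij_betw_trans[OF _ f(1)], rule bij_betw_inv_into) (simp add: bij_betw_def inj)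
  moreover have "card B = 2 * card (?f B)" if B: "B \<in> (`) H ` ?J" for B
  proof -
    obtain C where C: "C \<in> ?J" "B = H ` C" using B by blast
    have "C \<subseteq> ?S" using C JS by auto
    then have "card B = card C" unfolding C(2) by (intro card_image inj_on_subset[OF Hinj])
    then show ?thesis using f(2)[OF C(1)] C inj by (simp add: inv_into_f_f)
  qed
  ultimately show ?thesis unfolding join_type_def img J by (intro exI[of _ ?f] conjI ballI) auto
qed

section \<open>Traces along premaps\<close>

lemma sum_indices_insert:
  fixes f :: "('a \<Rightarrow> 'b::finite) \<Rightarrow> 'c::comm_monoid_add"
  assumes "y \<notin> A"
  shows "sum f (indices (insert y A)) = (\<Sum>c\<in>UNIV. \<Sum>j\<in>indices A. f (j(y := c)))"
proof -
  let ?upd = "\<lambda>(c :: 'b, j). j(y := c)"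
  have "indices (insert y A) = ?upd ` (UNIV \<times> indices A)"
    by (rule PiE_insert_eq)
  moreover have "inj_on ?upd (UNIV \<times> indices A)"
    by (rule inj_combinator[OF assms])
  ultimately show ?thesis
    by (simp add: sum.reindex sum.cartesian_product split_def)
qed

lemma sum_indices_Un:
  fixes f g :: "('a \<Rightarrow> 'b::finite) \<Rightarrow> 'c::comm_semiring_0"
  assumes AB: "A \<inter> B = {}"
    and f: "\<And>j. f (restrict j A) = f j" and g: "\<And>j. g (restrict j B) = g j"
  shows "(\<Sum>j\<in>indices (A \<union> B). f j * g j) = sum f (indices A) * sum g (indices B)"
proof -
  have "sum f (indices A) * sum g (indices B) = (\<Sum>(j, k)\<in>indices A \<times> indices B. f j * g k)"
    by (simp add: sum_product sum.cartesian_product)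
  also have "\<dots> = (\<Sum>j\<in>indices (A \<union> B). f j * g j)"
  proof (rule sum.reindex_bij_witness[of _ "\<lambda>j. (restrict j A, restrict j B)"
        "\<lambda>(j, k). \<lambda>x\<in>A \<union> B. if x \<in> A then j x else k x"], goal_cases)
    case (1 p)
    then obtain j k where p: "p = (j, k)" "j \<in> indices A" "k \<in> indices B" by auto
    have "restrict (\<lambda>x\<in>A \<union> B. if x \<in> A then j x else k x) A x = j x" for x
      using PiE_arb[OF p(2), of x] by (cases "x \<in> A") simp_all
    moreover have "restrict (\<lambda>x\<in>A \<union> B. if x \<in> A then j x else k x) B x = k x" for x
      using PiE_arb[OF p(3), of x] AB by (cases "x \<in> B") auto
    ultimately show ?case unfolding p(1) prod.case prod.inject by blast
  next
    case (3 j)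
    have "(\<lambda>x\<in>A \<union> B. if x \<in> A then restrict j A x else restrict j B x) x = j x" for x
      using PiE_arb[OF 3, of x] by (cases "x \<in> A \<union> B") auto
    then show ?case unfolding prod.case by blast
  next
    case (5 p)
    then obtain j k where p: "p = (j, k)" "j \<in> indices A" "k \<in> indices B" by auto
    let ?m = "\<lambda>x\<in>A \<union> B. if x \<in> A then j x else k x"
    have "restrict ?m A = restrict j A" by (rule restrict_ext) simp
    moreover have "restrict ?m B = restrict k B" by (rule restrict_ext) (use AB in auto)
    ultimately have "f ?m = f j" "g ?m = g k" using f g by metis+
    then show ?case unfolding p(1) by (simp only: prod.case)
  qed auto
  finally show ?thesis by simp
qed

lemma prod_sum_disjoint:
  fixes F :: "'a set \<Rightarrow> ('a \<Rightarrow> 'b::finite) \<Rightarrow> 'c::comm_semiring_1"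
  assumes "finite C" and "disjoint C" and F: "\<And>c j. F c (restrict j c) = F c j"
  shows "(\<Prod>c\<in>C. \<Sum>j\<in>indices c. F c j) = (\<Sum>j\<in>indices (\<Union>C). \<Prod>c\<in>C. F c j)"
  using assms(1,2)
proof (induction C rule: finite_induct)
  case empty
  then show ?case by simp
next
  case (insert c C)
  have dis: "c \<inter> \<Union>C = {}" using insert.prems insert.hyps by (force simp: disjoint_def)
  have "(\<Prod>d\<in>C. F d (restrict j (\<Union>C))) = (\<Prod>d\<in>C. F d j)" for j
  proof (rule prod.cong[OF refl])
    fix d assume "d \<in> C"
    then have "restrict (restrict j (\<Union>C)) d = restrict j d" by (intro restrict_ext) auto
    then show "F d (restrict j (\<Union>C)) = F d j" using F by metis
  qed
  then have "(\<Sum>j\<in>indices (c \<union> \<Union>C). F c j * (\<Prod>d\<in>C. F d j))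
      = (\<Sum>j\<in>indices c. F c j) * (\<Sum>j\<in>indices (\<Union>C). \<Prod>d\<in>C. F d j)"
    by (intro sum_indices_Un[OF dis] F)
  then show ?case using insert by (simp add: disjoint_def)
qed

text \<open>Each factor has its own row index, and its column index is the row index of the next
  factor. The last column index b is kept free for matrix entries and set to the first row index for
  traces.\<close>

fun path_weight :: "(int \<Rightarrow> complex^'N^'N) \<Rightarrow> (int \<Rightarrow> 'N) \<Rightarrow> int list \<Rightarrow> 'N \<Rightarrow> complex" where
  "path_weight M j [] b = 1"
| "path_weight M j [x] b = M x $ j x $ b"
| "path_weight M j (x # y # ys) b = M x $ j x $ j y * path_weight M j (y # ys) b"

lemma path_weight_cong: "(\<And>k. k \<in> set xs \<Longrightarrow> i k = j k) \<Longrightarrow> path_weight M i xs b = path_weight M j xs b"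
  by (induction M i xs b rule: path_weight.induct) auto

lemma matrix_product_entry:
  fixes M :: "int \<Rightarrow> complex^'N^'N"
  assumes "distinct (x # ys)"
  shows "foldr (\<lambda>k B. M k ** B) (x # ys) (mat 1) $ a $ b
    = (\<Sum>j\<in>indices (set ys). path_weight M (j(x := a)) (x # ys) b)"
  using assms
proof (induction ys arbitrary: x a)
  case Nil
  then show ?case by (simp add: matrix_mul_rid)
next
  case (Cons y zs)
  have mm: "(P ** Q) $ a $ b = (\<Sum>c\<in>UNIV. P $ a $ c * Q $ c $ b)" for P Q :: "complex^'N^'N"
    by (simp add: matrix_matrix_mult_def)
  have IH: "foldr (\<lambda>k B. M k ** B) (y # zs) (mat 1) $ c $ b
      = (\<Sum>j\<in>indices (set zs). path_weight M (j(y := c)) (y # zs) b)" for c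
    by (rule Cons.IH) (use Cons.prems in simp)
  have "foldr (\<lambda>k B. M k ** B) (x # y # zs) (mat 1) $ a $ b
      = (\<Sum>c\<in>UNIV. M x $ a $ c * (\<Sum>j\<in>indices (set zs). path_weight M (j(y := c)) (y # zs) b))"
    unfolding IH[symmetric] mm[symmetric] by simp
  also have "\<dots> = (\<Sum>c\<in>UNIV. \<Sum>j\<in>indices (set zs). path_weight M ((j(y := c))(x := a)) (x # y # zs) b)"
    unfolding sum_distrib_left
  proof (intro sum.cong refl)
    fix c j
    have "path_weight M ((j(y := c))(x := a)) (y # zs) b = path_weight M (j(y := c)) (y # zs) b"
      by (rule path_weight_cong) (use Cons.prems in auto)
    then show "M x $ a $ c * path_weight M (j(y := c)) (y # zs) b
        = path_weight M ((j(y := c))(x := a)) (x # y # zs) b"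
      using Cons.prems by simp
  qed
  also have "\<dots> = (\<Sum>j\<in>indices (insert y (set zs)). path_weight M (j(x := a)) (x # y # zs) b)"
    by (rule sum_indices_insert[symmetric]) (use Cons.prems in auto)
  finally show ?case unfolding list.set .
qed

lemma trace_matrix_product:
  fixes M :: "int \<Rightarrow> complex^'N^'N"
  assumes "distinct (x # ys)"
  shows "trace (foldr (\<lambda>k B. M k ** B) (x # ys) (mat 1))
    = (\<Sum>j\<in>indices (set (x # ys)). path_weight M j (x # ys) (j x))"
proof -
  have "trace (foldr (\<lambda>k B. M k ** B) (x # ys) (mat 1))
      = (\<Sum>a\<in>UNIV. \<Sum>j\<in>indices (set ys). path_weight M (j(x := a)) (x # ys) ((j(x := a)) x))"
    unfolding trace_def matrix_product_entry[OF assms] by simp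
  also have "\<dots> = (\<Sum>j\<in>indices (insert x (set ys)). path_weight M j (x # ys) (j x))"
    by (rule sum_indices_insert[symmetric]) (use assms in auto)
  finally show ?thesis by simp
qed

lemma path_weight_orbit:
  assumes "distinct xs" and "xs \<noteq> []" and "successively (\<lambda>x y. \<pi> x = y) xs"
  shows "path_weight M j xs (j (\<pi> (last xs))) = (\<Prod>k\<in>set xs. M k $ j k $ j (\<pi> k))"
  using assms
proof (induction xs rule: induct_list012)
  case (3 x y zs)
  then show ?case by simp
qed auto

text \<open>Along the list m, \<pi> m, \<dots> the column index at k is j (\<pi> k), also at the
  last element, where \<pi> returns to m. The product over the orbit no longer remembers the
  starting point.\<close>

lemma ntr_cycle:
  fixes M :: "int \<Rightarrow> complex^'N^'N"
  assumes \<pi>: "permutation \<pi>"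
  shows "ntr (foldr (\<lambda>k B. M k ** B) (support \<pi> m) (mat 1))
    = (\<Sum>j\<in>indices (orbit \<pi> m). \<Prod>k\<in>orbit \<pi> m. M k $ j k $ j (\<pi> k)) / of_nat CARD('N)"
proof -
  let ?L = "least_power \<pi> m"
  have L: "(\<pi> ^^ ?L) m = m" "?L > 0" using least_power_of_permutation[OF \<pi>] by auto
  define xs where "xs = support \<pi> m"
  have dist: "distinct xs" unfolding xs_def using cycle_of_permutation[OF \<pi>] .
  have set_xs: "set xs = orbit \<pi> m"
    unfolding xs_def support_set[OF \<pi>] orbit_altdef_permutation[OF \<pi>] by auto
  obtain ys where ys: "xs = m # ys"
    using L(2) unfolding xs_def by (cases "support \<pi> m") (auto simp: upt_conv_Cons)
  have succ: "successively (\<lambda>x y. \<pi> x = y) xs"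
    by (simp add: xs_def successively_conv_nth)
  have last: "\<pi> (last xs) = m"
  proof -
    obtain l where l: "?L = Suc l" using L(2) by (cases ?L) auto
    then show ?thesis using L(1) by (simp add: xs_def)
  qed
  have "trace (foldr (\<lambda>k B. M k ** B) xs (mat 1)) = (\<Sum>j\<in>indices (set xs). path_weight M j xs (j m))"
    using dist unfolding ys by (rule trace_matrix_product)
  also have "\<dots> = (\<Sum>j\<in>indices (orbit \<pi> m). \<Prod>k\<in>orbit \<pi> m. M k $ j k $ j (\<pi> k))"
    unfolding set_xs
  proof (rule sum.cong[OF refl])
    fix j
    have "xs \<noteq> []" using ys by simp
    from path_weight_orbit[OF dist this succ, of M j]
    show "path_weight M j xs (j m) = (\<Prod>k\<in>orbit \<pi> m. M k $ j k $ j (\<pi> k))"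
      unfolding last set_xs .
  qed
  finally show ?thesis unfolding ntr_def xs_def by simp
qed

context premap begin

text \<open>The cycles of \<pi>_+ give a sum over indices on \<open>plus_set\<close> of entries at
  (j k, j (\<pi> k)). Putting j (- k) = j (\<pi> k) extends j to \<plusminus>I, and this condition
  is constancy on the pairs of \<pi>. For a negative k the transpose turns the entry into that of A
  |k| at the index pair of |k|.\<close>

lemma tr_premap_eq:
  fixes A :: "int \<Rightarrow> complex^'N^'N"
  shows "tr_premap I \<pi> A = (\<Sum>j\<in>{j \<in> indices (signed I). block_const pair_part j}.
    \<Prod>k\<in>I. A k $ j k $ j (- k)) / of_nat CARD('N) ^ card pos_cycles"
proof -
  let ?M = "signed_mat A"
  let ?F = "\<lambda>c (j :: int \<Rightarrow> 'N). \<Prod>k\<in>c. ?M k $ j k $ j (\<pi> k)"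
  have fin: "finite pos_cycles" using finite_pcycles by simp
  have dis: "disjoint pos_cycles"
  proof (rule disjointI)
    fix c d assume "c \<in> pos_cycles" "d \<in> pos_cycles" "c \<noteq> d"
    then obtain k l where "c = orbit \<pi> k" "d = orbit \<pi> l" by (auto simp: pcycles_def)
    then show "c \<inter> d = {}" using orbit_eq \<open>c \<noteq> d\<close> by (metis disjoint_iff)
  qed
  have Un: "\<Union>pos_cycles = plus_set"
    unfolding pcycles_def plus_set_def using orbit_self orbit_subset_signed orbit_eq by auto
  have clos: "\<pi> k \<in> c" if "c \<in> pos_cycles" "k \<in> c" for c k
    using that by (auto simp: pcycles_def intro: orbit.step)
  have Min_c: "orbit \<pi> (Min (abs ` c)) = c" if c: "c \<in> pos_cycles" for c
  proof -
    obtain k where k: "c = orbit \<pi> k" using c by (auto simp: pcycles_def)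
    obtain m where m: "m \<in> c" "0 < m" "\<And>l. l \<in> c \<Longrightarrow> m \<le> \<bar>l\<bar>" using c by (auto simp: positive_cycle_def)
    have "Min (abs ` c) = m"
      using m finite_orbit_premap[of k] k by (intro Min_eqI) (auto intro!: image_eqI[of m abs m])
    then show ?thesis using orbit_eq m(1) k by simp
  qed
  have cyc: "ntr (foldr (\<lambda>k B. ?M k ** B) (support \<pi> (Min (abs ` c))) (mat 1))
      = (\<Sum>j\<in>indices c. ?F c j) / of_nat CARD('N)" if "c \<in> pos_cycles" for c
    using ntr_cycle[OF permutation, of ?M "Min (abs ` c)"] by (simp only: Min_c[OF that])
  have "tr_premap I \<pi> A = (\<Prod>c\<in>pos_cycles. (\<Sum>j\<in>indices c. ?F c j) / of_nat CARD('N))"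
    unfolding tr_premap_def by (rule prod.cong[OF refl cyc])
  also have "\<dots> = (\<Prod>c\<in>pos_cycles. \<Sum>j\<in>indices c. ?F c j) / of_nat CARD('N) ^ card pos_cycles"
    by (simp add: prod_dividef)
  \<comment> \<open>\<open>prod_sum_disjoint\<close> asks that for every set c the factor depend
    only on the values of j on c. The guard secures this for sets not closed under \<pi> and changes
    nothing for cycles.\<close>
  also have "(\<Prod>c\<in>pos_cycles. \<Sum>j\<in>indices c. ?F c j)
      = (\<Prod>c\<in>pos_cycles. \<Sum>j\<in>indices c. if \<forall>k\<in>c. \<pi> k \<in> c then ?F c j else 0)"
    by (rule prod.cong[OF refl]) (use clos in simp)
  also have "\<dots> = (\<Sum>j\<in>indices plus_set. \<Prod>c\<in>pos_cycles. if \<forall>k\<in>c. \<pi> k \<in> c then ?F c j else 0)"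
    unfolding Un[symmetric]
    by (rule prod_sum_disjoint[OF fin dis]) (auto intro!: prod.cong)
  also have "\<dots> = (\<Sum>j\<in>indices plus_set. \<Prod>k\<in>plus_set. ?M k $ j k $ j (\<pi> k))"
  proof (rule sum.cong[OF refl])
    fix j
    have "(\<Prod>c\<in>pos_cycles. if \<forall>k\<in>c. \<pi> k \<in> c then ?F c j else 0) = (\<Prod>c\<in>pos_cycles. ?F c j)"
      by (rule prod.cong[OF refl]) (use clos in simp)
    also have "\<dots> = (\<Prod>k\<in>\<Union>pos_cycles. ?M k $ j k $ j (\<pi> k))"
      by (subst prod.Union_disjoint)
        (use dis finite_orbit_premap in \<open>auto simp: disjoint_def pcycles_def\<close>)
    finally show "(\<Prod>c\<in>pos_cycles. if \<forall>k\<in>c. \<pi> k \<in> c then ?F c j else 0)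
        = (\<Prod>k\<in>plus_set. ?M k $ j k $ j (\<pi> k))" unfolding Un .
  qed
  also have "\<dots> = (\<Sum>j\<in>{j \<in> indices (signed I). block_const pair_part j}. \<Prod>k\<in>I. A k $ j k $ j (- k))"
  proof (rule sum.reindex_bij_witness[of _ "\<lambda>j. restrict j plus_set"
        "\<lambda>j. \<lambda>k\<in>signed I. if k \<in> plus_set then j k else j (\<pi> (- k))"], goal_cases)
    case (1 j)
    have "(\<lambda>k\<in>plus_set. (\<lambda>k\<in>signed I. if k \<in> plus_set then j k else j (\<pi> (- k))) k) k = j k" for k
      using PiE_arb[OF 1, of k] plus_set_subset by (cases "k \<in> plus_set") auto
    then show ?case by blast
  next
    case (2 j)
    let ?j = "\<lambda>k\<in>signed I. if k \<in> plus_set then j k else j (\<pi> (- k))"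
    have "?j (- k) = ?j (\<pi> k)" if k: "k \<in> signed I" for k
    proof (cases "k \<in> plus_set")
      case True
      then have "- k \<notin> plus_set" "\<pi> k \<in> plus_set" using plus_set_neg[OF k] plus_set_image by auto
      then show ?thesis using k signed_neg_iff in_signed by simp
    next
      case False
      then have "- k \<in> plus_set" "\<pi> k \<notin> plus_set" using plus_set_neg[OF k] plus_set_image by auto
      then show ?thesis using k signed_neg_iff in_signed neg_neg[of "- k"] by simp
    qed
    then show ?case by (auto simp: block_const_pair_part)
  next
    case (3 j)
    then have j: "j \<in> indices (signed I)" and bc: "\<And>k. k \<in> signed I \<Longrightarrow> j (- k) = j (\<pi> k)"
      by (auto simp: block_const_pair_part)
    have "(\<lambda>k\<in>signed I. if k \<in> plus_set then restrict j plus_set k else restrict j plus_set (\<pi> (- k))) k = j k" for k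
    proof (cases "k \<in> signed I")
      case True
      then have "k \<notin> plus_set \<Longrightarrow> \<pi> (- k) \<in> plus_set" using plus_set_neg plus_set_image by simp
      moreover have "j (\<pi> (- k)) = j k" using bc[of "- k"] True signed_neg_iff by simp
      ultimately show ?thesis using True by simp
    next
      case False
      then show ?thesis using PiE_arb[OF j, of k] by simp
    qed
    then show ?case by blast
  next
    case (4 j)
    then show ?case by auto
  next
    case (5 j)
    let ?j = "\<lambda>k\<in>signed I. if k \<in> plus_set then j k else j (\<pi> (- k))"
    have "(\<Prod>k\<in>I. A k $ ?j k $ ?j (- k)) = (\<Prod>k\<in>plus_set. A \<bar>k\<bar> $ ?j \<bar>k\<bar> $ ?j (- \<bar>k\<bar>))"
      by (rule prod.reindex_bij_betw[OF bij_abs_plus_set, symmetric])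
    also have "\<dots> = (\<Prod>k\<in>plus_set. ?M k $ j k $ j (\<pi> k))"
    proof (rule prod.cong[OF refl])
      fix k assume k: "k \<in> plus_set"
      then have kS: "k \<in> signed I" "- k \<in> signed I" "- k \<notin> plus_set" "k \<noteq> 0"
        using plus_set_subset plus_set_neg signed_neg_iff zero_notin by auto
      have "?j k = j k" "?j (- k) = j (\<pi> k)" using k kS by simp_all
      then show "A \<bar>k\<bar> $ ?j \<bar>k\<bar> $ ?j (- \<bar>k\<bar>) = ?M k $ j k $ j (\<pi> k)"
        using kS(4) by (cases "0 < k") (simp_all add: signed_mat_def transpose_def)
    qed
    finally show ?case .
  qed
  finally show ?thesis .
qed

end

section \<open>Matrix and vertex cumulants\<close>

lemma card_signed:
  assumes "finite V" and pos: "\<And>k. k \<in> V \<Longrightarrow> 0 < k"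
  shows "card (signed V) = 2 * card V"
proof -
  have "card (signed V) = card V + card (uminus ` V)"
    unfolding signed_def using assms(1) by (intro card_Un_disjoint positive_disjoint_neg pos) auto
  also have "card (uminus ` V) = card V" by (rule card_image) (simp add: inj_on_def)
  finally show ?thesis by simp
qed

text \<open>Pairing an expansion in the e_R with e_Q brings in the Gram matrix, which the Weingarten
  matrix then inverts.\<close>

lemma sum_block_const_expansion:
  fixes u :: "('a \<Rightarrow> 'N::finite) \<Rightarrow> complex"
  assumes fin: "finite S" and Q: "Q \<in> pair_partitions S"
    and u: "\<And>j. u j = (\<Sum>R\<in>pair_partitions S. \<alpha> R * of_bool (block_const R j))"
  shows "(\<Sum>j\<in>{j \<in> indices S. block_const Q j}. u j)
    = (\<Sum>R\<in>pair_partitions S. \<alpha> R * of_real (real CARD('N) ^ card (part_join S Q R)))"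
proof -
  let ?I = "{j \<in> indices S :: ('a \<Rightarrow> 'N) set. block_const Q j}"
  have finI: "finite ?I" using fin by (simp add: finite_PiE)
  have "(\<Sum>j\<in>?I. u j) = (\<Sum>R\<in>pair_partitions S. \<Sum>j\<in>?I. \<alpha> R * of_bool (block_const R j))"
    unfolding u by (rule sum.swap)
  also have "\<dots> = (\<Sum>R\<in>pair_partitions S. \<alpha> R * of_real (real CARD('N) ^ card (part_join S Q R)))"
  proof (rule sum.cong[OF refl])
    fix R assume R: "R \<in> pair_partitions S"
    have "(\<Sum>j\<in>?I. \<alpha> R * of_bool (block_const R j)) = \<alpha> R * of_nat (card {j \<in> ?I. block_const R j})"
      using finI by (simp add: sum_distrib_left[symmetric] Int_def)
    also have "{j \<in> ?I. block_const R j} = {j \<in> indices S. block_const Q j \<and> block_const R j}" by auto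
    also have "card \<dots> = CARD('N) ^ card (part_join S Q R)"
      by (rule card_block_const[OF fin]) (use Q R in \<open>auto simp: pair_partitions_def\<close>)
    finally show "(\<Sum>j\<in>?I. \<alpha> R * of_bool (block_const R j))
        = \<alpha> R * of_real (real CARD('N) ^ card (part_join S Q R))" by simp
  qed
  finally show ?thesis .
qed

lemma integral_tr_premap:
  fixes X :: "int \<Rightarrow> 'w \<Rightarrow> complex^'N^'N"
  assumes "premap V \<pi>" and M: "prob_space M" and rm: "\<And>k. k \<in> V \<Longrightarrow> random_matrix M (X k)"
  shows "(\<integral>\<omega>. tr_premap V \<pi> (\<lambda>k. X k \<omega>) \<partial>M)
    = (\<Sum>j\<in>{j \<in> indices (signed V). block_const (premap.pair_part V \<pi>) j}. mixed_moment M X V j)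
      / of_nat CARD('N) ^ card {c \<in> pcycles V \<pi>. positive_cycle c}"
proof -
  interpret premap V \<pi> by fact
  have "integrable M (\<lambda>\<omega>. \<Prod>k\<in>V. X k \<omega> $ j k $ j (- k))" for j
    by (rule integrable_entries[OF M rm])
  then show ?thesis
    unfolding tr_premap_eq mixed_moment_def
    by (simp add: Bochner_Integration.integral_sum)
qed

text \<open>
  All powers of \<open>N\<close> in the definition of the matrix cumulant combine to a factor depending only on \<open>\<rho>\<close>,
  so that the cumulants are, up to this factor, the coordinates of the invariant tensor of mixed
  moments with respect to the pair partitions; the coordinate at \<open>\<rho>\<close> is an entry of the tensor.
\<close>

lemma matrix_cumulant_eq:
  fixes X :: "int \<Rightarrow> 'w \<Rightarrow> complex^'N^'N"
  assumes pm: "premap V \<rho>" and small: "card V \<le> CARD('N)" and M: "prob_space M"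
    and rm: "\<And>k. k \<in> V \<Longrightarrow> random_matrix M (X k)"
    and inv: "orth_invariant (signed V) (mixed_moment M X V)"
    and i: "\<And>k l. k \<in> signed V \<Longrightarrow> l \<in> signed V \<Longrightarrow>
      i k = i l \<longleftrightarrow> block_of (premap.pair_part V \<rho>) k = block_of (premap.pair_part V \<rho>) l"
  shows "matrix_cumulant M X V \<rho>
    = of_real (real CARD('N) powr (real (card V) - real (card (pcycles V \<rho>)) / 2)) * mixed_moment M X V i"
proof -
  interpret rho: premap V \<rho> by fact
  let ?S = "signed V" and ?n = "card V" and ?N = "real CARD('N)" and ?u = "mixed_moment M X V"
  let ?PP = "pair_partitions ?S" and ?c = "?N powr (real (card V) - real (card (pcycles V \<rho>)) / 2)"
  have fin: "finite V" and pos: "\<And>k. k \<in> V \<Longrightarrow> 0 < k" using rho.finite_I rho.pos_I by auto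
  have finS: "finite ?S" by (rule rho.finite_signed)
  have cS: "card ?S = 2 * ?n" by (rule card_signed[OF fin pos])
  have smallS: "card ?S \<le> 2 * CARD('N)" using cS small by simp
  have pmI: "premap V \<pi>" if "\<pi> \<in> premaps V" for \<pi> using fin pos that by unfold_locales auto
  obtain h where h: "bij_betw h ?S {1..2 * ?n}"
    using finite_same_card_bij[OF finS, of "{1..2 * ?n}"] cS by auto
  define W where "W P Q = weingarten_matrix CARD('N) ?n ((`) h ` P) ((`) h ` Q)" for P Q
  have Winv: "(\<Sum>Q\<in>?PP. W P Q * ?N ^ card (part_join ?S Q R)) = of_bool (P = R)" if "P \<in> ?PP" "R \<in> ?PP" for P R
    unfolding W_def by (rule weingarten_matrix_inverse_transport[OF small h that])
  have "\<exists>g :: int \<Rightarrow> 'N. \<forall>k\<in>?S. \<forall>l\<in>?S. g k = g l \<longleftrightarrow> block_of P k = block_of P l" if P: "P \<in> ?PP" for P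
  proof -
    obtain g :: "int \<Rightarrow> 'N" where g: "\<And>k l. k \<in> ?S \<Longrightarrow> l \<in> ?S \<Longrightarrow> g k = g l \<longleftrightarrow> block_of P k = block_of P l"
      and "\<And>Q. Q \<in> ?PP \<Longrightarrow> block_const Q g \<longleftrightarrow> Q = P"
      by (rule ex_dual_index[OF finS P smallS]) blast
    from g show ?thesis by blast
  qed
  then obtain g :: "int set set \<Rightarrow> int \<Rightarrow> 'N" where
    g: "\<And>P k l. P \<in> ?PP \<Longrightarrow> k \<in> ?S \<Longrightarrow> l \<in> ?S \<Longrightarrow> g P k = g P l \<longleftrightarrow> block_of P k = block_of P l"
    by metis
  have exp: "?u j = (\<Sum>R\<in>?PP. ?u (g R) * of_bool (block_const R j))" for j
    by (rule orth_invariant_expansion[OF finS smallS inv g])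
  have summand: "of_real (?N powr (euler_char V \<rho> \<pi> - real (card (pcycles V \<rho>)))
       * normalized_Weingarten CARD('N) (premap_part V (kreweras \<rho> \<pi>)))
     * (\<integral>\<omega>. tr_premap V \<pi> (\<lambda>k. X k \<omega>) \<partial>M)
     = of_real ?c * (of_real (W rho.pair_part (premap.pair_part V \<pi>))
        * (\<Sum>j\<in>{j \<in> indices ?S. block_const (premap.pair_part V \<pi>) j}. ?u j))"
    if \<pi>: "\<pi> \<in> premaps V" for \<pi>
  proof -
    interpret pi: premap V \<pi> using pmI[OF \<pi>] .
    have K: "kreweras \<rho> \<pi> \<in> premaps V" by (rule kreweras_premap[OF fin rho.premap \<pi>])
    interpret K: premap V "kreweras \<rho> \<pi>" using pmI[OF K] .
    let ?U = "premap_part V (kreweras \<rho> \<pi>)"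
    have U: "card (\<Union>?U) = ?n" by (simp add: K.Union_premap_part)
    have "Weingarten CARD('N) ?U = W rho.pair_part pi.pair_part"
      unfolding W_def
    proof (rule Weingarten_eq[OF small U])
      have "(`) ((`) h) P \<in> pairings ?n" if "P \<in> ?PP" for P
        using image_pair_partitions[OF h] that unfolding pairings_eq bij_betw_def by blast
      then show "(`) h ` rho.pair_part \<in> pairings ?n" "(`) h ` pi.pair_part \<in> pairings ?n"
        using rho.pair_part pi.pair_part by auto
      show "join_type ?n ?U ((`) h ` rho.pair_part) ((`) h ` pi.pair_part)"
        by (rule join_type_kreweras[OF fin pos rho.premap \<pi> h])
    qed
    then have wg: "normalized_Weingarten CARD('N) ?U = ?N ^ (2 * ?n - card ?U) * W rho.pair_part pi.pair_part"
      by (simp add: normalized_Weingarten_def U)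
    \<comment> \<open>The exponent of N in \<open>normalized_Weingarten\<close> is a truncated
      subtraction; this bound makes it a true difference.\<close>
    have cU: "card ?U \<le> 2 * ?n"
      using cS card_image_le[OF finS, of "\<lambda>k. abs ` orbit (kreweras \<rho> \<pi>) k"]
      by (simp add: premap_part_def pcycles_def image_image)
    have N0: "?N > 0" by simp
    have "?N powr (euler_char V \<rho> \<pi> - real (card (pcycles V \<rho>))) * ?N ^ (2 * ?n - card ?U)
        = ?N powr (euler_char V \<rho> \<pi> - real (card (pcycles V \<rho>)) + real (2 * ?n - card ?U))"
      unfolding powr_add powr_realpow[OF N0] ..
    \<comment> \<open>Half the number of cycles of the Kreweras complement cancels against the
      number of blocks of its partition. What is left depends on \<rho> alone, apart from N to the
      number of positive cycles of \<pi>, which cancels the normalization of the traces.\<close>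
    also have "euler_char V \<rho> \<pi> - real (card (pcycles V \<rho>)) + real (2 * ?n - card ?U)
        = (real ?n - real (card (pcycles V \<rho>)) / 2) + real (card pi.pos_cycles)"
      using cU by (simp add: euler_char_def K.card_pcycles pi.card_pcycles K.card_premap_part of_nat_diff)
    also have "?N powr \<dots> = ?c * ?N ^ card pi.pos_cycles"
      unfolding powr_add powr_realpow[OF N0] ..
    finally have "?N powr (euler_char V \<rho> \<pi> - real (card (pcycles V \<rho>))) * normalized_Weingarten CARD('N) ?U
        = ?c * W rho.pair_part pi.pair_part * ?N ^ card pi.pos_cycles"
      unfolding wg by (simp add: mult_ac)
    moreover have "(\<integral>\<omega>. tr_premap V \<pi> (\<lambda>k. X k \<omega>) \<partial>M)
        = (\<Sum>j\<in>{j \<in> indices ?S. block_const pi.pair_part j}. ?u j) / of_nat CARD('N) ^ card pi.pos_cycles"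
      by (rule integral_tr_premap[OF pmI[OF \<pi>] M]) (rule rm)
    ultimately show ?thesis by simp
  qed
  let ?t = "\<lambda>\<pi>. of_real (W rho.pair_part (premap.pair_part V \<pi>))
      * (\<Sum>j\<in>{j \<in> indices ?S. block_const (premap.pair_part V \<pi>) j}. ?u j)"
  have "matrix_cumulant M X V \<rho> = (\<Sum>\<pi>\<in>premaps V. of_real ?c * ?t \<pi>)"
    unfolding matrix_cumulant_def by (rule sum.cong[OF refl summand])
  also have "\<dots> = of_real ?c * (\<Sum>\<pi>\<in>premaps V. ?t \<pi>)" by (rule sum_distrib_left[symmetric])
  also have "(\<Sum>\<pi>\<in>premaps V. ?t \<pi>) = (\<Sum>Q\<in>?PP. of_real (W rho.pair_part Q) * (\<Sum>j\<in>{j \<in> indices ?S. block_const Q j}. ?u j))"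
    by (rule sum.reindex_bij_betw[OF bij_betw_pair_part[OF fin pos]])
  also have "\<dots> = (\<Sum>Q\<in>?PP. \<Sum>R\<in>?PP. ?u (g R) * of_real (W rho.pair_part Q * ?N ^ card (part_join ?S Q R)))"
    by (rule sum.cong[OF refl]) (simp add: sum_block_const_expansion[OF finS _ exp] sum_distrib_left mult_ac)
  also have "\<dots> = (\<Sum>R\<in>?PP. \<Sum>Q\<in>?PP. ?u (g R) * of_real (W rho.pair_part Q * ?N ^ card (part_join ?S Q R)))"
    by (rule sum.swap)
  also have "\<dots> = (\<Sum>R\<in>?PP. if R = rho.pair_part then ?u (g R) else 0)"
  proof (rule sum.cong[OF refl])
    fix R assume "R \<in> ?PP"
    then show "(\<Sum>Q\<in>?PP. ?u (g R) * of_real (W rho.pair_part Q * ?N ^ card (part_join ?S Q R)))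
        = (if R = rho.pair_part then ?u (g R) else 0)"
      unfolding sum_distrib_left[symmetric] of_real_sum[symmetric] using Winv[OF rho.pair_part] by auto
  qed
  also have "\<dots> = ?u (g rho.pair_part)"
    using finite_pair_partitions[OF finS] rho.pair_part by simp
  also have "\<dots> = ?u i"
    by (rule orth_invariant_same_kernel[OF finS inv]) (use g[OF rho.pair_part] i in simp)
  finally show ?thesis .
qed

section \<open>Restriction of premaps to unions of cycles\<close>

lemma premap_restrict_eq: "k \<in> signed W \<Longrightarrow> \<pi> k \<in> signed W \<Longrightarrow> premap_restrict \<pi> W k = \<pi> k"
proof -
  assume k: "k \<in> signed W" "\<pi> k \<in> signed W"
  have "(LEAST m. 0 < m \<and> (\<pi> ^^ m) k \<in> signed W) = 1"
    by (rule Least_equality) (use k in auto)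
  then show ?thesis using k by (simp add: premap_restrict_def)
qed

text \<open>For W \<subseteq> I this says that W is a union of blocks of
  \<open>premap_part I \<pi>\<close>. The first return map \<open>premap_restrict \<pi> W\<close> is
  then \<pi> itself on \<open>signed W\<close>.\<close>

definition saturated :: "(int \<Rightarrow> int) \<Rightarrow> int set \<Rightarrow> bool" where
  "saturated \<pi> W \<longleftrightarrow> (\<forall>k\<in>signed W. \<pi> k \<in> signed W)"

lemma signed_mono: "W \<subseteq> T \<Longrightarrow> signed W \<subseteq> signed T" by (auto simp: signed_def)

context premap begin

lemma abs_cycles_disjoint:
  assumes k: "k \<in> signed I" and l: "l \<in> signed I" and x: "x \<in> abs ` orbit \<pi> k" "x \<in> abs ` orbit \<pi> l"
  shows "abs ` orbit \<pi> k = abs ` orbit \<pi> l"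
proof -
  obtain a b where ab: "a \<in> orbit \<pi> k" "x = \<bar>a\<bar>" "b \<in> orbit \<pi> l" "x = \<bar>b\<bar>" using x by blast
  then have "b = a \<or> b = - a" by auto
  moreover have "abs ` orbit \<pi> (- a) = abs ` orbit \<pi> a"
    unfolding orbit_neg image_image abs_minus_cancel ..
  ultimately have "abs ` orbit \<pi> a = abs ` orbit \<pi> b" by metis
  then show ?thesis using orbit_eq[OF ab(1)] orbit_eq[OF ab(3)] by simp
qed

lemma partition_on_premap_part: "partition_on I (premap_part I \<pi>)"
proof (rule partition_onI)
  fix A B assume AB: "A \<in> premap_part I \<pi>" "B \<in> premap_part I \<pi>" "A \<noteq> B"
  then obtain k l where "k \<in> signed I" "A = abs ` orbit \<pi> k" "l \<in> signed I" "B = abs ` orbit \<pi> l"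
    unfolding premap_part_def pcycles_def by blast
  then have "x \<notin> A \<or> x \<notin> B" for x using abs_cycles_disjoint[of k l x] AB(3) by metis
  then show "disjnt A B" unfolding disjnt_def by blast
next
  show "{} \<notin> premap_part I \<pi>" by (auto simp: premap_part_def pcycles_def) (metis orbit_nonempty)
qed (rule Union_premap_part)

text \<open>Expresses the range of summation of the vertex cumulant by a condition on single blocks,
  which a product over blocks can detect.\<close>

lemma refines_premap_part_iff:
  "refines I (premap_part I \<pi>) P \<longleftrightarrow> partition_on I P \<and> (\<forall>W\<in>P. saturated \<pi> W)"
proof
  assume ref: "refines I (premap_part I \<pi>) P"
  then have P: "partition_on I P" by (simp add: refines_def)
  have "saturated \<pi> W" if W: "W \<in> P" for W
    unfolding saturated_def
  proof
    fix k assume k: "k \<in> signed W"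
    have WI: "W \<subseteq> I" using W partition_onD1[OF P] by auto
    have kI: "k \<in> signed I" using k signed_mono[OF WI] by auto
    have kW: "\<bar>k\<bar> \<in> W" using k WI pos_I by (force simp: signed_def)
    have "abs ` orbit \<pi> k \<in> premap_part I \<pi>" using kI by (simp add: premap_part_def pcycles_def)
    then obtain Y where Y: "Y \<in> P" "abs ` orbit \<pi> k \<subseteq> Y" using ref by (auto simp: refines_def)
    then have "\<bar>k\<bar> \<in> Y" "\<bar>\<pi> k\<bar> \<in> Y" using orbit_self[of k] orbit.base[of \<pi> k] by auto
    then have "Y = W" using Y(1) W kW block_of_eq[OF P] by metis
    then have "\<bar>\<pi> k\<bar> \<in> W" using \<open>\<bar>\<pi> k\<bar> \<in> Y\<close> by simp
    then show "\<pi> k \<in> signed W" unfolding signed_def by (cases "0 \<le> \<pi> k") (auto intro: image_eqI[of _ _ "- \<pi> k"])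
  qed
  then show "partition_on I P \<and> (\<forall>W\<in>P. saturated \<pi> W)" using P by blast
next
  assume P: "partition_on I P \<and> (\<forall>W\<in>P. saturated \<pi> W)"
  show "refines I (premap_part I \<pi>) P"
    unfolding refines_def
  proof (intro conjI ballI partition_on_premap_part)
    fix B assume "B \<in> premap_part I \<pi>"
    then obtain k where k: "k \<in> signed I" "B = abs ` orbit \<pi> k"
      unfolding premap_part_def pcycles_def by blast
    then have "\<bar>k\<bar> \<in> \<Union>P" using signed_iff P partition_onD1[of I P] by auto
    then obtain W where W: "W \<in> P" "\<bar>k\<bar> \<in> W" by blast
    have WI: "W \<subseteq> I" using W P partition_onD1[of I P] by auto
    have kW: "k \<in> signed W" using W(2) unfolding signed_def
      by (cases "0 \<le> k") (auto intro: image_eqI[of _ _ "- k"])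
    have "l \<in> signed W" if "l \<in> orbit \<pi> k" for l
      using that by (induction rule: orbit.induct) (use P W kW in \<open>auto simp: saturated_def\<close>)
    moreover have "\<bar>l\<bar> \<in> W" if "l \<in> signed W" for l
      using that WI pos_I by (force simp: signed_def)
    ultimately show "\<exists>Y\<in>P. B \<subseteq> Y" using W(1) k by blast
  qed (use P in blast)
qed

text \<open>The restriction keeps the pairs of \<pi>, so an index with the blocks of
  \<open>pair_part\<close> as level sets suits all such restrictions at once. Its cycles are cycles
  of \<pi>, so that they can be counted block by block.\<close>

lemma premap_restrict_saturated:
  assumes W: "W \<subseteq> I" and sat: "saturated \<pi> W"
  shows "premap W (premap_restrict \<pi> W)"
    and "\<And>k. k \<in> signed W \<Longrightarrow> block_of (premap.pair_part W (premap_restrict \<pi> W)) k = {k, \<pi> (- k)}"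
    and "pcycles W (premap_restrict \<pi> W) = orbit \<pi> ` signed W"
proof -
  let ?r = "premap_restrict \<pi> W"
  have finW: "finite W" and posW: "\<And>k. k \<in> W \<Longrightarrow> 0 < k" using W finite_I finite_subset pos_I by blast+
  have fin: "finite (signed W)" using finW by (simp add: signed_def)
  have WS: "k \<in> signed I" if "k \<in> signed W" for k using that signed_mono[OF W] by blast
  have S: "- k \<in> signed W \<longleftrightarrow> k \<in> signed W" for k by (force simp: signed_def)
  have r: "?r k = \<pi> k" "\<pi> k \<in> signed W" if "k \<in> signed W" for k
    using that sat premap_restrict_eq by (auto simp: saturated_def)
  have r': "?r k = k" if "k \<notin> signed W" for k using that by (simp add: premap_restrict_def)
  have K_inv: "?r (- ?r (- k)) = k" for k
    using r[of "- k"] r(1)[of "- \<pi> (- k)"] r'[of "- k"] r'[of k] S by (cases "k \<in> signed W") simp_all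
  have K_inv': "- ?r (- ?r k) = k" for k using K_inv[of "- k"] by simp
  have bij: "bij ?r" by (rule o_bij[of "\<lambda>k. - ?r (- k)"]) (auto simp: fun_eq_iff K_inv K_inv')
  have perm: "?r permutes signed W" using bij r' unfolding permutes_def bij_iff by auto
  have inv_r: "inv ?r k = - ?r (- k)" for k
    using K_inv[of k] bij_is_inj[OF bij] by (intro inv_f_eq)
  have ne: "?r k \<noteq> - k" if "k \<in> signed W" for k
    using r(1)[OF that] neq_neg[of "- k"] WS[OF that] signed_neg_iff by simp
  have "?r \<in> premaps W"
    by (rule premapsI[OF perm finW posW]) (use inv_r ne in auto)
  then show pm: "premap W ?r" using finW posW by unfold_locales auto
  show "block_of (premap.pair_part W ?r) k = {k, \<pi> (- k)}" if "k \<in> signed W" for k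
    using premap.block_of_pair_part[OF pm that] r(1)[of "- k"] S that by simp
  have "orbit ?r k = orbit \<pi> k" if "k \<in> signed W" for k
    by (rule orbit_cong0[of k "signed W"]) (use that r in auto)
  then show "pcycles W ?r = orbit \<pi> ` signed W" unfolding pcycles_def by (rule image_cong[OF refl])
qed

end

lemma of_int_part_moebius:
  assumes "partition_on T P"
  shows "(of_int (part_moebius P {T}) :: complex) = signed_fact (card P)"
proof -
  have P: "U \<inter> T = U" "U \<noteq> {}" if "U \<in> P" for U
    using that partition_onD1[OF assms] partition_onD3[OF assms] by blast+
  have "part_restrict P T = (\<lambda>U. U \<inter> T) ` {U. U \<in> P \<and> U \<inter> T \<noteq> {}}"
    unfolding part_restrict_def by (rule setcompr_eq_image)
  also have "{U. U \<in> P \<and> U \<inter> T \<noteq> {}} = P" by (rule set_eqI) (simp add: P cong: conj_cong)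
  also have "(\<lambda>U. U \<inter> T) ` P = (\<lambda>U. U) ` P" by (rule image_cong) (simp_all add: P)
  finally have "part_restrict P T = P" by simp
  then show ?thesis by (simp add: part_moebius_def signed_fact_def)
qed

theorem lemma4p13:
  fixes M :: "'w measure" and X :: "int \<Rightarrow> 'w \<Rightarrow> complex^'N^'N"
    and n :: nat and I :: "int set" and \<pi> :: "int \<Rightarrow> int"
  assumes "prob_space M"
    and "2 \<le> n" and "n \<le> CARD('N)"
    and "\<And>k. k \<in> {1..int n} \<Longrightarrow> random_matrix M (X k)"
    and "I \<noteq> {}" and "I \<subset> {1..int n}"
    and "indep_orth_general_position M X {1..int n} I"
    and "\<pi> \<in> premaps {1..int n}"
  shows "vertex_cumulant M X n \<pi> = 0"
proof -
  let ?T = "{1..int n}" and ?N = "real CARD('N)"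
  note M = assms(1) and rm = assms(4) and gp = assms(7)
  interpret M: prob_space M by fact
  interpret premap ?T \<pi> using assms(8) by unfold_locales auto
  have smallS: "card (signed ?T) \<le> 2 * CARD('N)"
    using card_signed[OF finite_I pos_I] assms(3) by simp
  obtain i :: "int \<Rightarrow> 'N" where i: "\<And>k l. k \<in> signed ?T \<Longrightarrow> l \<in> signed ?T \<Longrightarrow>
      i k = i l \<longleftrightarrow> block_of pair_part k = block_of pair_part l"
    and "\<And>Q. Q \<in> pair_partitions (signed ?T) \<Longrightarrow> block_const Q i \<longleftrightarrow> Q = pair_part"
    by (rule ex_dual_index[OF finite_signed pair_part smallS]) blast
  define f where "f W = mixed_moment M X W i" for W
  have inv: "orth_invariant (signed W) (mixed_moment M X W)" if "W \<subseteq> ?T" for W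
    by (rule orth_invariant_mixed_moment[OF M rm gp _ _ that]) auto
  have f_unsat: "f W = 0" if W: "W \<subseteq> ?T" and unsat: "\<not> saturated \<pi> W" for W
  proof -
    have WS: "k \<in> signed ?T" if "k \<in> signed W" for k using that signed_mono[OF W] by blast
    obtain k0 where k0: "k0 \<in> signed W" "\<pi> k0 \<notin> signed W" using unsat by (auto simp: saturated_def)
    \<comment> \<open>The pair of k in \<pi> is {k, \<pi> (- k)}, so the change of sign makes the
      partner of k the element that leaves \<open>signed W\<close>. The value i k then occurs
      exactly once on \<open>signed W\<close>.\<close>
    define k where "k = - k0"
    have k: "k \<in> signed W" "\<pi> (- k) \<notin> signed W" using k0 by (auto simp: k_def signed_def)
    have "l = k" if l: "l \<in> signed W" "i l = i k" for l
    proof -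
      have "{l, \<pi> (- l)} = {k, \<pi> (- k)}"
        using i[of l k] WS l k block_of_pair_part by simp
      then show "l = k" using l(1) k(2) by (auto simp: doubleton_eq_iff)
    qed
    then have "{l \<in> signed W. i l = i k} = {k}" using k(1) by blast
    then have "odd (card {l \<in> signed W. i l = i k})" by simp
    moreover have "finite (signed W)" using finite_subset[OF signed_mono[OF W] finite_signed] .
    ultimately show ?thesis unfolding f_def using orth_invariant_odd inv[OF W] by blast
  qed
  have gp': "prob_space.indep_var M
       (PiM I (\<lambda>_. borel)) (\<lambda>\<omega>. \<lambda>k\<in>I. X k \<omega>)
       (PiM (?T - I) (\<lambda>_. borel)) (\<lambda>\<omega>. \<lambda>k\<in>?T - I. X k \<omega>)"
    using gp unfolding indep_orth_general_position_def by blast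
  have log0: "log_coeff f ?T = 0"
  proof (rule log_coeff_multiplicative[of ?T f I])
    show "f {} = 1" by (simp add: f_def mixed_moment_def M.prob_space)
    show "f V = f (V \<inter> I) * f (V - I)" if "V \<subseteq> ?T" for V
      unfolding f_def by (rule mixed_moment_indep[OF M rm _ gp' that]) auto
  qed (use assms(5,6) in auto)
  define c where "c = ?N powr (real n - real (card (pcycles ?T \<pi>)) / 2)"
  have part_cum: "part_cumulant M X P \<pi> = of_real c * (\<Prod>W\<in>P. f W)"
    if ref: "refines ?T (premap_part ?T \<pi>) P" for P
  proof -
    have P: "partition_on ?T P" and sat: "\<And>W. W \<in> P \<Longrightarrow> saturated \<pi> W"
      using ref refines_premap_part_iff by auto
    have sub: "W \<subseteq> ?T" if "W \<in> P" for W using that partition_onD1[OF P] by auto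
    have finP: "finite P" using finite_elements[OF finite_I P] .
    \<comment> \<open>The exponent of N belonging to a block. It adds up to the exponent in c,
      because the block sizes add up to n and each cycle of \<pi> lies over exactly one
      block.\<close>
    let ?e = "\<lambda>W. real (card W) - real (card (orbit \<pi> ` signed W)) / 2"
    have mc: "matrix_cumulant M X W (premap_restrict \<pi> W) = of_real (?N powr ?e W) * f W" if W: "W \<in> P" for W
    proof -
      note r = premap_restrict_saturated[OF sub[OF W] sat[OF W]]
      have "matrix_cumulant M X W (premap_restrict \<pi> W) = of_real (?N powr (real (card W)
          - real (card (pcycles W (premap_restrict \<pi> W))) / 2)) * mixed_moment M X W i"
      proof (rule matrix_cumulant_eq[OF r(1) _ M _ inv[OF sub[OF W]]])
        have "card W \<le> card ?T" by (rule card_mono[OF finite_I sub[OF W]])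
        then show "card W \<le> CARD('N)" using assms(3) by simp
        show "random_matrix M (X k)" if "k \<in> W" for k using rm sub[OF W] that by blast
        fix k l assume kl: "k \<in> signed W" "l \<in> signed W"
        then have "k \<in> signed ?T" "l \<in> signed ?T" using signed_mono[OF sub[OF W]] by auto
        then show "i k = i l \<longleftrightarrow> block_of (premap.pair_part W (premap_restrict \<pi> W)) k
            = block_of (premap.pair_part W (premap_restrict \<pi> W)) l"
          using i r(2) kl block_of_pair_part by simp
      qed
      then show ?thesis by (simp only: r(3) f_def)
    qed
    have "(\<Sum>W\<in>P. card W) = n"
    proof -
      have "card (\<Union>P) = (\<Sum>W\<in>P. card W)"
        by (rule card_Union_disjoint)
          (use partition_onD2[OF P] finite_subset[OF sub finite_I] in \<open>auto simp: disjoint_def pairwise_def disjnt_def\<close>)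
      then show ?thesis unfolding partition_onD1[OF P, symmetric] by simp
    qed
    moreover have "(\<Sum>W\<in>P. card (orbit \<pi> ` signed W)) = card (pcycles ?T \<pi>)"
    proof -
      have "signed ?T = (\<Union>W\<in>P. signed W)"
        using partition_onD1[OF P] by (auto simp: signed_def)
      then have "pcycles ?T \<pi> = (\<Union>W\<in>P. orbit \<pi> ` signed W)" by (simp add: pcycles_def image_UN)
      moreover have "card (\<Union>W\<in>P. orbit \<pi> ` signed W) = (\<Sum>W\<in>P. card (orbit \<pi> ` signed W))"
      proof (rule card_UN_disjoint[OF finP])
        show "\<forall>W\<in>P. finite (orbit \<pi> ` signed W)"
          using finite_subset[OF signed_mono[OF sub] finite_signed] by blast
        show "\<forall>W\<in>P. \<forall>V\<in>P. W \<noteq> V \<longrightarrow> orbit \<pi> ` signed W \<inter> orbit \<pi> ` signed V = {}"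
        proof (intro ballI impI)
          fix W V assume WV: "W \<in> P" "V \<in> P" "W \<noteq> V"
          have orb: "orbit \<pi> k \<subseteq> signed U" if U: "U \<in> P" and k: "k \<in> signed U" for U k
          proof
            fix l assume "l \<in> orbit \<pi> k"
            then show "l \<in> signed U"
              by (induction rule: orbit.induct) (use sat[OF U] k in \<open>auto simp: saturated_def\<close>)
          qed
          have abs_in: "\<bar>k\<bar> \<in> U" if "U \<in> P" "k \<in> signed U" for U k
            using that sub[OF that(1)] pos_I by (force simp: signed_def)
          have "False" if kl: "k \<in> signed W" "l \<in> signed V" "orbit \<pi> k = orbit \<pi> l" for k l
          proof -
            have "k \<in> signed V" using orb[OF WV(2) kl(2)] kl(3) orbit_self[of k] by auto
            then have "\<bar>k\<bar> \<in> W" "\<bar>k\<bar> \<in> V" using abs_in WV kl by auto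
            then show False using block_of_eq[OF P] WV by metis
          qed
          then show "orbit \<pi> ` signed W \<inter> orbit \<pi> ` signed V = {}" by blast
        qed
      qed
      ultimately show ?thesis by simp
    qed
    ultimately have "(\<Sum>W\<in>P. ?e W) = real n - real (card (pcycles ?T \<pi>)) / 2"
      by (simp add: sum_subtractf flip: of_nat_sum sum_divide_distrib)
    then have "(\<Prod>W\<in>P. ?N powr ?e W) = c"
      unfolding c_def using powr_sum[of ?N ?e P] finP by simp
    then have "(\<Prod>W\<in>P. complex_of_real (?N powr ?e W)) = of_real c"
      unfolding of_real_prod[symmetric] by simp
    moreover have "part_cumulant M X P \<pi> = (\<Prod>W\<in>P. of_real (?N powr ?e W) * f W)"
      unfolding part_cumulant_def by (rule prod.cong[OF refl mc])
    ultimately show ?thesis by (simp add: prod.distrib)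
  qed
  have "vertex_cumulant M X n \<pi> = (\<Sum>P\<in>{P. refines ?T (premap_part ?T \<pi>) P}.
      of_real c * (signed_fact (card P) * (\<Prod>W\<in>P. f W)))"
    unfolding vertex_cumulant_def
  proof (rule sum.cong[OF refl])
    fix P assume "P \<in> {P. refines ?T (premap_part ?T \<pi>) P}"
    then have ref: "refines ?T (premap_part ?T \<pi>) P" by simp
    then have "partition_on ?T P" by (simp add: refines_def)
    then show "of_int (part_moebius P {?T}) * part_cumulant M X P \<pi>
        = of_real c * (signed_fact (card P) * (\<Prod>W\<in>P. f W))"
      by (simp only: of_int_part_moebius part_cum[OF ref] mult_ac)
  qed
  \<comment> \<open>A partition that is not above \<Pi>(\<pi>) has an unsaturated block W, whose
    factor f W vanishes, so the sum may be completed to a classical cumulant.\<close>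
  also have "\<dots> = (\<Sum>P\<in>{P. partition_on ?T P}. of_real c * (signed_fact (card P) * (\<Prod>W\<in>P. f W)))"
  proof (rule sum.mono_neutral_left)
    show "finite {P. partition_on ?T P}" by (rule finitely_many_partition_on[OF finite_I])
    show "{P. refines ?T (premap_part ?T \<pi>) P} \<subseteq> {P. partition_on ?T P}" by (auto simp: refines_def)
    show "\<forall>P\<in>{P. partition_on ?T P} - {P. refines ?T (premap_part ?T \<pi>) P}.
        of_real c * (signed_fact (card P) * (\<Prod>W\<in>P. f W)) = 0"
    proof
      fix P assume "P \<in> {P. partition_on ?T P} - {P. refines ?T (premap_part ?T \<pi>) P}"
      then have P: "partition_on ?T P" "\<not> (\<forall>W\<in>P. saturated \<pi> W)" using refines_premap_part_iff by auto
      then obtain W where W: "W \<in> P" "\<not> saturated \<pi> W" by blast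
      have "W \<subseteq> ?T" using W(1) partition_onD1[OF P(1)] by auto
      then have "f W = 0" using f_unsat W(2) by blast
      then have "(\<Prod>W\<in>P. f W) = 0" using W(1) finite_elements[OF finite_I P(1)] by (intro prod_zero) auto
      then show "of_real c * (signed_fact (card P) * (\<Prod>W\<in>P. f W)) = 0" by simp
    qed
  qed
  also have "\<dots> = of_real c * log_coeff f ?T" by (simp add: log_coeff_def sum_distrib_left)
  also have "\<dots> = 0" using log0 by simp
  finally show ?thesis .
qed

end
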